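(* Let $\mu$ be a non-degenerate probability measure supported on $[0,1]$ with cumulant generating function $K(\theta)=\log\int e^{\theta x}\mu(dx)$, let $H_1$ be a single edge, and let $H_2$ be a finite simple graph with $p\ge 2$ edges such that the equation $K'''(\theta)K'(\theta)=-(p-2)\left(K''(\theta)\right)^2$ has exactly one solution $\theta\in\mathbb{R}$. Then there exist a point $(\beta_1^c,\beta_2^c)$ and a decreasing curve $\beta_2=r(\beta_1)$, $\beta_1\le\beta_1^c$, with endpoint $r(\beta_1^c)=\beta_2^c$, such that the parameter space $\{(\beta_1,\beta_2):\beta_2\ge 0\}$ of the $2$-parameter edge-weighted exponential random graph model with edge-weight distribution $\mu$ consists of a single phase with a first order phase transition across the curve $\beta_2=r(\beta_1)$ ($\beta_1<\beta_1^c$) and a second order phase transition at the critical point $(\beta_1^c,\beta_2^c)$.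
   Context: Model: $\mathcal{G}_n$ is the set of edge-weighted complete labeled graphs $G_n$ on $n$ vertices (undirected, no loops or multiple edges), where the edge weights $x_{ij}=x_{ji}$, $i<j$, are iid with distribution $\mu$ (and $x_{ii}=0$); this gives a probability measure $\mathbb{P}_n$ on $\mathcal{G}_n$ with expectation $\mathbb{E}_n$. The graphon of $G_n$ is $h^{G_n}:[0,1]^2\to[0,1]$, $h^{G_n}(x,y)=x_{\lceil nx\rceil\lceil ny\rceil}$. For a finite simple graph $H$ with vertex set $\{1,\dots,k\}$ and edge set $E(H)$, the homomorphism density is $t(H,G_n)=\int_{[0,1]^k}\prod_{\{i,j\}\in E(H)}h^{G_n}(x_i,x_j)\,dx_1\cdots dx_k$. The $2$-parameter exponential random graph model is the probability measure $\mathbb{P}_n^\beta$ on $\mathcal{G}_n$ with density $\exp\left(n^2\left(\beta_1t(H_1,G_n)+\beta_2t(H_2,G_n)-\psi_n^\beta\right)\right)$ with respect to $\mathbb{P}_n$, where $\psi_n^\beta=\frac{1}{n^2}\log\mathbb{E}_n\left(\exp\left(n^2(\beta_1t(H_1,G_n)+\beta_2t(H_2,G_n))\right)\right)$. The limiting normalization constant is $\psi_\infty^\beta=\lim_{n\to\infty}\psi_n^\beta$. It is known that for $\beta_2\ge 0$ this limit exists and $\psi_\infty^\beta=\sup_u\left(\beta_1u+\beta_2u^p-\frac12 I(u)\right)$, where $I(u)=\sup_{\theta\in\mathbb{R}}\{\theta u-K(\theta)\}$ and the supremum is over all $u$ with $I(u)<\infty$. Phases: a phase is a connected region of the parameter space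 $\{\beta\}$, maximal for the condition that $\psi_\infty^\beta$ is analytic. There is a $j$th-order transition at a boundary point of a phase if at least one $j$th-order partial derivative of $\psi_\infty^\beta$ is discontinuous there, while all lower order derivatives are continuous. *)

theory Defs
  imports "HOL-Probability.Probability"
begin

section \<open>Edge-weighted random graphs\<close>

text \<open>
  A finite simple graph \<open>(k, E)\<close> has vertex set \<open>{1..k}\<close>; its edges are two-element sets of vertices.
\<close>

type_synonym sgraph = "nat \<times> nat set set"

definition simple_graph :: "sgraph \<Rightarrow> bool" where
  "simple_graph H \<longleftrightarrow> (\<forall>e\<in>snd H. e \<subseteq> {1..fst H} \<and> card e = 2)"

definition single_edge :: sgraph where
  "single_edge = (2, {{1, 2}})"

text \<open>
  A weighted complete graph on \<open>{1..n}\<close> is given by its weights on the pairs \<open>i < j\<close>.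
\<close>

definition vertex_pairs :: "nat \<Rightarrow> (nat \<times> nat) set" where
  "vertex_pairs n = {(i, j). 1 \<le> i \<and> i < j \<and> j \<le> n}"

definition random_weights :: "real measure \<Rightarrow> nat \<Rightarrow> (nat \<times> nat \<Rightarrow> real) measure" where
  "random_weights \<mu> n = (\<Pi>\<^sub>M e\<in>vertex_pairs n. \<mu>)"

text \<open>
  The last case covers the diagonal, and also the index \<open>0\<close>, which the graphon below only
  uses when one of its arguments is \<open>0\<close>, hence on a null set.
\<close>

definition edge_weight :: "nat \<Rightarrow> (nat \<times> nat \<Rightarrow> real) \<Rightarrow> nat \<Rightarrow> nat \<Rightarrow> real" where
  "edge_weight n w i j =
     (if (i, j) \<in> vertex_pairs n then w (i, j)
      else if (j, i) \<in> vertex_pairs n then w (j, i)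
      else 0)"

definition graphon :: "nat \<Rightarrow> (nat \<times> nat \<Rightarrow> real) \<Rightarrow> real \<Rightarrow> real \<Rightarrow> real" where
  "graphon n w x y = edge_weight n w (nat \<lceil>real n * x\<rceil>) (nat \<lceil>real n * y\<rceil>)"

definition hom_density :: "sgraph \<Rightarrow> nat \<Rightarrow> (nat \<times> nat \<Rightarrow> real) \<Rightarrow> real" where
  "hom_density H n w =
     (LINT x:({1..fst H} \<rightarrow>\<^sub>E {0..1})|(\<Pi>\<^sub>M i\<in>{1..fst H}. lborel).
        (\<Prod>(i, j)\<in>{(i, j). i < j \<and> {i, j} \<in> snd H}. graphon n w (x i) (x j)))"


section \<open>The two-parameter exponential model\<close>

definition psi_n :: "real measure \<Rightarrow> sgraph \<Rightarrow> sgraph \<Rightarrow> nat \<Rightarrow> real \<times> real \<Rightarrow> real" where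
  "psi_n \<mu> H\<^sub>1 H\<^sub>2 n \<beta> =
     1 / (real n)\<^sup>2 *
       ln (LINT w|random_weights \<mu> n.
             exp ((real n)\<^sup>2 * (fst \<beta> * hom_density H\<^sub>1 n w + snd \<beta> * hom_density H\<^sub>2 n w)))"

definition psi_infinity :: "real measure \<Rightarrow> sgraph \<Rightarrow> sgraph \<Rightarrow> real \<times> real \<Rightarrow> real" where
  "psi_infinity \<mu> H\<^sub>1 H\<^sub>2 \<beta> = lim (\<lambda>n. psi_n \<mu> H\<^sub>1 H\<^sub>2 n \<beta>)"

definition cumulant_gf :: "real measure \<Rightarrow> real \<Rightarrow> real" where
  "cumulant_gf \<mu> \<theta> = ln (LINT x|\<mu>. exp (\<theta> * x))"

definition parameter_space :: "(real \<times> real) set" where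
  "parameter_space = {\<beta>. snd \<beta> \<ge> 0}"


section \<open>Phases and phase transitions\<close>

text \<open>
  Below, \<open>S\<close> is the parameter space and \<open>f\<close> the limiting normalization constant.  All notions
  are relative to \<open>S\<close>.  At a point of \<open>S\<close> on its topological boundary, analyticity means
  that \<open>f\<close> agrees, on a neighbourhood within \<open>S\<close>, with a convergent double power series, and
  partial derivatives are one-sided where necessary.
\<close>

definition analytic_within :: "(real \<times> real) set \<Rightarrow> (real \<times> real \<Rightarrow> real) \<Rightarrow> real \<times> real \<Rightarrow> bool" where
  "analytic_within S f b \<longleftrightarrow>
     (\<exists>(c :: nat \<Rightarrow> nat \<Rightarrow> real) \<rho>. \<rho> > 0 \<and>
        (\<forall>x y. (x, y) \<in> S \<longrightarrow> \<bar>x - fst b\<bar> < \<rho> \<longrightarrow> \<bar>y - snd b\<bar> < \<rho> \<longrightarrow>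
           ((\<lambda>(i, j). c i j * (x - fst b) ^ i * (y - snd b) ^ j) has_sum f (x, y)) UNIV))"

definition analytic_region :: "(real \<times> real) set \<Rightarrow> (real \<times> real \<Rightarrow> real) \<Rightarrow> (real \<times> real) set \<Rightarrow> bool" where
  "analytic_region S f P \<longleftrightarrow>
     openin (top_of_set S) P \<and> connected P \<and> P \<noteq> {} \<and> (\<forall>b\<in>P. analytic_within S f b)"

definition phase :: "(real \<times> real) set \<Rightarrow> (real \<times> real \<Rightarrow> real) \<Rightarrow> (real \<times> real) set \<Rightarrow> bool" where
  "phase S f P \<longleftrightarrow>
     analytic_region S f P \<and> (\<forall>Q. analytic_region S f Q \<longrightarrow> P \<subseteq> Q \<longrightarrow> Q = P)"

text \<open>
  \<open>has_partial S f vs b d\<close>: the iterated partial derivative of \<open>f\<close> in the coordinate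
  directions \<open>vs\<close> (the last one taken first) exists at \<open>b\<close> and equals \<open>d\<close>.
\<close>

primrec has_partial ::
  "(real \<times> real) set \<Rightarrow> (real \<times> real \<Rightarrow> real) \<Rightarrow> (real \<times> real) list \<Rightarrow> real \<times> real \<Rightarrow> real \<Rightarrow> bool"
where
  "has_partial S f [] = (\<lambda>b d. d = f b)"
| "has_partial S f (v # vs) = (\<lambda>b d.
     \<exists>g. (\<forall>\<^sub>F t in nhds 0. b + t *\<^sub>R v \<in> S \<longrightarrow> has_partial S f vs (b + t *\<^sub>R v) (g t)) \<and>
         (g has_real_derivative d) (at 0 within {t. b + t *\<^sub>R v \<in> S}))"

text \<open>
  At a boundary point \<open>b\<close> of a phase the derivatives that jump or blow up usually do not exist.
  So a derivative is discontinuous at \<open>b\<close> if, as a function on the phase, it has no finite limit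
  at \<open>b\<close>.  It is continuous at \<open>b\<close> if it exists at \<open>b\<close> and its values on the phase
  converge to its value there.
\<close>

definition partial_discontinuous ::
  "(real \<times> real) set \<Rightarrow> (real \<times> real \<Rightarrow> real) \<Rightarrow> (real \<times> real) set \<Rightarrow> (real \<times> real) list \<Rightarrow> real \<times> real \<Rightarrow> bool"
where
  "partial_discontinuous S f P vs b \<longleftrightarrow>
     (\<exists>g. (\<forall>x\<in>P. has_partial S f vs x (g x)) \<and> (\<nexists>l. (g \<longlongrightarrow> l) (at b within P)))"

definition partial_continuous ::
  "(real \<times> real) set \<Rightarrow> (real \<times> real \<Rightarrow> real) \<Rightarrow> (real \<times> real) set \<Rightarrow> (real \<times> real) list \<Rightarrow> real \<times> real \<Rightarrow> bool"
where
  "partial_continuous S f P vs b \<longleftrightarrow>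
     (\<exists>g. (\<forall>x\<in>insert b P. has_partial S f vs x (g x)) \<and> (g \<longlongrightarrow> g b) (at b within P))"

definition phase_transition ::
  "(real \<times> real) set \<Rightarrow> (real \<times> real \<Rightarrow> real) \<Rightarrow> (real \<times> real) set \<Rightarrow> nat \<Rightarrow> real \<times> real \<Rightarrow> bool"
where
  "phase_transition S f P j b \<longleftrightarrow>
     b \<in> top_of_set S frontier_of P \<and>
     (\<exists>vs\<in>lists Basis. length vs = j \<and> partial_discontinuous S f P vs b) \<and>
     (\<forall>vs\<in>lists Basis. length vs < j \<longrightarrow> partial_continuous S f P vs b)"

end

theory Submission
  imports Defs "HOL-Complex_Analysis.Complex_Analysis"
begin

text \<open>Let \<open>K\<close> be the cumulant generating function, and let \<open>u = K'(\<theta>)\<close> be the mean edge weight after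
exponential tilting by \<open>\<theta>\<close>.  The theorem follows from the scalar variational formula
\<open>\<psi>(\<beta>) = sup\<^sub>\<theta> (\<beta>\<^sub>1 u + \<beta>\<^sub>2 u^p - (\<theta> u - K(\<theta>)) / 2)\<close>, which is \<open>psi_n_tendsto\<close> below, and from calculus.

The lower bound in the formula is Gibbs' inequality for the product of tilted weights, under which
injective maps see independent edges (\<open>partition_lower\<close>).  For the upper bound (\<open>partition_upper\<close>),
the weak regularity lemma of Frieze and Kannan replaces a weighted graph by its averages over boundedly
many blocks, and the counting lemma says that homomorphism densities hardly change.  For a block graph
the arithmetic-geometric mean inequality bounds \<open>t(H, G)\<close> by the mean \<open>p\<close>-th power of the weights, and
finitely many tangents approximate \<open>x^p\<close> from below.  So up to a small error the exponent lies below
one of \<open>exp(o(n^2))\<close> linear functions of the independent weights.  The exponential moments of these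
factorize, and by convex duality each is at most \<open>exp(n^2 \<psi>(\<beta>) + o(n^2))\<close>.

For the calculus, put \<open>q = p K'^(p - 1)\<close>.  The derivative of the function to be maximized is \<open>K''\<close>
times \<open>slope(\<theta>) = \<beta>\<^sub>1 + \<beta>\<^sub>2 q(\<theta>) - \<theta> / 2\<close>.  The hypothesis on \<open>K\<close> says that \<open>q''\<close> has a single zero \<open>\<theta>\<^sub>0\<close>.
As \<open>q\<close> is increasing and bounded, it is a sigmoid that is steepest at \<open>\<theta>\<^sub>0\<close> (\<open>curvature_unimodal\<close>).
Hence \<open>slope\<close> is strictly decreasing if \<open>\<beta>\<^sub>2 \<le> 1 / (2 q'(\<theta>\<^sub>0))\<close>, and there is one maximizer.  For
larger \<open>\<beta>\<^sub>2\<close> there is at most one local maximum on either side of \<open>\<theta>\<^sub>0\<close>, and the two compete.  The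
\<open>gap\<close>, the right maximum minus the left maximum, is strictly increasing in both parameters, so for these
\<open>\<beta>\<^sub>2\<close> the two sides balance along the graph of a decreasing function, which ends at the critical point.

Off this curve the maximizer \<open>\<Theta>\<close> is unique and nondegenerate, and \<open>\<psi>\<close> is a Cauchy integral around
\<open>\<Theta>\<close> whose integrand is a quotient of polynomials in the parameters; expanding it yields a double power series
(\<open>analytic_on_pure_phase\<close>).  The first derivatives of \<open>\<psi>\<close> are \<open>K'(\<Theta>)\<close> and \<open>K'(\<Theta>)^p\<close>.  Across the
curve they jump from one maximizer to the other (\<open>density_jump\<close>).  At the critical point the two
maximizers merge, so the first derivatives are continuous there, but the second derivative
\<open>K''(\<Theta>) / (1/2 - \<beta>\<^sub>2 q'(\<Theta>))\<close> blows up (\<open>susceptibility_blow_up\<close>).  The sum of a power series has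
continuous derivatives, so \<open>\<psi>\<close> is analytic at no point of the curve.  The complement of the curve is
connected, because one can pass around the critical point; so it is the only phase.\<close>

section \<open>Averages over colour classes and weak regularity\<close>

definition class_average :: "'a set \<Rightarrow> ('a \<Rightarrow> 'k) \<Rightarrow> ('a \<Rightarrow> real) \<Rightarrow> 'a \<Rightarrow> real" where
  "class_average X \<kappa> h x = (\<Sum>y | y \<in> X \<and> \<kappa> y = \<kappa> x. h y) / real (card {y\<in>X. \<kappa> y = \<kappa> x})"

lemma class_average_cong: "\<kappa> x = \<kappa> y \<Longrightarrow> class_average X \<kappa> h x = class_average X \<kappa> h y"
  by (simp add: class_average_def)

lemma class_average_bounds:
  assumes "finite X" "x \<in> X" "\<And>y. y \<in> X \<Longrightarrow> 0 \<le> h y \<and> h y \<le> 1"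
  shows "0 \<le> class_average X \<kappa> h x" "class_average X \<kappa> h x \<le> 1"
proof -
  have "card {y\<in>X. \<kappa> y = \<kappa> x} > 0" using assms by (auto simp: card_gt_0_iff)
  moreover have "(\<Sum>y | y \<in> X \<and> \<kappa> y = \<kappa> x. h y) \<le> real (card {y\<in>X. \<kappa> y = \<kappa> x}) * 1"
    using assms by (intro sum_bounded_above) auto
  moreover have "0 \<le> (\<Sum>y | y \<in> X \<and> \<kappa> y = \<kappa> x. h y)"
    using assms by (intro sum_nonneg) auto
  ultimately show "0 \<le> class_average X \<kappa> h x" "class_average X \<kappa> h x \<le> 1"
    by (simp_all add: class_average_def divide_le_eq)
qed

text \<open>Averaging is the orthogonal projection onto the functions that are constant on colour
  classes; this is its defining property.\<close>

lemma class_average_pairing: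
  assumes "finite X" and f: "\<And>x y. x \<in> X \<Longrightarrow> y \<in> X \<Longrightarrow> \<kappa> x = \<kappa> y \<Longrightarrow> f x = f y"
  shows "(\<Sum>x\<in>X. class_average X \<kappa> h x * f x) = (\<Sum>x\<in>X. h x * f x)"
proof -
  define N where "N x = real (card {y\<in>X. \<kappa> y = \<kappa> x})" for x
  have "(\<Sum>x\<in>X. class_average X \<kappa> h x * f x) = (\<Sum>x\<in>X. \<Sum>y\<in>X. if \<kappa> y = \<kappa> x then h y * f x / N x else 0)"
    by (intro sum.cong refl)
      (auto simp: class_average_def N_def sum_distrib_right sum_divide_distrib sum.inter_filter assms(1) intro!: sum.cong)
  also have "\<dots> = (\<Sum>y\<in>X. \<Sum>x\<in>X. if \<kappa> y = \<kappa> x then h y * f x / N x else 0)"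
    by (rule sum.swap)
  also have "\<dots> = (\<Sum>y\<in>X. h y * f y)"
  proof (rule sum.cong[OF refl])
    fix y assume y: "y \<in> X"
    have "(\<Sum>x\<in>X. if \<kappa> y = \<kappa> x then h y * f x / N x else 0) = (\<Sum>x\<in>{x\<in>X. \<kappa> x = \<kappa> y}. h y * f y / N y)"
      unfolding sum.inter_filter[OF assms(1)]
    proof (rule sum.cong[OF refl])
      fix x assume x: "x \<in> X"
      have "f x = f y" "N x = N y" if "\<kappa> x = \<kappa> y" using f[OF x y that] that by (simp_all add: N_def)
      then show "(if \<kappa> y = \<kappa> x then h y * f x / N x else 0) = (if \<kappa> x = \<kappa> y then h y * f y / N y else 0)"
        by (cases "\<kappa> x = \<kappa> y") simp_all
    qed
    also have "\<dots> = N y * (h y * f y / N y)" by (simp add: N_def)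
    also have "\<dots> = h y * f y"
    proof -
      have "N y > 0" using assms(1) y by (auto simp: N_def card_gt_0_iff)
      then show ?thesis by simp
    qed
    finally show "(\<Sum>x\<in>X. if \<kappa> y = \<kappa> x then h y * f x / N x else 0) = h y * f y" .
  qed
  finally show ?thesis .
qed

text \<open>Pairs of vertices are coloured by the pair of colours of their endpoints.  With a bounded
  number of colours, the number of such colourings is exponential in the number of vertices and not in its
  square, which a union bound on the scale \<open>exp (n\<^sup>2)\<close> can afford.\<close>

definition block_average :: "nat set \<Rightarrow> (nat \<Rightarrow> nat) \<Rightarrow> (nat \<times> nat \<Rightarrow> real) \<Rightarrow> nat \<times> nat \<Rightarrow> real" where
  "block_average V c = class_average (V \<times> V) (map_prod c c)"

text \<open>Only an excess of \<open>h\<close> over its block averages is bounded: homomorphism sums of \<open>h\<close> will be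
  estimated from above.\<close>

definition cut_regular :: "nat set \<Rightarrow> real \<Rightarrow> (nat \<Rightarrow> nat) \<Rightarrow> (nat \<times> nat \<Rightarrow> real) \<Rightarrow> bool" where
  "cut_regular V \<epsilon> c h \<longleftrightarrow> (\<forall>S T. S \<subseteq> V \<longrightarrow> T \<subseteq> V \<longrightarrow>
     (\<Sum>x\<in>S \<times> T. h x - block_average V c h x) \<le> \<epsilon> * (real (card V))\<^sup>2)"

text \<open>A violated cut \<open>S \<times> T\<close> is a test function on which \<open>h\<close> and its averages differ.  Averages over
  a refinement that resolves \<open>S\<close> and \<open>T\<close> see the same difference, so they differ from the old averages
  by at least \<open>\<epsilon> (card V)\<close> in \<open>L\<^sup>2\<close> (Cauchy-Schwarz), and the squared norms differ accordingly
  (Pythagoras).\<close>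

lemma energy_increment:
  assumes V: "finite V" "V \<noteq> {}" and "\<epsilon> > 0" and irregular: "\<not> cut_regular V \<epsilon> c h"
  shows "\<exists>S T. \<forall>c'. (\<forall>i\<in>V. \<forall>j\<in>V. c' i = c' j \<longrightarrow> c i = c j \<and> (i \<in> S \<longleftrightarrow> j \<in> S) \<and> (i \<in> T \<longleftrightarrow> j \<in> T)) \<longrightarrow>
    (\<Sum>x\<in>V \<times> V. (block_average V c h x)\<^sup>2) + \<epsilon>\<^sup>2 * (real (card V))\<^sup>2 \<le> (\<Sum>x\<in>V \<times> V. (block_average V c' h x)\<^sup>2)"
proof -
  let ?X = "V \<times> V" and ?N = "real (card V)"
  have X: "finite ?X" using V by simp
  obtain S T where ST: "S \<subseteq> V" "T \<subseteq> V" and big: "\<epsilon> * ?N\<^sup>2 < (\<Sum>x\<in>S \<times> T. h x - block_average V c h x)"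
    using irregular by (auto simp: cut_regular_def not_le)
  show ?thesis
  proof (rule exI[of _ S], rule exI[of _ T], intro allI impI)
    fix c' :: "nat \<Rightarrow> nat" assume fine: "\<forall>i\<in>V. \<forall>j\<in>V. c' i = c' j \<longrightarrow> c i = c j \<and> (i \<in> S \<longleftrightarrow> j \<in> S) \<and> (i \<in> T \<longleftrightarrow> j \<in> T)"
    have fine_c: "c i = c j" and fine_S: "i \<in> S \<longleftrightarrow> j \<in> S" and fine_T: "i \<in> T \<longleftrightarrow> j \<in> T"
      if "i \<in> V" "j \<in> V" "c' i = c' j" for i j using fine that by blast+
    define a where "a = block_average V c h"
    define a' where "a' = block_average V c' h"
    define f where "f x = (if x \<in> S \<times> T then 1 else 0 :: real)" for x
    have pair': "(\<Sum>x\<in>?X. a' x * u x) = (\<Sum>x\<in>?X. h x * u x)"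
      if "\<And>x y. x \<in> ?X \<Longrightarrow> y \<in> ?X \<Longrightarrow> map_prod c' c' x = map_prod c' c' y \<Longrightarrow> u x = u y" for u
      unfolding a'_def block_average_def by (rule class_average_pairing[OF X that])
    have pair: "(\<Sum>x\<in>?X. a x * u x) = (\<Sum>x\<in>?X. h x * u x)"
      if "\<And>x y. x \<in> ?X \<Longrightarrow> y \<in> ?X \<Longrightarrow> map_prod c c x = map_prod c c y \<Longrightarrow> u x = u y" for u
      unfolding a_def block_average_def by (rule class_average_pairing[OF X that])
    have a_fine: "a x = a y" if "x \<in> ?X" "y \<in> ?X" "map_prod c' c' x = map_prod c' c' y" for x y
    proof -
      have "map_prod c c x = map_prod c c y"
        using that by (cases x; cases y) (auto intro: fine_c)
      then show ?thesis unfolding a_def block_average_def by (rule class_average_cong)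
    qed
    have f_fine: "f x = f y" if "x \<in> ?X" "y \<in> ?X" "map_prod c' c' x = map_prod c' c' y" for x y
    proof -
      obtain i j i' j' where xy: "x = (i, j)" "y = (i', j')" by fastforce
      have "i \<in> S \<longleftrightarrow> i' \<in> S" using that unfolding xy by (intro fine_S) auto
      moreover have "j \<in> T \<longleftrightarrow> j' \<in> T" using that unfolding xy by (intro fine_T) auto
      ultimately have "x \<in> S \<times> T \<longleftrightarrow> y \<in> S \<times> T" unfolding xy by simp
      then show ?thesis by (simp add: f_def)
    qed
    have a_own: "a x = a y" if "map_prod c c x = map_prod c c y" for x y
      unfolding a_def block_average_def using that by (rule class_average_cong)
    \<comment> \<open>\<open>a\<close> is the projection of \<open>a'\<close>, so it is orthogonal to \<open>a' - a\<close>\<close>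
    have "(\<Sum>x\<in>?X. a' x * a x) = (\<Sum>x\<in>?X. (a x)\<^sup>2)"
    proof -
      have "(\<Sum>x\<in>?X. a' x * a x) = (\<Sum>x\<in>?X. h x * a x)" by (rule pair'[OF a_fine])
      also have "\<dots> = (\<Sum>x\<in>?X. a x * a x)" by (rule pair[OF a_own, symmetric])
      finally show ?thesis by (simp add: power2_eq_square)
    qed
    then have diff: "(\<Sum>x\<in>?X. (a' x - a x)\<^sup>2) = (\<Sum>x\<in>?X. (a' x)\<^sup>2) - (\<Sum>x\<in>?X. (a x)\<^sup>2)"
      by (simp add: power2_diff sum.distrib sum_subtractf mult.assoc flip: sum_distrib_left)
    have "(\<Sum>x\<in>S \<times> T. h x - a x) = (\<Sum>x\<in>?X. (h x - a x) * f x)"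
      using ST X by (intro sum.mono_neutral_cong_left) (auto simp: f_def)
    also have "\<dots> = (\<Sum>x\<in>?X. (a' x - a x) * f x)"
    proof -
      have "(\<Sum>x\<in>?X. a' x * f x) = (\<Sum>x\<in>?X. h x * f x)" by (rule pair'[OF f_fine])
      then show ?thesis by (simp add: left_diff_distrib sum_subtractf)
    qed
    finally have "\<epsilon> * ?N\<^sup>2 < (\<Sum>x\<in>?X. (a' x - a x) * f x)" using big by (simp add: a_def)
    then have "(\<epsilon> * ?N\<^sup>2)\<^sup>2 \<le> (\<Sum>x\<in>?X. (a' x - a x) * f x)\<^sup>2"
      using \<open>\<epsilon> > 0\<close> by (intro power_mono) auto
    also have "\<dots> \<le> (\<Sum>x\<in>?X. (a' x - a x)\<^sup>2) * (\<Sum>x\<in>?X. (f x)\<^sup>2)" by (rule Cauchy_Schwarz_ineq_sum)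
    also have "\<dots> \<le> (\<Sum>x\<in>?X. (a' x - a x)\<^sup>2) * ?N\<^sup>2"
    proof (rule mult_left_mono)
      have "(\<Sum>x\<in>?X. (f x)\<^sup>2) \<le> real (card ?X) * 1" by (intro sum_bounded_above) (auto simp: f_def)
      then show "(\<Sum>x\<in>?X. (f x)\<^sup>2) \<le> ?N\<^sup>2" by (simp add: card_cartesian_product power2_eq_square)
    qed (simp add: sum_nonneg)
    finally have "(\<epsilon>\<^sup>2 * ?N\<^sup>2) * ?N\<^sup>2 \<le> (\<Sum>x\<in>?X. (a' x - a x)\<^sup>2) * ?N\<^sup>2"
      by (simp add: power2_eq_square mult_ac)
    moreover have "?N > 0" using V by (simp add: card_gt_0_iff)
    ultimately have "\<epsilon>\<^sup>2 * ?N\<^sup>2 \<le> (\<Sum>x\<in>?X. (a' x - a x)\<^sup>2)" by (simp add: mult_le_cancel_right)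
    then show "(\<Sum>x\<in>?X. (block_average V c h x)\<^sup>2) + \<epsilon>\<^sup>2 * ?N\<^sup>2 \<le> (\<Sum>x\<in>?X. (block_average V c' h x)\<^sup>2)"
      unfolding diff by (simp add: a_def a'_def)
  qed
qed

text \<open>The energy of the block averages never exceeds \<open>(card V)\<^sup>2\<close>, so about \<open>1 / \<epsilon>\<^sup>2\<close> refinements
  suffice.  The number \<open>M\<close> of colours therefore does not depend on the graph.\<close>

lemma weak_regularity:
  assumes "\<epsilon> > 0"
  obtains M :: nat where "M > 0" "\<And>(V :: nat set) h. finite V \<Longrightarrow> V \<noteq> {} \<Longrightarrow> (\<And>x. x \<in> V \<times> V \<Longrightarrow> 0 \<le> h x \<and> h x \<le> 1) \<Longrightarrow>
    \<exists>c. c ` V \<subseteq> {..<M} \<and> cut_regular V \<epsilon> c h"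
proof -
  \<comment> \<open>after \<open>m\<close> increments the energy would exceed its upper bound\<close>
  define m where "m = Suc (nat \<lceil>1 / \<epsilon>\<^sup>2\<rceil>)"
  have "real m > 1 / \<epsilon>\<^sup>2" unfolding m_def by linarith
  then have m: "real m * \<epsilon>\<^sup>2 > 1" using assms by (simp add: field_simps)
  show ?thesis
  proof (rule that[of "4 ^ m"])
    fix V :: "nat set" and h
    assume V: "finite V" "V \<noteq> {}" and h: "\<And>x. x \<in> V \<times> V \<Longrightarrow> 0 \<le> h x \<and> h x \<le> (1 :: real)"
    let ?N = "real (card V)"
    let ?E = "\<lambda>c. \<Sum>x\<in>V \<times> V. (block_average V c h x)\<^sup>2"
    have N: "?N > 0" using V by (simp add: card_gt_0_iff)
    have "\<exists>c. c ` V \<subseteq> {..<4 ^ k} \<and> (cut_regular V \<epsilon> c h \<or> real k * \<epsilon>\<^sup>2 * ?N\<^sup>2 \<le> ?E c)" for k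
    proof (induction k)
      case 0
      show ?case by (intro exI[of _ "\<lambda>_. 0"]) (auto intro!: sum_nonneg)
    next
      case (Suc k)
      then obtain c where c: "c ` V \<subseteq> {..<4 ^ k}" "cut_regular V \<epsilon> c h \<or> real k * \<epsilon>\<^sup>2 * ?N\<^sup>2 \<le> ?E c" by blast
      show ?case
      proof (cases "cut_regular V \<epsilon> c h")
        case True
        have "(4 :: nat) ^ k \<le> 4 ^ Suc k" by simp
        then have "c ` V \<subseteq> {..<4 ^ Suc k}" using c(1) by (meson lessThan_subset_iff order_trans)
        then show ?thesis using True by blast
      next
        case False
        from energy_increment[OF V assms False] obtain S T where inc: "\<And>c'. (\<forall>i\<in>V. \<forall>j\<in>V. c' i = c' j \<longrightarrow> c i = c j \<and> (i \<in> S \<longleftrightarrow> j \<in> S) \<and> (i \<in> T \<longleftrightarrow> j \<in> T))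
          \<Longrightarrow> ?E c + \<epsilon>\<^sup>2 * ?N\<^sup>2 \<le> ?E c'" by blast
        \<comment> \<open>the old colour together with the membership in \<open>S\<close> and in \<open>T\<close>\<close>
        define c' where "c' i = 4 * c i + (2 * of_bool (i \<in> S) + of_bool (i \<in> T))" for i
        have "c i = c j \<and> (i \<in> S \<longleftrightarrow> j \<in> S) \<and> (i \<in> T \<longleftrightarrow> j \<in> T)" if "c' i = c' j" for i j
          using that unfolding c'_def by (cases "i \<in> S"; cases "j \<in> S"; cases "i \<in> T"; cases "j \<in> T"; simp; presburger)
        then have "?E c + \<epsilon>\<^sup>2 * ?N\<^sup>2 \<le> ?E c'" by (intro inc) blast
        then have "real (Suc k) * \<epsilon>\<^sup>2 * ?N\<^sup>2 \<le> ?E c'" using c(2) False by (simp add: algebra_simps)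
        moreover have "c' i < 4 ^ Suc k" if "i \<in> V" for i
        proof -
          have "c i < 4 ^ k" using c(1) that by auto
          moreover have "2 * of_bool (i \<in> S) + of_bool (i \<in> T) \<le> (3 :: nat)" by simp
          ultimately show ?thesis unfolding c'_def power_Suc by linarith
        qed
        ultimately show ?thesis by (intro exI[of _ c']) auto
      qed
    qed
    from this[of m] obtain c where c: "c ` V \<subseteq> {..<4 ^ m}" "cut_regular V \<epsilon> c h \<or> real m * \<epsilon>\<^sup>2 * ?N\<^sup>2 \<le> ?E c" by blast
    have "?E c \<le> real (card (V \<times> V)) * 1"
    proof (rule sum_bounded_above)
      fix x assume "x \<in> V \<times> V"
      then show "(block_average V c h x)\<^sup>2 \<le> 1"
        using class_average_bounds[of "V \<times> V" x h] h V unfolding block_average_def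
        by (intro power_le_one) auto
    qed
    also have "\<dots> = ?N\<^sup>2" by (simp add: card_cartesian_product power2_eq_square)
    also have "\<dots> < real m * \<epsilon>\<^sup>2 * ?N\<^sup>2" using m N by simp
    finally show "\<exists>c. c ` V \<subseteq> {..<4 ^ m} \<and> cut_regular V \<epsilon> c h" using c by auto
  qed simp
qed

lemma sum_le_positive_part:
  fixes X a :: "'a \<Rightarrow> real"
  assumes "finite V" "\<And>i. i \<in> V \<Longrightarrow> 0 \<le> a i \<and> a i \<le> 1"
  shows "(\<Sum>i\<in>V. a i * X i) \<le> (\<Sum>i\<in>{i\<in>V. X i > 0}. X i)"
proof -
  have "(\<Sum>i\<in>V. a i * X i) \<le> (\<Sum>i\<in>V. if X i > 0 then X i else 0)"
  proof (rule sum_mono)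
    fix i assume "i \<in> V"
    then show "a i * X i \<le> (if X i > 0 then X i else 0)"
      using assms(2)[of i] mult_right_mono[of "a i" 1 "X i"] by (auto simp: mult_nonneg_nonpos)
  qed
  also have "\<dots> = (\<Sum>i\<in>{i\<in>V. X i > 0}. X i)" using assms(1) by (simp add: sum.inter_filter)
  finally show ?thesis .
qed

text \<open>A bilinear form on a product of cubes is maximal at vertices, that is, at a pair of
  indicator functions.\<close>

lemma cut_regular_weighted:
  assumes V: "finite V" and reg: "cut_regular V \<epsilon> c h"
    and a: "\<And>i. i \<in> V \<Longrightarrow> 0 \<le> a i \<and> a i \<le> 1" and b: "\<And>i. i \<in> V \<Longrightarrow> 0 \<le> b i \<and> b i \<le> (1 :: real)"
  shows "(\<Sum>i\<in>V. \<Sum>j\<in>V. a i * b j * (h (i, j) - block_average V c h (i, j))) \<le> \<epsilon> * (real (card V))\<^sup>2"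
proof -
  define D where "D i j = h (i, j) - block_average V c h (i, j)" for i j
  define S where "S = {i\<in>V. (\<Sum>j\<in>V. b j * D i j) > 0}"
  define T where "T = {j\<in>V. (\<Sum>i\<in>S. D i j) > 0}"
  have "(\<Sum>i\<in>V. \<Sum>j\<in>V. a i * b j * D i j) = (\<Sum>i\<in>V. a i * (\<Sum>j\<in>V. b j * D i j))"
    by (simp add: sum_distrib_left mult.assoc)
  also have "\<dots> \<le> (\<Sum>i\<in>S. \<Sum>j\<in>V. b j * D i j)"
    unfolding S_def using V a by (rule sum_le_positive_part)
  also have "\<dots> = (\<Sum>j\<in>V. b j * (\<Sum>i\<in>S. D i j))"
    by (subst sum.swap) (simp add: sum_distrib_left)
  also have "\<dots> \<le> (\<Sum>j\<in>T. \<Sum>i\<in>S. D i j)"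
    unfolding T_def using V b by (rule sum_le_positive_part)
  also have "\<dots> = (\<Sum>x\<in>S \<times> T. h x - block_average V c h x)"
    by (subst sum.swap) (simp add: sum.cartesian_product D_def case_prod_unfold)
  also have "\<dots> \<le> \<epsilon> * (real (card V))\<^sup>2"
    using reg unfolding cut_regular_def by (auto simp: S_def T_def)
  finally show ?thesis by (simp add: D_def)
qed

section \<open>Counting homomorphisms under a cut-norm error\<close>

lemma sum_PiE_insert:
  assumes "i \<notin> I"
  shows "(\<Sum>\<phi>\<in>insert i I \<rightarrow>\<^sub>E V. G \<phi>) = (\<Sum>\<psi>\<in>I \<rightarrow>\<^sub>E V. \<Sum>a\<in>V. G (\<psi>(i := a)))"
proof -
  have "(\<Sum>\<phi>\<in>insert i I \<rightarrow>\<^sub>E V. G \<phi>) = (\<Sum>(a, \<psi>)\<in>V \<times> (I \<rightarrow>\<^sub>E V). G (\<psi>(i := a)))"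
    unfolding PiE_insert_eq using inj_combinator[OF assms, of "\<lambda>_. V"]
    by (subst sum.reindex) (auto simp: case_prod_unfold o_def)
  also have "\<dots> = (\<Sum>\<psi>\<in>I \<rightarrow>\<^sub>E V. \<Sum>a\<in>V. G (\<psi>(i := a)))"
    unfolding sum.cartesian_product[symmetric] by (rule sum.swap)
  finally show ?thesis .
qed

lemma sum_PiE_two:
  assumes "finite I" "i \<in> I" "j \<in> I" "i \<noteq> j"
  shows "(\<Sum>\<phi>\<in>I \<rightarrow>\<^sub>E V. G \<phi>) = (\<Sum>\<psi>\<in>(I - {i, j}) \<rightarrow>\<^sub>E V. \<Sum>a\<in>V. \<Sum>b\<in>V. G (\<psi>(j := b, i := a)))"
proof -
  have I: "I = insert i (insert j (I - {i, j}))" using assms by auto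
  have "(\<Sum>\<phi>\<in>I \<rightarrow>\<^sub>E V. G \<phi>) = (\<Sum>\<psi>\<in>insert j (I - {i, j}) \<rightarrow>\<^sub>E V. \<Sum>a\<in>V. G (\<psi>(i := a)))"
    by (subst I, rule sum_PiE_insert) (use assms in auto)
  also have "\<dots> = (\<Sum>\<psi>\<in>(I - {i, j}) \<rightarrow>\<^sub>E V. \<Sum>b\<in>V. \<Sum>a\<in>V. G (\<psi>(j := b, i := a)))"
    by (rule sum_PiE_insert) auto
  also have "\<dots> = (\<Sum>\<psi>\<in>(I - {i, j}) \<rightarrow>\<^sub>E V. \<Sum>a\<in>V. \<Sum>b\<in>V. G (\<psi>(j := b, i := a)))"
    by (intro sum.cong refl sum.swap)
  finally show ?thesis .
qed

text \<open>No other edge contains both endpoints of \<open>e\<close>.  So once the remaining vertices are placed,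
  the other factors are a function of one endpoint times a function of the other, to which the cut bound
  applies.\<close>

lemma single_edge_replacement:
  fixes g :: "nat \<times> nat \<Rightarrow> nat \<times> nat \<Rightarrow> real"
  assumes V: "finite V" and reg: "cut_regular V \<epsilon> c h"
    and e: "fst e \<in> I" "snd e \<in> I" "fst e < snd e" and I: "finite I"
    and F: "finite F" "e \<notin> F" "\<And>e'. e' \<in> F \<Longrightarrow> fst e' \<in> I \<and> snd e' \<in> I \<and> fst e' < snd e'"
    and g: "\<And>e' x. e' \<in> F \<Longrightarrow> x \<in> V \<times> V \<Longrightarrow> 0 \<le> g e' x \<and> g e' x \<le> 1"
  shows "(\<Sum>\<phi>\<in>I \<rightarrow>\<^sub>E V. (h (\<phi> (fst e), \<phi> (snd e)) - block_average V c h (\<phi> (fst e), \<phi> (snd e))) *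
      (\<Prod>e'\<in>F. g e' (\<phi> (fst e'), \<phi> (snd e')))) \<le> \<epsilon> * real (card V) ^ card I"
proof -
  define i where "i = fst e"
  define j where "j = snd e"
  have ij: "i \<in> I" "j \<in> I" "i \<noteq> j" using e by (auto simp: i_def j_def)
  let ?I = "I - {i, j}"
  have cardI: "card I = card ?I + 2"
    using ij I card_Diff_subset[of "{i, j}" I] card_mono[of I "{i, j}"] by auto
  define D where "D a b = h (a, b) - block_average V c h (a, b)" for a b
  have "(\<Sum>a\<in>V. \<Sum>b\<in>V. D a b * (\<Prod>e'\<in>F. g e' ((\<psi>(j := b, i := a)) (fst e'), (\<psi>(j := b, i := a)) (snd e'))))
      \<le> \<epsilon> * (real (card V))\<^sup>2" if \<psi>: "\<psi> \<in> ?I \<rightarrow>\<^sub>E V" for \<psi>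
  proof (cases "V = {}")
    case False
    then obtain v where v: "v \<in> V" by blast
    \<comment> \<open>the edges that avoid \<open>j\<close>, and those that contain \<open>j\<close> and hence avoid \<open>i\<close>\<close>
    define F1 where "F1 = {e'\<in>F. fst e' \<noteq> j \<and> snd e' \<noteq> j}"
    define F2 where "F2 = {e'\<in>F. fst e' = j \<or> snd e' = j}"
    define A where "A a = (\<Prod>e'\<in>F1. g e' ((\<psi>(i := a)) (fst e'), (\<psi>(i := a)) (snd e')))" for a
    define B where "B b = (\<Prod>e'\<in>F2. g e' ((\<psi>(j := b)) (fst e'), (\<psi>(j := b)) (snd e')))" for b
    have F2: "fst e' \<noteq> i" "snd e' \<noteq> i" if "e' \<in> F2" for e'
    proof -
      have "e' \<in> F" "fst e' = j \<or> snd e' = j" using that by (auto simp: F2_def)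
      moreover have "i < j" using e by (simp add: i_def j_def)
      moreover have "e' \<noteq> e" using F(2) \<open>e' \<in> F\<close> by auto
      ultimately show "fst e' \<noteq> i" "snd e' \<noteq> i"
        using F(3)[of e'] by (auto simp: i_def j_def prod_eq_iff)
    qed
    have split: "(\<Prod>e'\<in>F. g e' ((\<psi>(j := b, i := a)) (fst e'), (\<psi>(j := b, i := a)) (snd e'))) = A a * B b" for a b
    proof -
      have "F = F1 \<union> F2" "F1 \<inter> F2 = {}" "finite F1" "finite F2" using F(1) by (auto simp: F1_def F2_def)
      then have "(\<Prod>e'\<in>F. g e' ((\<psi>(j := b, i := a)) (fst e'), (\<psi>(j := b, i := a)) (snd e'))) =
          (\<Prod>e'\<in>F1. g e' ((\<psi>(j := b, i := a)) (fst e'), (\<psi>(j := b, i := a)) (snd e'))) *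
          (\<Prod>e'\<in>F2. g e' ((\<psi>(j := b, i := a)) (fst e'), (\<psi>(j := b, i := a)) (snd e')))"
        by (simp add: prod.union_disjoint)
      also have "\<dots> = A a * B b"
        unfolding A_def B_def
        by (intro arg_cong2[where f = "(*)"] prod.cong refl) (use F2 in \<open>auto simp: F1_def\<close>)
      finally show ?thesis .
    qed
    have val: "(\<psi>(i := a)) u \<in> V" if "u \<in> I" "u \<noteq> j" "a \<in> V" for a u using \<psi> that by (auto simp: PiE_iff)
    have val': "(\<psi>(j := a)) u \<in> V" if "u \<in> I" "u \<noteq> i" "a \<in> V" for a u using \<psi> that by (auto simp: PiE_iff)
    have A: "0 \<le> A a \<and> A a \<le> 1" if "a \<in> V" for a
    proof -
      have "0 \<le> g e' ((\<psi>(i := a)) (fst e'), (\<psi>(i := a)) (snd e')) \<and> g e' ((\<psi>(i := a)) (fst e'), (\<psi>(i := a)) (snd e')) \<le> 1"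
        if "e' \<in> F1" for e'
      proof (rule g)
        show e': "e' \<in> F" using that by (simp add: F1_def)
        have "fst e' \<noteq> j" "snd e' \<noteq> j" using that by (simp_all add: F1_def)
        then have "(\<psi>(i := a)) (fst e') \<in> V" "(\<psi>(i := a)) (snd e') \<in> V"
          using F(3)[OF e'] \<open>a \<in> V\<close> val[of "fst e'" a] val[of "snd e'" a] by blast+
        then show "((\<psi>(i := a)) (fst e'), (\<psi>(i := a)) (snd e')) \<in> V \<times> V" by (rule SigmaI)
      qed
      then show ?thesis unfolding A_def by (auto intro: prod_nonneg prod_le_1)
    qed
    have B: "0 \<le> B b \<and> B b \<le> 1" if "b \<in> V" for b
    proof -
      have "0 \<le> g e' ((\<psi>(j := b)) (fst e'), (\<psi>(j := b)) (snd e')) \<and> g e' ((\<psi>(j := b)) (fst e'), (\<psi>(j := b)) (snd e')) \<le> 1"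
        if "e' \<in> F2" for e'
      proof (rule g)
        show e': "e' \<in> F" using that by (simp add: F2_def)
        have "(\<psi>(j := b)) (fst e') \<in> V" "(\<psi>(j := b)) (snd e') \<in> V"
          using F(3)[OF e'] F2[OF that] \<open>b \<in> V\<close> val'[of "fst e'" b] val'[of "snd e'" b] by blast+
        then show "((\<psi>(j := b)) (fst e'), (\<psi>(j := b)) (snd e')) \<in> V \<times> V" by (rule SigmaI)
      qed
      then show ?thesis unfolding B_def by (auto intro: prod_nonneg prod_le_1)
    qed
    have "(\<Sum>a\<in>V. \<Sum>b\<in>V. A a * B b * (h (a, b) - block_average V c h (a, b))) \<le> \<epsilon> * (real (card V))\<^sup>2"
      by (rule cut_regular_weighted[OF V reg A B])
    then show ?thesis unfolding split D_def by (simp add: mult_ac)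
  qed simp
  then have "(\<Sum>\<psi>\<in>?I \<rightarrow>\<^sub>E V. \<Sum>a\<in>V. \<Sum>b\<in>V. D a b *
        (\<Prod>e'\<in>F. g e' ((\<psi>(j := b, i := a)) (fst e'), (\<psi>(j := b, i := a)) (snd e'))))
      \<le> real (card (?I \<rightarrow>\<^sub>E V)) * (\<epsilon> * (real (card V))\<^sup>2)"
    by (rule sum_bounded_above)
  also have "card (?I \<rightarrow>\<^sub>E V) = card V ^ card ?I" using I by (simp add: card_PiE)
  also have "real (card V ^ card ?I) * (\<epsilon> * (real (card V))\<^sup>2) = \<epsilon> * real (card V) ^ card I"
    unfolding cardI power_add by simp
  finally have bound: "(\<Sum>\<psi>\<in>?I \<rightarrow>\<^sub>E V. \<Sum>a\<in>V. \<Sum>b\<in>V. D a b *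
        (\<Prod>e'\<in>F. g e' ((\<psi>(j := b, i := a)) (fst e'), (\<psi>(j := b, i := a)) (snd e'))))
      \<le> \<epsilon> * real (card V) ^ card I" .
  have at: "(\<psi>(j := b, i := a)) i = a" "(\<psi>(j := b, i := a)) j = b" for \<psi> :: "nat \<Rightarrow> nat" and a b
    using ij by auto
  show ?thesis
    unfolding i_def[symmetric] j_def[symmetric] sum_PiE_two[OF I ij] at
    using bound unfolding D_def .
qed

text \<open>The weights on the edges are replaced by block averages one edge at a time.\<close>

lemma counting_lemma:
  fixes I :: "nat set" and E :: "(nat \<times> nat) set"
  assumes V: "finite V" and reg: "cut_regular V \<epsilon> c h" and I: "finite I"
    and h: "\<And>x. x \<in> V \<times> V \<Longrightarrow> 0 \<le> h x \<and> h x \<le> 1"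
    and E: "finite E" "\<And>e. e \<in> E \<Longrightarrow> fst e \<in> I \<and> snd e \<in> I \<and> fst e < snd e"
  shows "(\<Sum>\<phi>\<in>I \<rightarrow>\<^sub>E V. \<Prod>e\<in>E. h (\<phi> (fst e), \<phi> (snd e))) \<le>
    (\<Sum>\<phi>\<in>I \<rightarrow>\<^sub>E V. \<Prod>e\<in>E. block_average V c h (\<phi> (fst e), \<phi> (snd e)))
      + real (card E) * (\<epsilon> * real (card V) ^ card I)"
proof -
  let ?a = "block_average V c h"
  have a: "0 \<le> ?a x \<and> ?a x \<le> 1" if "x \<in> V \<times> V" for x
    using class_average_bounds[of "V \<times> V" x h] h V that unfolding block_average_def by auto
  have "(\<Sum>\<phi>\<in>I \<rightarrow>\<^sub>E V. (\<Prod>e\<in>F. h (\<phi> (fst e), \<phi> (snd e))) * (\<Prod>e\<in>G. ?a (\<phi> (fst e), \<phi> (snd e)))) \<le>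
    (\<Sum>\<phi>\<in>I \<rightarrow>\<^sub>E V. \<Prod>e\<in>F \<union> G. ?a (\<phi> (fst e), \<phi> (snd e))) + real (card F) * (\<epsilon> * real (card V) ^ card I)"
    if "finite F" "F \<subseteq> E" "G \<subseteq> E" "F \<inter> G = {}" for F G
    using that
  proof (induction F arbitrary: G rule: finite_induct)
    case (insert e F)
    let ?C = "\<epsilon> * real (card V) ^ card I"
    let ?g = "\<lambda>e'. if e' \<in> F then h else ?a"
    have G: "finite G" using insert.prems E(1) finite_subset by auto
    have FG: "(\<Prod>e\<in>F. h (\<phi> (fst e), \<phi> (snd e))) * (\<Prod>e\<in>G. ?a (\<phi> (fst e), \<phi> (snd e))) =
        (\<Prod>e'\<in>F \<union> G. ?g e' (\<phi> (fst e'), \<phi> (snd e')))" for \<phi>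
    proof -
      have "(\<Prod>e\<in>F. h (\<phi> (fst e), \<phi> (snd e))) = (\<Prod>e'\<in>F. ?g e' (\<phi> (fst e'), \<phi> (snd e')))"
        by (intro prod.cong) auto
      moreover have "(\<Prod>e\<in>G. ?a (\<phi> (fst e), \<phi> (snd e))) = (\<Prod>e'\<in>G. ?g e' (\<phi> (fst e'), \<phi> (snd e')))"
        using insert.prems by (intro prod.cong) auto
      ultimately show ?thesis using insert.hyps G insert.prems by (subst prod.union_disjoint) auto
    qed
    have "(\<Sum>\<phi>\<in>I \<rightarrow>\<^sub>E V. (\<Prod>e\<in>insert e F. h (\<phi> (fst e), \<phi> (snd e))) * (\<Prod>e\<in>G. ?a (\<phi> (fst e), \<phi> (snd e)))) =
       (\<Sum>\<phi>\<in>I \<rightarrow>\<^sub>E V. (h (\<phi> (fst e), \<phi> (snd e)) - ?a (\<phi> (fst e), \<phi> (snd e))) *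
          (\<Prod>e'\<in>F \<union> G. ?g e' (\<phi> (fst e'), \<phi> (snd e')))) +
       (\<Sum>\<phi>\<in>I \<rightarrow>\<^sub>E V. (\<Prod>e\<in>F. h (\<phi> (fst e), \<phi> (snd e))) * (\<Prod>e\<in>insert e G. ?a (\<phi> (fst e), \<phi> (snd e))))"
      unfolding sum.distrib[symmetric] FG[symmetric]
    proof (rule sum.cong[OF refl])
      fix \<phi>
      have "e \<notin> G" using insert.prems by auto
      then show "(\<Prod>e\<in>insert e F. h (\<phi> (fst e), \<phi> (snd e))) * (\<Prod>e\<in>G. ?a (\<phi> (fst e), \<phi> (snd e))) =
        (h (\<phi> (fst e), \<phi> (snd e)) - ?a (\<phi> (fst e), \<phi> (snd e))) *
        ((\<Prod>e\<in>F. h (\<phi> (fst e), \<phi> (snd e))) * (\<Prod>e\<in>G. ?a (\<phi> (fst e), \<phi> (snd e)))) +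
        (\<Prod>e\<in>F. h (\<phi> (fst e), \<phi> (snd e))) * (\<Prod>e\<in>insert e G. ?a (\<phi> (fst e), \<phi> (snd e)))"
        using insert.hyps G by (simp add: algebra_simps)
    qed
    also have "\<dots> \<le> ?C + ((\<Sum>\<phi>\<in>I \<rightarrow>\<^sub>E V. \<Prod>e\<in>F \<union> insert e G. ?a (\<phi> (fst e), \<phi> (snd e))) + real (card F) * ?C)"
    proof (rule add_mono)
      show "(\<Sum>\<phi>\<in>I \<rightarrow>\<^sub>E V. (h (\<phi> (fst e), \<phi> (snd e)) - ?a (\<phi> (fst e), \<phi> (snd e))) *
          (\<Prod>e'\<in>F \<union> G. ?g e' (\<phi> (fst e'), \<phi> (snd e')))) \<le> ?C"
      proof (rule single_edge_replacement[OF V reg, where e = e and F = "F \<union> G" and I = I and g = "?g"])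
        show "fst e' \<in> I \<and> snd e' \<in> I \<and> fst e' < snd e'" if "e' \<in> F \<union> G" for e'
          using that insert.prems E(2) by blast
        show "fst e \<in> I" "snd e \<in> I" "fst e < snd e" using E(2)[of e] insert.prems by auto
        show "finite (F \<union> G)" "e \<notin> F \<union> G" using insert G by auto
        show "0 \<le> ?g e' x \<and> ?g e' x \<le> 1" if "x \<in> V \<times> V" for e' x using h[OF that] a[OF that] by simp
      qed (rule I)
      show "(\<Sum>\<phi>\<in>I \<rightarrow>\<^sub>E V. (\<Prod>e\<in>F. h (\<phi> (fst e), \<phi> (snd e))) * (\<Prod>e\<in>insert e G. ?a (\<phi> (fst e), \<phi> (snd e)))) \<le>
        (\<Sum>\<phi>\<in>I \<rightarrow>\<^sub>E V. \<Prod>e\<in>F \<union> insert e G. ?a (\<phi> (fst e), \<phi> (snd e))) + real (card F) * ?C"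
        using insert.prems insert.hyps by (intro insert.IH) auto
    qed
    finally show ?case using insert.hyps by (simp add: algebra_simps)
  qed simp
  from this[of E "{}"] E(1) show ?thesis by simp
qed

text \<open>For a block graph this bounds the homomorphism density by a mean of \<open>p\<close>-th powers; of the
  shape of the graph only its number of edges survives.\<close>

lemma prod_le_mean_power:
  fixes x :: "'a \<Rightarrow> real"
  assumes "finite E" "E \<noteq> {}" "\<And>e. e \<in> E \<Longrightarrow> 0 \<le> x e"
  shows "(\<Prod>e\<in>E. x e) \<le> (\<Sum>e\<in>E. x e ^ card E) / real (card E)"
proof -
  let ?p = "card E"
  let ?y = "\<Prod>e\<in>E. x e"
  have p: "?p > 0" using assms by (simp add: card_gt_0_iff)
  have y: "0 \<le> ?y" using assms(3) by (intro prod_nonneg) auto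
  have "?y = (?y ^ ?p) powr (1 / real ?p)"
  proof (cases "?y = 0")
    case False
    then have "?y > 0" using y by simp
    then have "(?y ^ ?p) powr (1 / real ?p) = (?y powr real ?p) powr (1 / real ?p)"
      by (simp add: powr_realpow)
    then show ?thesis using \<open>?y > 0\<close> p by (simp add: powr_powr)
  qed (use p in simp)
  also have "?y ^ ?p = (\<Prod>e\<in>E. x e ^ ?p)" by (simp add: prod_power_distrib)
  also have "\<dots> powr (1 / real ?p) \<le> (\<Sum>e\<in>E. x e ^ ?p / real ?p)"
    using assms by (intro arith_geom_mean) auto
  also have "\<dots> = (\<Sum>e\<in>E. x e ^ ?p) / real ?p" by (simp add: sum_divide_distrib)
  finally show ?thesis .
qed

lemma power_tangent:
  fixes u x :: real
  assumes "0 \<le> u" "0 \<le> x"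
  shows "u ^ p + real p * u ^ (p - 1) * (x - u) \<le> x ^ p"
proof (induction p)
  case (Suc p)
  have "u ^ Suc p + real (Suc p) * u ^ (Suc p - 1) * (x - u) + real p * u ^ (p - 1) * (x - u)\<^sup>2 =
      x * (u ^ p + real p * u ^ (p - 1) * (x - u))"
    by (cases p) (simp_all add: power2_eq_square algebra_simps)
  also have "\<dots> \<le> x * x ^ p" using Suc assms by (intro mult_left_mono)
  finally have "u ^ Suc p + real (Suc p) * u ^ (Suc p - 1) * (x - u) + real p * u ^ (p - 1) * (x - u)\<^sup>2 \<le> x ^ Suc p"
    by simp
  moreover have "0 \<le> real p * u ^ (p - 1) * (x - u)\<^sup>2" using assms by simp
  ultimately show ?case by linarith
qed simp

text \<open>The tangents at the points of a grid of mesh \<open>1 / L\<close> approximate \<open>x ^ p\<close> uniformly.  The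
  tangent at \<open>u\<close> is written as \<open>p u ^ (p - 1) x + (1 - p) u ^ p\<close>.\<close>

lemma grid_tangent:
  fixes x :: real and L :: nat
  assumes x: "0 \<le> x" "x \<le> 1" and "L > 0" "p \<ge> 1"
  defines "u \<equiv> real (nat \<lfloor>real L * x\<rfloor>) / real L"
  shows "x ^ p \<le> real p * u ^ (p - 1) * x + (1 - real p) * u ^ p + real p / real L"
proof -
  have "0 \<le> real L * x" using x by simp
  then have fl: "real (nat \<lfloor>real L * x\<rfloor>) = of_int \<lfloor>real L * x\<rfloor>" by simp
  have u: "0 \<le> u" "u \<le> x" "x - u \<le> 1 / real L"
  proof -
    show "0 \<le> u" by (simp add: u_def)
    have "0 \<le> real L * x - of_int \<lfloor>real L * x\<rfloor>" "real L * x - of_int \<lfloor>real L * x\<rfloor> \<le> 1" by linarith+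
    then have "0 \<le> (real L * x - of_int \<lfloor>real L * x\<rfloor>) / real L"
        "(real L * x - of_int \<lfloor>real L * x\<rfloor>) / real L \<le> 1 / real L"
      by (intro divide_nonneg_nonneg divide_right_mono; simp)+
    moreover have "(real L * x - of_int \<lfloor>real L * x\<rfloor>) / real L = x - u"
      unfolding u_def fl using \<open>L > 0\<close> by (simp add: diff_divide_distrib)
    ultimately show "u \<le> x" "x - u \<le> 1 / real L" by simp_all
  qed
  have "x ^ p + real p * x ^ (p - 1) * (u - x) \<le> u ^ p" using power_tangent[of x u p] x u by simp
  then have "x ^ p \<le> u ^ p + real p * u ^ (p - 1) * (x - u) + real p * ((x ^ (p - 1) - u ^ (p - 1)) * (x - u))"
    by (simp add: algebra_simps)
  also have "\<dots> \<le> u ^ p + real p * u ^ (p - 1) * (x - u) + real p * (1 * (1 / real L))"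
  proof (intro add_left_mono mult_left_mono mult_mono)
    show "x ^ (p - 1) - u ^ (p - 1) \<le> 1" using power_le_one[OF x, of "p - 1"] zero_le_power[OF u(1), of "p - 1"] by linarith
  qed (use u in auto)
  also have "u ^ p + real p * u ^ (p - 1) * (x - u) = real p * u ^ (p - 1) * x + (1 - real p) * u ^ p"
    using \<open>p \<ge> 1\<close> by (cases p) (simp_all add: algebra_simps)
  finally show ?thesis by simp
qed

section \<open>Homomorphism densities as finite sums\<close>

text \<open>Each edge is oriented from its smaller to its larger endpoint.\<close>

definition graph_edges :: "sgraph \<Rightarrow> (nat \<times> nat) set" where
  "graph_edges H = {(i, j). i < j \<and> {i, j} \<in> snd H}"

lemma graph_edges_bij:
  assumes "simple_graph H"
  shows "bij_betw (\<lambda>(i, j). {i, j}) (graph_edges H) (snd H)"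
  unfolding bij_betw_def
proof
  show "inj_on (\<lambda>(i, j). {i, j}) (graph_edges H)"
    by (auto simp: inj_on_def graph_edges_def doubleton_eq_iff)
  show "(\<lambda>(i, j). {i, j}) ` graph_edges H = snd H"
  proof
    show "snd H \<subseteq> (\<lambda>(i, j). {i, j}) ` graph_edges H"
    proof
      fix e assume e: "e \<in> snd H"
      then have "card e = 2" using assms by (simp add: simple_graph_def)
      then obtain i j where ij: "e = {i, j}" "i \<noteq> j" by (auto simp: card_2_iff)
      show "e \<in> (\<lambda>(i, j). {i, j}) ` graph_edges H"
      proof (cases "i < j")
        case True
        then show ?thesis using e ij by (intro image_eqI[of _ _ "(i, j)"]) (auto simp: graph_edges_def)
      next
        case False
        then show ?thesis using e ij by (intro image_eqI[of _ _ "(j, i)"]) (auto simp: graph_edges_def insert_commute)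
      qed
    qed
  qed (auto simp: graph_edges_def)
qed

lemma card_graph_edges: "simple_graph H \<Longrightarrow> card (graph_edges H) = card (snd H)"
  using graph_edges_bij bij_betw_same_card by blast

lemma graph_edges_vertices:
  assumes "simple_graph H" "e \<in> graph_edges H"
  shows "fst e \<in> {1..fst H} \<and> snd e \<in> {1..fst H} \<and> fst e < snd e"
proof -
  have "fst e < snd e" "{fst e, snd e} \<in> snd H" using assms(2) by (auto simp: graph_edges_def)
  moreover from bspec[OF assms(1)[unfolded simple_graph_def] this(2)]
  have "{fst e, snd e} \<subseteq> {1..fst H}" by simp
  ultimately show ?thesis by simp
qed

lemma finite_graph_edges: "simple_graph H \<Longrightarrow> finite (graph_edges H)"
  by (rule finite_subset[of _ "{1..fst H} \<times> {1..fst H}"]) (auto dest!: graph_edges_vertices)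

definition hom_sum :: "nat set \<Rightarrow> nat set \<Rightarrow> (nat \<times> nat) set \<Rightarrow> (nat \<Rightarrow> nat \<Rightarrow> real) \<Rightarrow> real" where
  "hom_sum I V E h = (\<Sum>\<phi>\<in>I \<rightarrow>\<^sub>E V. \<Prod>e\<in>E. h (\<phi> (fst e)) (\<phi> (snd e)))"

text \<open>Rounding \<open>n x\<close> up divides \<open>[0, 1]\<close> into these cells.  The cell of \<open>0\<close> consists of the
  point \<open>0\<close> and has no mass.\<close>

lemma measure_cell:
  assumes "n > 0" "a \<in> {0..n}"
  defines "C \<equiv> {x\<in>{0..1}. nat \<lceil>real n * x\<rceil> = a}"
  shows "C \<in> sets lborel" "emeasure lborel C < \<infinity>" "measure lborel C = (if a = 0 then 0 else 1 / real n)"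
proof -
  have C: "C = (if a = 0 then {0} else {(real a - 1) / real n <.. real a / real n})"
  proof (cases "a = 0")
    case True
    have "x = 0" if "0 \<le> x" "nat \<lceil>real n * x\<rceil> = 0" for x
    proof -
      have "real n * x \<le> 0" using that by (simp add: ceiling_le_zero)
      then show ?thesis using that \<open>n > 0\<close> by (simp add: mult_le_0_iff)
    qed
    then show ?thesis using True by (auto simp: C_def)
  next
    case False
    have "x \<in> C \<longleftrightarrow> x \<in> {(real a - 1) / real n <.. real a / real n}" for x
    proof -
      have "nat \<lceil>real n * x\<rceil> = a \<longleftrightarrow> \<lceil>real n * x\<rceil> = int a" using False by linarith
      also have "\<dots> \<longleftrightarrow> real a - 1 < real n * x \<and> real n * x \<le> real a" by (simp add: ceiling_eq_iff)
      also have "\<dots> \<longleftrightarrow> (real a - 1) / real n < x \<and> x \<le> real a / real n"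
        using \<open>n > 0\<close> by (simp add: field_simps)
      finally have *: "nat \<lceil>real n * x\<rceil> = a \<longleftrightarrow> (real a - 1) / real n < x \<and> x \<le> real a / real n" .
      have "0 \<le> x" if "(real a - 1) / real n < x"
      proof -
        have "0 \<le> (real a - 1) / real n" using False by simp
        then show ?thesis using that by linarith
      qed
      moreover have "x \<le> 1" if "x \<le> real a / real n"
      proof -
        have "real a / real n \<le> 1" using assms(1,2) by simp
        then show ?thesis using that by linarith
      qed
      ultimately show ?thesis
        unfolding C_def mem_Collect_eq atLeastAtMost_iff greaterThanAtMost_iff * by blast
    qed
    then have "C = {(real a - 1) / real n <.. real a / real n}" by (rule set_eqI)
    then show ?thesis using False by simp
  qed
  show "C \<in> sets lborel" unfolding C by simp
  show "measure lborel C = (if a = 0 then 0 else 1 / real n)"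
    unfolding C by (simp add: divide_right_mono flip: diff_divide_distrib)
  show "emeasure lborel C < \<infinity>"
    unfolding C by (simp add: divide_right_mono)
qed

text \<open>The graphon is constant on the products of cells of side \<open>1 / n\<close>, so the integral is an
  average over all maps from the vertices of \<open>H\<close> to those of the graph.\<close>

lemma hom_density_eq:
  assumes H: "simple_graph H" and "n > 0"
  shows "hom_density H n w = hom_sum {1..fst H} {1..n} (graph_edges H) (edge_weight n w) / real n ^ fst H"
proof -
  let ?I = "{1..fst H}" and ?E = "graph_edges H"
  define C where "C a = {x\<in>{0..1}. nat \<lceil>real n * x\<rceil> = a}" for a
  define F where "F \<phi> = (\<Prod>e\<in>?E. edge_weight n w (\<phi> (fst e)) (\<phi> (snd e)))" for \<phi>
  let ?\<Phi> = "?I \<rightarrow>\<^sub>E {0..n}"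
  interpret product_sigma_finite "\<lambda>_. lborel :: real measure" ..
  have C: "C a \<in> sets lborel" "emeasure lborel (C a) < \<infinity>" "measure lborel (C a) = (if a = 0 then 0 else 1 / real n)"
    if "a \<in> {0..n}" for a
    unfolding C_def using measure_cell[OF \<open>n > 0\<close> that] by auto
  have point: "indicator (?I \<rightarrow>\<^sub>E {0..1}) x *\<^sub>R (\<Prod>(i, j)\<in>?E. graphon n w (x i) (x j)) =
      (\<Sum>\<phi>\<in>?\<Phi>. F \<phi> * (\<Prod>i\<in>?I. indicator (C (\<phi> i)) (x i)))"
    if x: "x \<in> space (\<Pi>\<^sub>M i\<in>?I. (lborel :: real measure))" for x
  proof (cases "x \<in> ?I \<rightarrow>\<^sub>E {0..1}")
    case False
    then obtain i where i: "i \<in> ?I" "x i \<notin> {0..1}" using x by (auto simp: space_PiM PiE_iff)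
    then have zero: "(\<Prod>i\<in>?I. indicator (C (\<phi> i)) (x i) :: real) = 0" for \<phi>
      by (intro prod_zero bexI[of _ i]) (auto simp: C_def)
    show ?thesis unfolding zero using False by simp
  next
    case True
    define \<phi>0 where "\<phi>0 = restrict (\<lambda>i. nat \<lceil>real n * x i\<rceil>) ?I"
    have "nat \<lceil>real n * x i\<rceil> \<le> n" if "i \<in> ?I" for i
    proof -
      have "x i \<le> 1" using True that by auto
      then have "real n * x i \<le> real n * 1" by (intro mult_left_mono) auto
      then have "\<lceil>real n * x i\<rceil> \<le> int n" by (simp add: ceiling_le_iff)
      then show ?thesis by linarith
    qed
    then have \<phi>0: "\<phi>0 \<in> ?\<Phi>" by (auto simp: \<phi>0_def)
    have ind: "(\<Prod>i\<in>?I. indicator (C (\<phi> i)) (x i) :: real) = (if \<phi> = \<phi>0 then 1 else 0)" if \<phi>: "\<phi> \<in> ?\<Phi>" for \<phi>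
    proof (cases "\<phi> = \<phi>0")
      case True
      then have "(\<Prod>i\<in>?I. indicator (C (\<phi> i)) (x i) :: real) = (\<Prod>i\<in>?I. 1)"
        using \<open>x \<in> ?I \<rightarrow>\<^sub>E {0..1}\<close> by (intro prod.cong) (auto simp: \<phi>0_def C_def indicator_def PiE_iff)
      then show ?thesis using True by simp
    next
      case False
      then obtain i where "i \<in> ?I" "\<phi> i \<noteq> \<phi>0 i" using \<phi> \<phi>0 by (meson PiE_ext)
      then have "(\<Prod>i\<in>?I. indicator (C (\<phi> i)) (x i) :: real) = 0"
        by (intro prod_zero bexI[of _ i]) (auto simp: C_def \<phi>0_def)
      then show ?thesis using False by simp
    qed
    have "(\<Sum>\<phi>\<in>?\<Phi>. F \<phi> * (\<Prod>i\<in>?I. indicator (C (\<phi> i)) (x i))) = (\<Sum>\<phi>\<in>?\<Phi>. if \<phi> = \<phi>0 then F \<phi> else 0)"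
    proof (rule sum.cong[OF refl])
      fix \<phi> assume \<phi>: "\<phi> \<in> ?\<Phi>"
      show "F \<phi> * (\<Prod>i\<in>?I. indicator (C (\<phi> i)) (x i)) = (if \<phi> = \<phi>0 then F \<phi> else 0)"
        unfolding ind[OF \<phi>] by simp
    qed
    also have "\<dots> = F \<phi>0" using \<phi>0 by (simp add: finite_PiE)
    also have "\<dots> = (\<Prod>(i, j)\<in>?E. graphon n w (x i) (x j))"
      unfolding F_def case_prod_unfold
      by (intro prod.cong refl) (use graph_edges_vertices[OF H] in \<open>auto simp: graphon_def \<phi>0_def\<close>)
    finally show ?thesis using True by simp
  qed
  have int1: "integrable lborel (indicator (C a) :: real \<Rightarrow> real)" if "a \<in> {0..n}" for a
    using C[OF that] by simp
  have int: "integrable (\<Pi>\<^sub>M i\<in>?I. lborel) (\<lambda>x. F \<phi> * (\<Prod>i\<in>?I. indicator (C (\<phi> i)) (x i)))" if "\<phi> \<in> ?\<Phi>" for \<phi>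
    using that by (intro integrable_mult_right product_integrable_prod int1) auto
  have "hom_density H n w = (LINT x|(\<Pi>\<^sub>M i\<in>?I. lborel). (\<Sum>\<phi>\<in>?\<Phi>. F \<phi> * (\<Prod>i\<in>?I. indicator (C (\<phi> i)) (x i))))"
    unfolding hom_density_def set_lebesgue_integral_def
    by (intro Bochner_Integration.integral_cong refl) (use point in \<open>simp add: graph_edges_def\<close>)
  also have "\<dots> = (\<Sum>\<phi>\<in>?\<Phi>. F \<phi> * (\<Prod>i\<in>?I. if \<phi> i = 0 then 0 else 1 / real n))"
  proof (subst Bochner_Integration.integral_sum[OF int], assumption, rule sum.cong[OF refl])
    fix \<phi> assume \<phi>: "\<phi> \<in> ?\<Phi>"
    have "(LINT x|(\<Pi>\<^sub>M i\<in>?I. lborel). (\<Prod>i\<in>?I. indicator (C (\<phi> i)) (x i) :: real)) =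
        (\<Prod>i\<in>?I. LINT x|lborel. indicator (C (\<phi> i)) x)"
      using \<phi> by (intro product_integral_prod int1) auto
    also have "\<dots> = (\<Prod>i\<in>?I. if \<phi> i = 0 then 0 else 1 / real n)"
    proof (rule prod.cong[OF refl])
      fix i assume "i \<in> ?I"
      then have "\<phi> i \<in> {0..n}" using \<phi> by auto
      then show "(LINT x|lborel. indicator (C (\<phi> i)) x :: real) = (if \<phi> i = 0 then 0 else 1 / real n)"
        using C by simp
    qed
    finally show "(LINT x|(\<Pi>\<^sub>M i\<in>?I. lborel). F \<phi> * (\<Prod>i\<in>?I. indicator (C (\<phi> i)) (x i))) =
        F \<phi> * (\<Prod>i\<in>?I. if \<phi> i = 0 then 0 else 1 / real n)" by simp
  qed
  also have "\<dots> = (\<Sum>\<phi>\<in>?I \<rightarrow>\<^sub>E {1..n}. F \<phi> * (1 / real n) ^ fst H)"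
  proof (rule sum.mono_neutral_cong_right)
    show "finite ?\<Phi>" by (simp add: finite_PiE)
    show "?I \<rightarrow>\<^sub>E {1..n} \<subseteq> ?\<Phi>" by (intro PiE_mono) auto
    show "\<forall>\<phi>\<in>?\<Phi> - (?I \<rightarrow>\<^sub>E {1..n}). F \<phi> * (\<Prod>i\<in>?I. if \<phi> i = 0 then 0 else 1 / real n) = 0"
    proof
      fix \<phi> assume \<phi>: "\<phi> \<in> ?\<Phi> - (?I \<rightarrow>\<^sub>E {1..n})"
      then obtain i where "i \<in> ?I" "\<phi> i \<notin> {1..n}" by (auto simp: PiE_iff)
      moreover from this have "\<phi> i = 0" using \<phi> by (auto simp: PiE_iff)
      ultimately have "(\<Prod>i\<in>?I. if \<phi> i = 0 then 0 else 1 / real n) = 0"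
        by (intro prod_zero bexI[of _ i]) auto
      then show "F \<phi> * (\<Prod>i\<in>?I. if \<phi> i = 0 then 0 else 1 / real n) = 0" by simp
    qed
    fix \<phi> assume \<phi>: "\<phi> \<in> ?I \<rightarrow>\<^sub>E {1..n}"
    have "(\<Prod>i\<in>?I. if \<phi> i = 0 then 0 else 1 / real n) = (\<Prod>i\<in>?I. 1 / real n)"
    proof (rule prod.cong[OF refl])
      fix i assume "i \<in> ?I"
      then have "\<phi> i \<in> {1..n}" using \<phi> by blast
      then show "(if \<phi> i = 0 then 0 else 1 / real n) = 1 / real n" by simp
    qed
    then show "F \<phi> * (\<Prod>i\<in>?I. if \<phi> i = 0 then 0 else 1 / real n) = F \<phi> * (1 / real n) ^ fst H" by simp
  qed
  also have "\<dots> = hom_sum ?I {1..n} ?E (edge_weight n w) / real n ^ fst H"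
    by (simp add: hom_sum_def F_def sum_divide_distrib power_divide)
  finally show ?thesis .
qed

lemma edge_weight_sym: "edge_weight n w i j = edge_weight n w j i"
  by (auto simp: edge_weight_def vertex_pairs_def)

lemma edge_weight_diag: "edge_weight n w i i = 0"
  by (auto simp: edge_weight_def vertex_pairs_def)

lemma sum_vertex_pairs:
  fixes f :: "nat \<Rightarrow> nat \<Rightarrow> real"
  shows "(\<Sum>i\<in>{1..n}. \<Sum>j\<in>{1..n}. f i j) = (\<Sum>(i, j)\<in>vertex_pairs n. f i j + f j i) + (\<Sum>i\<in>{1..n}. f i i)"
proof -
  let ?P = "vertex_pairs n" and ?V = "{1..n}"
  let ?Q = "prod.swap ` ?P" and ?D = "(\<lambda>i. (i, i)) ` ?V"
  have fin: "finite ?P" by (rule finite_subset[of _ "?V \<times> ?V"]) (auto simp: vertex_pairs_def)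
  have "?V \<times> ?V = ?P \<union> (?Q \<union> ?D)"
  proof
    show "?V \<times> ?V \<subseteq> ?P \<union> (?Q \<union> ?D)"
    proof
      fix x assume "x \<in> ?V \<times> ?V"
      then obtain i j where x: "x = (i, j)" "i \<in> ?V" "j \<in> ?V" by blast
      consider "i < j" | "j < i" | "i = j" by linarith
      then show "x \<in> ?P \<union> (?Q \<union> ?D)"
      proof cases
        case 2
        then have "(j, i) \<in> ?P" using x by (simp add: vertex_pairs_def)
        then have "prod.swap (j, i) \<in> ?Q" by (rule imageI)
        then show ?thesis using x by simp
      qed (use x in \<open>auto simp: vertex_pairs_def\<close>)
    qed
  qed (auto simp: vertex_pairs_def)
  moreover have "?P \<inter> (?Q \<union> ?D) = {}" "?Q \<inter> ?D = {}" by (auto simp: vertex_pairs_def)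
  ultimately have "(\<Sum>x\<in>?V \<times> ?V. f (fst x) (snd x)) =
      (\<Sum>x\<in>?P. f (fst x) (snd x)) + ((\<Sum>x\<in>?Q. f (fst x) (snd x)) + (\<Sum>x\<in>?D. f (fst x) (snd x)))"
    using fin by (simp add: sum.union_disjoint)
  also have "(\<Sum>x\<in>?Q. f (fst x) (snd x)) = (\<Sum>x\<in>?P. f (snd x) (fst x))"
    by (subst sum.reindex) (auto simp: inj_on_def)
  also have "(\<Sum>x\<in>?D. f (fst x) (snd x)) = (\<Sum>i\<in>?V. f i i)"
    by (subst sum.reindex) (auto simp: inj_on_def)
  finally show ?thesis
    by (simp add: sum.cartesian_product case_prod_unfold sum.distrib)
qed

lemma finite_vertex_pairs [simp]: "finite (vertex_pairs n)"
  by (rule finite_subset[of _ "{1..n} \<times> {1..n}"]) (auto simp: vertex_pairs_def)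

lemma card_vertex_pairs: "2 * real (card (vertex_pairs n)) = real n * (real n - 1)"
  using sum_vertex_pairs[of "\<lambda>_ _. 1" n] by (simp add: case_prod_unfold algebra_simps)

lemma simple_graph_single_edge: "simple_graph single_edge"
  by (auto simp: simple_graph_def single_edge_def)

lemma graph_edges_single_edge: "graph_edges single_edge = {(1, 2)}"
  by (auto simp: graph_edges_def single_edge_def doubleton_eq_iff)

lemma hom_sum_pair:
  assumes "finite I" "i \<in> I" "j \<in> I" "i \<noteq> j"
  shows "(\<Sum>\<phi>\<in>I \<rightarrow>\<^sub>E V. f (\<phi> i) (\<phi> j)) = real (card V) ^ (card I - 2) * (\<Sum>a\<in>V. \<Sum>b\<in>V. f a b :: real)"
proof -
  have at: "(\<psi>(j := b, i := a)) i = a" "(\<psi>(j := b, i := a)) j = b" for \<psi> :: "'a \<Rightarrow> 'b" and a b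
    using assms by auto
  have "card (I - {i, j}) = card I - 2"
    using assms by (subst card_Diff_subset) auto
  then have "card ((I - {i, j}) \<rightarrow>\<^sub>E V) = card V ^ (card I - 2)" using assms by (simp add: card_PiE)
  then show ?thesis unfolding sum_PiE_two[OF assms] at by simp
qed

lemma hom_density_single_edge:
  assumes "n > 0"
  shows "(real n)\<^sup>2 * hom_density single_edge n w = (\<Sum>e\<in>vertex_pairs n. 2 * w e)"
proof -
  have fst: "fst single_edge = 2" by (simp add: single_edge_def)
  have "hom_sum {1..2} {1..n} {(1, 2)} (edge_weight n w) = (\<Sum>i\<in>{1..n}. \<Sum>j\<in>{1..n}. edge_weight n w i j)"
    using hom_sum_pair[of "{1..2::nat}" 1 2 "edge_weight n w" "{1..n}"] by (simp add: hom_sum_def)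
  also have "\<dots> = (\<Sum>(i, j)\<in>vertex_pairs n. edge_weight n w i j + edge_weight n w j i)"
    unfolding sum_vertex_pairs by (simp add: edge_weight_diag)
  also have "\<dots> = (\<Sum>e\<in>vertex_pairs n. 2 * w e)"
    by (intro sum.cong refl) (auto simp: edge_weight_sym[of n w, where i = "snd _"] edge_weight_def vertex_pairs_def)
  finally show ?thesis
    using assms unfolding hom_density_eq[OF simple_graph_single_edge assms] graph_edges_single_edge fst by simp
qed

lemma block_average_sym:
  assumes "\<And>i j. h (i, j) = h (j, i)"
  shows "block_average V c h (i, j) = block_average V c h (j, i)"
proof -
  let ?A = "\<lambda>i j. {y \<in> V \<times> V. map_prod c c y = map_prod c c (i, j)}"
  have A: "?A j i = prod.swap ` ?A i j" for i j by force
  have inj: "inj_on prod.swap B" for B :: "(nat \<times> nat) set" by (auto simp: inj_on_def)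
  have "(\<Sum>y\<in>?A j i. h y) = (\<Sum>y\<in>?A i j. h y)"
    unfolding A[of j i] sum.reindex[OF inj] by (intro sum.cong refl) (use assms in \<open>auto simp: o_def\<close>)
  moreover have "card (?A j i) = card (?A i j)" unfolding A[of j i] by (rule card_image[OF inj])
  ultimately show ?thesis by (simp only: block_average_def class_average_def)
qed

text \<open>This combines the counting lemma, the arithmetic-geometric mean inequality and the grid of
  tangents.  The bound is linear in the weights \<open>h\<close>, and its coefficients depend only on the colouring \<open>c\<close>
  and on the grid points \<open>\<sigma>\<close> chosen for the pairs of colours.  Because a tangent has constant slope on a
  block, block averages can be replaced by \<open>h\<close> again.\<close>

lemma hom_sum_upper:
  fixes h :: "nat \<Rightarrow> nat \<Rightarrow> real" and L n :: nat
  assumes H: "simple_graph H" and p: "card (snd H) = p" "p \<ge> 1" and n: "n > 0" and L: "L > 0"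
    and h: "\<And>i j. 0 \<le> h i j \<and> h i j \<le> 1" and sym: "\<And>i j. h i j = h j i"
    and reg: "c ` {1..n} \<subseteq> {..<M}" "cut_regular {1..n} \<epsilon> c (\<lambda>x. h (fst x) (snd x))"
  shows "\<exists>\<sigma>. \<sigma> \<in> ({..<M} \<times> {..<M} \<rightarrow>\<^sub>E {..L}) \<and> (\<forall>i\<in>{1..n}. \<forall>j\<in>{1..n}. \<sigma> (c i, c j) = \<sigma> (c j, c i)) \<and>
    (real n)\<^sup>2 * (hom_sum {1..fst H} {1..n} (graph_edges H) h / real n ^ fst H) \<le>
      (real n)\<^sup>2 * (real p * \<epsilon> + real p / real L) +
      (\<Sum>i\<in>{1..n}. \<Sum>j\<in>{1..n}. real p * (real (\<sigma> (c i, c j)) / real L) ^ (p - 1) * h i j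
         + (1 - real p) * (real (\<sigma> (c i, c j)) / real L) ^ p)"
proof -
  let ?V = "{1..n}" and ?k = "fst H" and ?E = "graph_edges H"
  let ?I = "{1..?k}" and ?h = "\<lambda>x. h (fst x) (snd x)"
  define a where "a = block_average ?V c ?h"
  have a: "0 \<le> a x \<and> a x \<le> 1" if "x \<in> ?V \<times> ?V" for x
    using class_average_bounds[of "?V \<times> ?V" x ?h "map_prod c c"] h that unfolding a_def block_average_def by auto
  have E: "finite ?E" "card ?E = p" "?E \<noteq> {}"
    using finite_graph_edges[OF H] card_graph_edges[OF H] p by auto
  obtain e0 where "e0 \<in> ?E" using E by blast
  from graph_edges_vertices[OF H this] have k: "?k \<ge> 2" by auto
  have "hom_sum ?I ?V ?E h \<le> (\<Sum>\<phi>\<in>?I \<rightarrow>\<^sub>E ?V. \<Prod>e\<in>?E. a (\<phi> (fst e), \<phi> (snd e)))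
      + real (card ?E) * (\<epsilon> * real (card ?V) ^ card ?I)"
    using counting_lemma[OF _ reg(2), of ?I ?E] h E(1) graph_edges_vertices[OF H]
    unfolding hom_sum_def a_def by simp
  also have "\<dots> = (\<Sum>\<phi>\<in>?I \<rightarrow>\<^sub>E ?V. \<Prod>e\<in>?E. a (\<phi> (fst e), \<phi> (snd e))) + real p * \<epsilon> * real n ^ ?k"
    by (simp add: E)
  also have "(\<Sum>\<phi>\<in>?I \<rightarrow>\<^sub>E ?V. \<Prod>e\<in>?E. a (\<phi> (fst e), \<phi> (snd e))) \<le>
      (\<Sum>\<phi>\<in>?I \<rightarrow>\<^sub>E ?V. (\<Sum>e\<in>?E. a (\<phi> (fst e), \<phi> (snd e)) ^ p) / real p)"
  proof (rule sum_mono)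
    fix \<phi> assume \<phi>: "\<phi> \<in> ?I \<rightarrow>\<^sub>E ?V"
    have "0 \<le> a (\<phi> (fst e), \<phi> (snd e))" if "e \<in> ?E" for e
    proof -
      have "(\<phi> (fst e), \<phi> (snd e)) \<in> ?V \<times> ?V"
        using graph_edges_vertices[OF H that] \<phi> by (intro SigmaI) blast+
      then show ?thesis using a by blast
    qed
    then show "(\<Prod>e\<in>?E. a (\<phi> (fst e), \<phi> (snd e))) \<le> (\<Sum>e\<in>?E. a (\<phi> (fst e), \<phi> (snd e)) ^ p) / real p"
      using prod_le_mean_power[OF E(1,3), of "\<lambda>e. a (\<phi> (fst e), \<phi> (snd e))"] unfolding E(2) by blast
  qed
  also have "\<dots> = (\<Sum>e\<in>?E. \<Sum>\<phi>\<in>?I \<rightarrow>\<^sub>E ?V. a (\<phi> (fst e), \<phi> (snd e)) ^ p) / real p"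
    unfolding sum_divide_distrib[symmetric] by (simp only: sum.swap[of _ ?E])
  also have "(\<Sum>e\<in>?E. \<Sum>\<phi>\<in>?I \<rightarrow>\<^sub>E ?V. a (\<phi> (fst e), \<phi> (snd e)) ^ p) =
      (\<Sum>e\<in>?E. real n ^ (?k - 2) * (\<Sum>i\<in>?V. \<Sum>j\<in>?V. a (i, j) ^ p))"
  proof (rule sum.cong[OF refl])
    fix e assume "e \<in> ?E"
    from graph_edges_vertices[OF H this] have "fst e \<in> ?I" "snd e \<in> ?I" "fst e \<noteq> snd e" by auto
    from hom_sum_pair[OF finite_atLeastAtMost this, where f = "\<lambda>i j. a (i, j) ^ p" and V = ?V]
    show "(\<Sum>\<phi>\<in>?I \<rightarrow>\<^sub>E ?V. a (\<phi> (fst e), \<phi> (snd e)) ^ p) =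
      real n ^ (?k - 2) * (\<Sum>i\<in>?V. \<Sum>j\<in>?V. a (i, j) ^ p)" by simp
  qed
  also have "\<dots> / real p = real n ^ (?k - 2) * (\<Sum>i\<in>?V. \<Sum>j\<in>?V. a (i, j) ^ p)"
    using E(2) p(2) by simp
  finally have "(real n)\<^sup>2 * hom_sum ?I ?V ?E h / real n ^ ?k \<le>
      (real n)\<^sup>2 * (real n ^ (?k - 2) * (\<Sum>i\<in>?V. \<Sum>j\<in>?V. a (i, j) ^ p) + real p * \<epsilon> * real n ^ ?k) / real n ^ ?k"
    using n by (intro divide_right_mono mult_left_mono) auto
  also have "\<dots> = (\<Sum>i\<in>?V. \<Sum>j\<in>?V. a (i, j) ^ p) + (real n)\<^sup>2 * (real p * \<epsilon>)"
  proof -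
    have "real n ^ ?k = (real n)\<^sup>2 * real n ^ (?k - 2)" using k by (metis le_add_diff_inverse power_add)
    then show ?thesis using n by (simp add: field_simps)
  qed
  finally have main: "(real n)\<^sup>2 * (hom_sum ?I ?V ?E h / real n ^ ?k) \<le>
      (\<Sum>i\<in>?V. \<Sum>j\<in>?V. a (i, j) ^ p) + (real n)\<^sup>2 * (real p * \<epsilon>)" by simp
  \<comment> \<open>the grid point below the average of each block\<close>
  define rep where "rep z = (SOME x. x \<in> ?V \<times> ?V \<and> map_prod c c x = z)" for z
  define \<sigma> where "\<sigma> = (\<lambda>z\<in>{..<M} \<times> {..<M}. min L (nat \<lfloor>real L * a (rep z)\<rfloor>))"
  have a_rep: "a (rep (c i, c j)) = a (i, j)" if "i \<in> ?V" "j \<in> ?V" for i j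
  proof -
    have "(i, j) \<in> ?V \<times> ?V \<and> map_prod c c (i, j) = (c i, c j)" using that by simp
    then have "rep (c i, c j) \<in> ?V \<times> ?V \<and> map_prod c c (rep (c i, c j)) = (c i, c j)"
      unfolding rep_def by (rule someI)
    then have "map_prod c c (rep (c i, c j)) = map_prod c c (i, j)" by simp
    then show ?thesis unfolding a_def block_average_def by (rule class_average_cong)
  qed
  have \<sigma>: "\<sigma> (c i, c j) = nat \<lfloor>real L * a (i, j)\<rfloor>" if "i \<in> ?V" "j \<in> ?V" for i j
  proof -
    have "c i \<in> {..<M}" "c j \<in> {..<M}" using reg(1) that by blast+
    then have "c i < M" "c j < M" by simp_all
    moreover have "real L * a (i, j) \<le> real L * 1" using a[of "(i, j)"] that by (intro mult_left_mono) auto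
    then have "nat \<lfloor>real L * a (i, j)\<rfloor> \<le> L" by linarith
    ultimately show ?thesis using a_rep[OF that] by (simp add: \<sigma>_def)
  qed
  define u where "u i j = real (\<sigma> (c i, c j)) / real L" for i j
  have "(\<Sum>i\<in>?V. \<Sum>j\<in>?V. a (i, j) ^ p) \<le>
      (\<Sum>i\<in>?V. \<Sum>j\<in>?V. real p * u i j ^ (p - 1) * a (i, j) + (1 - real p) * u i j ^ p + real p / real L)"
  proof (intro sum_mono)
    fix i j assume "i \<in> ?V" "j \<in> ?V"
    then show "a (i, j) ^ p \<le> real p * u i j ^ (p - 1) * a (i, j) + (1 - real p) * u i j ^ p + real p / real L"
      using grid_tangent[of "a (i, j)" L p] a[of "(i, j)"] L p unfolding u_def by (simp only: \<sigma>) simp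
  qed
  also have "\<dots> = (\<Sum>i\<in>?V. \<Sum>j\<in>?V. real p * u i j ^ (p - 1) * a (i, j)) +
      (\<Sum>i\<in>?V. \<Sum>j\<in>?V. (1 - real p) * u i j ^ p) + (real n)\<^sup>2 * (real p / real L)"
    by (simp add: sum.distrib power2_eq_square)
  also have "(\<Sum>i\<in>?V. \<Sum>j\<in>?V. real p * u i j ^ (p - 1) * a (i, j)) =
      (\<Sum>i\<in>?V. \<Sum>j\<in>?V. real p * u i j ^ (p - 1) * h i j)"
  proof -
    define f where "f x = real p * u (fst x) (snd x) ^ (p - 1)" for x
    have "(\<Sum>x\<in>?V \<times> ?V. a x * f x) = (\<Sum>x\<in>?V \<times> ?V. h (fst x) (snd x) * f x)"
      unfolding a_def block_average_def
    proof (rule class_average_pairing)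
      fix x y assume "map_prod c c x = map_prod c c y"
      then have "(c (fst x), c (snd x)) = (c (fst y), c (snd y))" by (simp add: map_prod_def case_prod_unfold)
      then show "f x = f y" by (simp only: f_def u_def)
    qed simp
    then show ?thesis by (simp add: sum.cartesian_product case_prod_unfold f_def mult.commute)
  qed
  finally have "(\<Sum>i\<in>?V. \<Sum>j\<in>?V. a (i, j) ^ p) \<le>
      (\<Sum>i\<in>?V. \<Sum>j\<in>?V. real p * u i j ^ (p - 1) * h i j + (1 - real p) * u i j ^ p) + (real n)\<^sup>2 * (real p / real L)"
    by (simp add: sum.distrib)
  with main have "(real n)\<^sup>2 * (hom_sum ?I ?V ?E h / real n ^ ?k) \<le> (real n)\<^sup>2 * (real p * \<epsilon> + real p / real L) +
      (\<Sum>i\<in>?V. \<Sum>j\<in>?V. real p * u i j ^ (p - 1) * h i j + (1 - real p) * u i j ^ p)"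
    unfolding distrib_left by linarith
  moreover have "\<sigma> (c i, c j) = \<sigma> (c j, c i)" if "i \<in> ?V" "j \<in> ?V" for i j
    using \<sigma>[OF that] \<sigma>[OF that(2,1)] block_average_sym[of ?h ?V c i j] sym by (simp add: a_def)
  moreover have "\<sigma> \<in> ({..<M} \<times> {..<M} \<rightarrow>\<^sub>E {..L})" unfolding \<sigma>_def by (rule restrict_PiE_iff[THEN iffD2]) simp
  ultimately show ?thesis unfolding u_def by (intro exI[of _ \<sigma>]) blast
qed

section \<open>Cumulants of the weight distribution\<close>

text \<open>If \<open>v\<close> were positive at \<open>s\<close>, then it would be positive from there on for lack of zeros.  So \<open>w\<close>
  would stay above \<open>w s > 0\<close>, and its primitive \<open>Q\<close> would be unbounded.\<close>

lemma derivative_sign_right: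
  fixes w v Q :: "real \<Rightarrow> real"
  assumes w: "\<And>x. (w has_real_derivative v x) (at x)" and w_pos: "\<And>x. w x > 0"
    and v: "continuous_on UNIV v" and zero: "\<And>x. v x = 0 \<Longrightarrow> x = c"
    and Q: "\<And>x. (Q has_real_derivative w x) (at x)" and Q_bounds: "\<And>x. 0 \<le> Q x" "\<And>x. Q x \<le> 1"
    and "c < s"
  shows "v s < 0"
proof (rule ccontr)
  assume "\<not> v s < 0"
  moreover have "v s \<noteq> 0" using zero[of s] \<open>c < s\<close> by auto
  ultimately have "v s > 0" by simp
  have v_pos: "v t > 0" if "t \<ge> s" for t
  proof (rule ccontr)
    assume "\<not> v t > 0"
    then have "\<exists>x\<ge>s. x \<le> t \<and> v x = 0"
      using \<open>v s > 0\<close> that by (intro IVT2') (auto intro: continuous_on_subset[OF v])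
    then show False using zero \<open>c < s\<close> by force
  qed
  have w_ge: "w s \<le> w t" if "t \<ge> s" for t
    using that v_pos w by (intro DERIV_nonneg_imp_nondecreasing[of s t w]) (auto intro!: exI less_imp_le)
  \<comment> \<open>up to this point \<open>Q\<close> would rise by 2\<close>
  define t where "t = s + 2 / w s"
  have "t \<ge> s" using w_pos[of s] by (simp add: t_def)
  then have "Q s - w s * s \<le> Q t - w s * t"
  proof (rule DERIV_nonneg_imp_nondecreasing)
    fix x assume "s \<le> x" "x \<le> t"
    then show "\<exists>y. ((\<lambda>x. Q x - w s * x) has_real_derivative y) (at x) \<and> 0 \<le> y"
      using w_ge[of x] by (intro exI[of _ "w x - w s"]) (auto intro!: derivative_eq_intros Q)
  qed
  moreover have "w s * t - w s * s = 2" using w_pos[of s] by (simp add: t_def field_simps)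
  ultimately show False using Q_bounds(2)[of t] Q_bounds(1)[of s] by linarith
qed

text \<open>The preceding lemma reflected at the origin, with \<open>1 - Q\<close> in place of \<open>Q\<close>.\<close>

lemma derivative_sign_left:
  fixes w v Q :: "real \<Rightarrow> real"
  assumes w: "\<And>x. (w has_real_derivative v x) (at x)" and w_pos: "\<And>x. w x > 0"
    and v: "continuous_on UNIV v" and zero: "\<And>x. v x = 0 \<Longrightarrow> x = c"
    and Q: "\<And>x. (Q has_real_derivative w x) (at x)" and Q_bounds: "\<And>x. 0 \<le> Q x" "\<And>x. Q x \<le> 1"
    and "s < c"
  shows "v s > 0"
proof -
  have neg: "(uminus has_real_derivative - 1) (at x)" for x :: real
    by (auto intro!: derivative_eq_intros)
  have "- v (- (- s)) < 0"
  proof (rule derivative_sign_right[where w = "\<lambda>x. w (- x)" and v = "\<lambda>x. - v (- x)" and c = "- c" and s = "- s"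
        and Q = "\<lambda>x. 1 - Q (- x)"])
    show "((\<lambda>x. w (- x)) has_real_derivative - v (- x)) (at x)" for x
      using DERIV_chain2[where f = w and g = uminus, OF w[of "- x"] neg] by simp
    show "((\<lambda>x. 1 - Q (- x)) has_real_derivative w (- x)) (at x)" for x
      using DERIV_diff[OF DERIV_const[of 1] DERIV_chain2[where f = Q and g = uminus, OF Q[of "- x"] neg]] by simp
    show "continuous_on UNIV (\<lambda>x. - v (- x))"
      by (intro continuous_intros continuous_on_compose2[OF v]) auto
    show "x = - c" if "- v (- x) = 0" for x using zero[of "- x"] that by auto
  qed (use w_pos Q_bounds \<open>s < c\<close> in auto)
  then show ?thesis by simp
qed

locale weight_distribution = real_distribution \<mu> for \<mu> :: "real measure" +
  assumes unit_interval: "measure \<mu> {0..1} = 1"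
    and nondegenerate: "measure \<mu> {a} \<noteq> 1"
begin

lemma prob_UNIV: "prob UNIV = 1" using prob_space by simp

lemma AE_unit: "AE x in \<mu>. 0 \<le> x \<and> x \<le> 1"
proof -
  have "AE x in \<mu>. x \<in> {0..1}" using unit_interval prob_eq_1[of "{0..1}"] by simp
  then show ?thesis by simp
qed

lemma integrable_bounded_on_unit:
  fixes f :: "real \<Rightarrow> real"
  assumes "f \<in> borel_measurable borel" "\<And>x. 0 \<le> x \<Longrightarrow> x \<le> 1 \<Longrightarrow> \<bar>f x\<bar> \<le> B"
  shows "integrable \<mu> f"
proof (rule integrable_const_bound[where B = B])
  show "AE x in \<mu>. norm (f x) \<le> B" using AE_unit by eventually_elim (use assms in auto)
qed (use assms in auto)

definition tilted_moment :: "nat \<Rightarrow> real \<Rightarrow> real" where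
  "tilted_moment k \<theta> = (LINT x|\<mu>. x ^ k * exp (\<theta> * x))"

lemma exp_le_on_unit: "0 \<le> x \<Longrightarrow> x \<le> 1 \<Longrightarrow> exp (\<theta> * x) \<le> exp \<bar>\<theta>\<bar>" for x \<theta> :: real
proof -
  assume "0 \<le> x" "x \<le> 1"
  then have "\<theta> * x \<le> \<bar>\<theta>\<bar> * 1" by (intro mult_mono) auto
  then show ?thesis by simp
qed

lemma integrable_tilted_moment [simp]: "integrable \<mu> (\<lambda>x. x ^ k * exp (\<theta> * x))"
proof (rule integrable_bounded_on_unit[where B = "1 * exp \<bar>\<theta>\<bar>"])
  fix x :: real assume "0 \<le> x" "x \<le> 1"
  then show "\<bar>x ^ k * exp (\<theta> * x)\<bar> \<le> 1 * exp \<bar>\<theta>\<bar>"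
    unfolding abs_mult using exp_le_on_unit[of x \<theta>] by (intro mult_mono) (auto simp: power_le_one power_abs)
qed simp

text \<open>Taylor coefficients at \<open>0\<close> of the \<open>k\<close>-th tilted moment.\<close>

definition moment_coef :: "nat \<Rightarrow> nat \<Rightarrow> real" where
  "moment_coef k n = tilted_moment (n + k) 0 / fact n"

text \<open>The exponential series is integrated term by term.  The weights are bounded, so the series
  converges everywhere, which gives all derivatives and a complex extension at once.\<close>

lemma moment_coef_sums: "(\<lambda>n. moment_coef k n * \<theta> ^ n) sums tilted_moment k \<theta>"
proof -
  let ?f = "\<lambda>n x. x ^ k * ((\<theta> * x) ^ n / fact n) :: real"
  have le: "\<bar>?f n x\<bar> \<le> \<bar>\<theta>\<bar> ^ n / fact n" if "0 \<le> x" "x \<le> 1" for n x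
  proof -
    have "\<bar>?f n x\<bar> = \<bar>\<theta>\<bar> ^ n / fact n * (x ^ k * x ^ n)"
      using that by (simp add: abs_mult power_abs power_mult_distrib)
    also have "\<dots> \<le> \<bar>\<theta>\<bar> ^ n / fact n * (1 * 1)"
      using that by (intro mult_left_mono mult_mono power_le_one) auto
    finally show ?thesis by simp
  qed
  have int: "integrable \<mu> (?f n)" for n
    by (rule integrable_bounded_on_unit[OF _ le]) auto
  have exp_sums: "(\<lambda>n. ?f n x) sums (x ^ k * exp (\<theta> * x))" for x
    using exp_converges[of "\<theta> * x"] by (intro sums_mult) (simp add: divide_inverse mult.commute)
  have summ: "summable (\<lambda>n. \<bar>\<theta>\<bar> ^ n / fact n)"
    using summable_exp[of "\<bar>\<theta>\<bar>"] by (simp add: divide_inverse mult.commute)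
  have "(\<lambda>n. integral\<^sup>L \<mu> (?f n)) sums (LINT x|\<mu>. (\<Sum>n. ?f n x))"
  proof (rule sums_integral[OF int])
    show "AE x in \<mu>. summable (\<lambda>n. norm (?f n x))"
      using AE_unit by eventually_elim (intro summable_comparison_test'[OF summ], use le in auto)
    show "summable (\<lambda>n. LINT x|\<mu>. norm (?f n x))"
    proof (rule summable_comparison_test'[OF summ])
      fix n
      have "(LINT x|\<mu>. norm (?f n x)) \<le> (LINT x|\<mu>. \<bar>\<theta>\<bar> ^ n / fact n)"
      proof (intro integral_mono_AE integrable_norm int)
        show "AE x in \<mu>. norm (?f n x) \<le> \<bar>\<theta>\<bar> ^ n / fact n"
          using AE_unit by eventually_elim (use le[of _ n] in simp)
      qed simp
      then show "norm (LINT x|\<mu>. norm (?f n x)) \<le> \<bar>\<theta>\<bar> ^ n / fact n"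
        by (simp add: prob_UNIV integral_nonneg_AE)
    qed
  qed
  moreover have "(LINT x|\<mu>. (\<Sum>n. ?f n x)) = tilted_moment k \<theta>"
    unfolding tilted_moment_def using exp_sums by (intro Bochner_Integration.integral_cong) (auto simp: sums_iff)
  moreover have "integral\<^sup>L \<mu> (?f n) = moment_coef k n * \<theta> ^ n" for n
  proof -
    have "integral\<^sup>L \<mu> (?f n) = (LINT x|\<mu>. \<theta> ^ n / fact n * x ^ (n + k))"
      by (intro Bochner_Integration.integral_cong) (auto simp: power_mult_distrib power_add)
    also have "\<dots> = \<theta> ^ n / fact n * (LINT x|\<mu>. x ^ (n + k))" by simp
    finally show ?thesis by (simp add: moment_coef_def tilted_moment_def)
  qed
  ultimately show ?thesis by simp
qed

lemma diffs_moment_coef: "diffs (moment_coef k) = moment_coef (Suc k)"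
  by (rule ext) (simp add: diffs_def moment_coef_def field_simps del: of_nat_Suc)

lemma tilted_moment_deriv: "(tilted_moment k has_real_derivative tilted_moment (Suc k) \<theta>) (at \<theta>)"
proof -
  have "summable (\<lambda>n. moment_coef k n * y ^ n)" for y using moment_coef_sums sums_summable by blast
  from termdiffs_strong_converges_everywhere[OF this, of \<theta>]
  have "((\<lambda>x. \<Sum>n. moment_coef k n * x ^ n) has_real_derivative (\<Sum>n. moment_coef (Suc k) n * \<theta> ^ n)) (at \<theta>)"
    unfolding diffs_moment_coef .
  moreover have "(\<Sum>n. moment_coef k n * x ^ n) = tilted_moment k x" for k x using moment_coef_sums sums_unique by metis
  ultimately show ?thesis by simp
qed

lemma tilted_moment_pos: "tilted_moment 0 \<theta> > 0"
proof -
  have "0 < (LINT x|\<mu>. exp (- \<bar>\<theta>\<bar>))" by (simp add: prob_UNIV)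
  also have "\<dots> \<le> tilted_moment 0 \<theta>"
    unfolding tilted_moment_def
  proof (intro integral_mono_AE integrable_tilted_moment)
    show "AE x in \<mu>. exp (- \<bar>\<theta>\<bar>) \<le> x ^ 0 * exp (\<theta> * x)"
      using AE_unit
    proof eventually_elim
      case (elim x)
      then have "(- \<theta>) * x \<le> \<bar>\<theta>\<bar> * 1" by (intro mult_mono) auto
      then show ?case by simp
    qed
  qed simp
  finally show ?thesis .
qed

text \<open>A nonnegative integrand with at most one zero has a positive integral, since the
  distribution is not concentrated at a point.\<close>

lemma integral_pos_if_not_null:
  assumes "integrable \<mu> f" "AE x in \<mu>. 0 \<le> f x" "\<And>x. f x = 0 \<Longrightarrow> x = (a::real)"
  shows "(LINT x|\<mu>. f x) > (0::real)"
proof -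
  have "(LINT x|\<mu>. f x) \<noteq> 0"
  proof
    assume "(LINT x|\<mu>. f x) = 0"
    then have "AE x in \<mu>. f x = 0" using integral_nonneg_eq_0_iff_AE[OF assms(1,2)] by simp
    then have "AE x in \<mu>. x \<in> {a}" by eventually_elim (use assms(3) in simp)
    then have "prob {a} = 1" by (subst prob_eq_1) auto
    then show False using nondegenerate[of a] by simp
  qed
  then show ?thesis using integral_nonneg_AE[OF assms(2)] by linarith
qed

definition K1 :: "real \<Rightarrow> real" where "K1 \<theta> = tilted_moment 1 \<theta> / tilted_moment 0 \<theta>"

definition K2 :: "real \<Rightarrow> real" where "K2 \<theta> = tilted_moment 2 \<theta> / tilted_moment 0 \<theta> - (K1 \<theta>)\<^sup>2"

definition K3 :: "real \<Rightarrow> real" where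
  "K3 \<theta> = tilted_moment 3 \<theta> / tilted_moment 0 \<theta> - tilted_moment 2 \<theta> * tilted_moment 1 \<theta> / (tilted_moment 0 \<theta>)\<^sup>2 - 2 * K1 \<theta> * K2 \<theta>"

lemma cumulant_eq: "cumulant_gf \<mu> = (\<lambda>\<theta>. ln (tilted_moment 0 \<theta>))"
  by (auto simp: cumulant_gf_def tilted_moment_def)

lemma exp_cumulant: "exp (cumulant_gf \<mu> \<theta>) = tilted_moment 0 \<theta>"
  using tilted_moment_pos by (simp add: cumulant_eq)

lemma K_deriv: "(cumulant_gf \<mu> has_real_derivative K1 \<theta>) (at \<theta>)"
  unfolding cumulant_eq K1_def
  using tilted_moment_pos[of \<theta>] tilted_moment_deriv[of 0 \<theta>] by (auto intro!: derivative_eq_intros)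

lemma K1_deriv: "(K1 has_real_derivative K2 \<theta>) (at \<theta>)"
proof -
  have "((\<lambda>\<theta>. tilted_moment 1 \<theta> / tilted_moment 0 \<theta>) has_real_derivative
      (tilted_moment 2 \<theta> * tilted_moment 0 \<theta> - tilted_moment 1 \<theta> * tilted_moment 1 \<theta>) / (tilted_moment 0 \<theta> * tilted_moment 0 \<theta>)) (at \<theta>)"
    using tilted_moment_pos[of \<theta>] tilted_moment_deriv[of 0 \<theta>] tilted_moment_deriv[of 1 \<theta>]
    by (intro DERIV_divide) (auto simp: numeral_2_eq_2)
  moreover have "(tilted_moment 2 \<theta> * tilted_moment 0 \<theta> - tilted_moment 1 \<theta> * tilted_moment 1 \<theta>) / (tilted_moment 0 \<theta> * tilted_moment 0 \<theta>) = K2 \<theta>"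
    using tilted_moment_pos[of \<theta>] by (simp add: K2_def K1_def field_simps power2_eq_square)
  ultimately show ?thesis by (simp add: K1_def[abs_def])
qed

lemma K2_deriv: "(K2 has_real_derivative K3 \<theta>) (at \<theta>)"
proof -
  have "((\<lambda>\<theta>. tilted_moment 2 \<theta> / tilted_moment 0 \<theta> - (K1 \<theta>)\<^sup>2) has_real_derivative
      (tilted_moment 3 \<theta> * tilted_moment 0 \<theta> - tilted_moment 2 \<theta> * tilted_moment 1 \<theta>) / (tilted_moment 0 \<theta> * tilted_moment 0 \<theta>)
       - 2 * K1 \<theta> * K2 \<theta>) (at \<theta>)"
    using tilted_moment_pos[of \<theta>] tilted_moment_deriv[of 0 \<theta>] tilted_moment_deriv[of 2 \<theta>] K1_deriv[of \<theta>]
    by (intro DERIV_diff DERIV_divide) (auto simp: numeral_3_eq_3 numeral_2_eq_2 intro!: derivative_eq_intros)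
  moreover have "(tilted_moment 3 \<theta> * tilted_moment 0 \<theta> - tilted_moment 2 \<theta> * tilted_moment 1 \<theta>) / (tilted_moment 0 \<theta> * tilted_moment 0 \<theta>)
       - 2 * K1 \<theta> * K2 \<theta> = K3 \<theta>"
    using tilted_moment_pos[of \<theta>] by (simp add: K3_def field_simps power2_eq_square)
  ultimately show ?thesis by (simp add: K2_def[abs_def])
qed

lemma isCont_cumulant_derivs: "isCont K1 \<theta>" "isCont K2 \<theta>" "isCont K3 \<theta>"
proof -
  have m: "isCont (tilted_moment k) \<theta>" for k using tilted_moment_deriv DERIV_isCont by blast
  show "isCont K1 \<theta>" "isCont K2 \<theta>" using K1_deriv K2_deriv DERIV_isCont by blast+
  then show "isCont K3 \<theta>"
    unfolding K3_def[abs_def] using tilted_moment_pos[of \<theta>] m by (intro continuous_intros) auto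
qed

lemma higher_derivs:
  "deriv (cumulant_gf \<mu>) = K1" "(deriv ^^ 2) (cumulant_gf \<mu>) = K2" "(deriv ^^ 3) (cumulant_gf \<mu>) = K3"
proof -
  show 1: "deriv (cumulant_gf \<mu>) = K1" using K_deriv DERIV_imp_deriv by blast
  have 2: "deriv K1 = K2" using K1_deriv DERIV_imp_deriv by blast
  have 3: "deriv K2 = K3" using K2_deriv DERIV_imp_deriv by blast
  show "(deriv ^^ 2) (cumulant_gf \<mu>) = K2" "(deriv ^^ 3) (cumulant_gf \<mu>) = K3"
    by (simp_all add: numeral_2_eq_2 numeral_3_eq_3 1 2 3)
qed

lemma K1_pos: "K1 \<theta> > 0"
proof -
  have "tilted_moment 1 \<theta> > 0"
    unfolding tilted_moment_def
    by (rule integral_pos_if_not_null[where a = 0, OF integrable_tilted_moment]) (use AE_unit in auto)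
  then show ?thesis using tilted_moment_pos by (simp add: K1_def)
qed

lemma K1_le: "K1 \<theta> \<le> 1"
proof -
  have "tilted_moment 1 \<theta> \<le> tilted_moment 0 \<theta>"
    unfolding tilted_moment_def using AE_unit
    by (intro integral_mono_AE integrable_tilted_moment) (auto elim!: eventually_mono)
  then show ?thesis using tilted_moment_pos[of \<theta>] by (simp add: K1_def)
qed

text \<open>\<open>K2 \<theta>\<close> is the variance of the weight under the tilted distribution, whose mean is \<open>K1 \<theta>\<close>.\<close>

lemma K2_pos: "K2 \<theta> > 0"
proof -
  let ?c = "K1 \<theta>"
  have eq: "(x - ?c)\<^sup>2 * exp (\<theta> * x) = x ^ 2 * exp (\<theta> * x) - 2 * ?c * (x ^ 1 * exp (\<theta> * x))
      + ?c\<^sup>2 * (x ^ 0 * exp (\<theta> * x))" for x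
    by (simp add: power2_eq_square algebra_simps)
  have int: "integrable \<mu> (\<lambda>x. (x - ?c)\<^sup>2 * exp (\<theta> * x))"
    unfolding eq by (intro Bochner_Integration.integrable_add Bochner_Integration.integrable_diff
        integrable_mult_right integrable_tilted_moment)
  have "0 < (LINT x|\<mu>. (x - ?c)\<^sup>2 * exp (\<theta> * x))"
    by (rule integral_pos_if_not_null[where a = ?c, OF int]) auto
  also have "\<dots> = tilted_moment 2 \<theta> - 2 * ?c * tilted_moment 1 \<theta> + ?c\<^sup>2 * tilted_moment 0 \<theta>"
    unfolding eq tilted_moment_def by (subst Bochner_Integration.integral_add Bochner_Integration.integral_diff;
      (intro Bochner_Integration.integrable_diff integrable_mult_right integrable_tilted_moment)?)+ simp
  also have "\<dots> = K2 \<theta> * tilted_moment 0 \<theta>"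
    using tilted_moment_pos[of \<theta>] by (simp add: K2_def K1_def field_simps power2_eq_square)
  finally show ?thesis using tilted_moment_pos[of \<theta>] by (simp add: zero_less_mult_iff)
qed

text \<open>The moment generating function is entire and positive at \<open>x\<close>.  Near \<open>x\<close> it stays in the right
  half-plane, where the principal logarithm is holomorphic.\<close>

lemma cumulant_extends:
  "\<exists>Kc r. r > 0 \<and> Kc holomorphic_on ball (complex_of_real x) r \<and>
      (\<forall>t. \<bar>t - x\<bar> < r \<longrightarrow> Kc (complex_of_real t) = complex_of_real (cumulant_gf \<mu> t))"
proof -
  define Mc where "Mc z = (\<Sum>n. complex_of_real (moment_coef 0 n) * z ^ n)" for z
  have Mc_real: "(\<lambda>n. complex_of_real (moment_coef 0 n) * of_real t ^ n) sums of_real (tilted_moment 0 t)" for t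
    using sums_of_real[OF moment_coef_sums[of 0 t]] by simp
  have summ: "summable (\<lambda>n. complex_of_real (moment_coef 0 n) * z ^ n)" for z
  proof (rule powser_inside)
    show "summable (\<lambda>n. complex_of_real (moment_coef 0 n) * of_real (norm z + 1) ^ n)"
      using Mc_real sums_summable by blast
  qed simp
  have Mc_deriv: "\<exists>d. (Mc has_field_derivative d) (at z)" for z
    using termdiffs_strong_converges_everywhere[OF summ, of z] unfolding Mc_def by blast
  then have Mc_holo: "Mc holomorphic_on A" for A
    unfolding holomorphic_on_def field_differentiable_def using has_field_derivative_at_within by blast
  have Mc_eq: "Mc (of_real t) = of_real (tilted_moment 0 t)" for t
    unfolding Mc_def using sums_unique[OF Mc_real[of t]] by simp
  have "isCont Mc (of_real x)" using Mc_deriv DERIV_isCont by blast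
  then obtain r where r: "r > 0" "\<And>z. dist z (of_real x) < r \<Longrightarrow> dist (Mc z) (Mc (of_real x)) < tilted_moment 0 x"
    unfolding continuous_at_eps_delta using tilted_moment_pos[of x] by blast
  have "Mc z \<notin> \<real>\<^sub>\<le>\<^sub>0" if "z \<in> ball (of_real x) r" for z
  proof -
    have "norm (Mc z - of_real (tilted_moment 0 x)) < tilted_moment 0 x"
      using r(2)[of z] that by (simp add: dist_commute Mc_eq flip: dist_norm)
    then have "\<bar>Re (Mc z) - tilted_moment 0 x\<bar> < tilted_moment 0 x"
      using abs_Re_le_cmod[of "Mc z - of_real (tilted_moment 0 x)"] by simp
    then show ?thesis by (auto simp: complex_nonpos_Reals_iff)
  qed
  then have "(\<lambda>z. Ln (Mc z)) holomorphic_on ball (of_real x) r"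
    by (intro holomorphic_intros Mc_holo)
  moreover have "Ln (Mc (of_real t)) = of_real (cumulant_gf \<mu> t)" for t
    using tilted_moment_pos[of t] by (simp add: Mc_eq Ln_of_real cumulant_eq)
  ultimately show ?thesis using r(1) by blast
qed

text \<open>Up to a factor \<open>p - 1\<close>, the function \<open>K1 ^ (p - 2) * K2\<close> is the derivative of the bounded
  function \<open>K1 ^ (p - 1)\<close>.  Its own derivative is a positive multiple of
  \<open>(p - 2) K2\<^sup>2 + K3 K1\<close>, which vanishes only at \<open>c\<close>.\<close>

lemma curvature_unimodal:
  fixes p :: nat
  assumes "p \<ge> 2"
    and unique: "\<And>\<theta>. K3 \<theta> * K1 \<theta> = - (real p - 2) * (K2 \<theta>)\<^sup>2 \<Longrightarrow> \<theta> = c"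
  shows "x < y \<Longrightarrow> y \<le> c \<Longrightarrow> K1 x ^ (p - 2) * K2 x < K1 y ^ (p - 2) * K2 y"
    and "c \<le> x \<Longrightarrow> x < y \<Longrightarrow> K1 y ^ (p - 2) * K2 y < K1 x ^ (p - 2) * K2 x"
proof -
  define w where "w \<theta> = real (p - 1) * (K1 \<theta> ^ (p - 2) * K2 \<theta>)" for \<theta>
  \<comment> \<open>the derivative of \<open>w\<close>, written as a positive factor times the expression in \<open>unique\<close>\<close>
  define v where "v \<theta> = real (p - 1) * (K1 \<theta> ^ (p - 2) / K1 \<theta>) * ((real p - 2) * (K2 \<theta>)\<^sup>2 + K3 \<theta> * K1 \<theta>)" for \<theta>
  have p1: "real (p - 1) > 0" using \<open>p \<ge> 2\<close> by simp
  have "((\<lambda>\<theta>. K1 \<theta> ^ (p - 2) * K2 \<theta>) has_real_derivative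
      K1 \<theta> ^ (p - 2) / K1 \<theta> * ((real p - 2) * (K2 \<theta>)\<^sup>2 + K3 \<theta> * K1 \<theta>)) (at \<theta>)" for \<theta>
  proof -
    have "((\<lambda>\<theta>. K1 \<theta> ^ (p - 2) * K2 \<theta>) has_real_derivative
      (real (p - 2) * K1 \<theta> ^ (p - 2 - 1) * K2 \<theta>) * K2 \<theta> + K3 \<theta> * K1 \<theta> ^ (p - 2)) (at \<theta>)"
      by (auto intro!: derivative_eq_intros K1_deriv K2_deriv)
    moreover
    have "real (p - 2) * K1 \<theta> ^ (p - 2 - 1) = (real p - 2) * (K1 \<theta> ^ (p - 2) / K1 \<theta>)"
    proof (cases "p = 2")
      case False
      then obtain k where "p = Suc k + 2" using \<open>p \<ge> 2\<close> by (metis add.commute le_Suc_ex add_0_right not0_implies_Suc)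
      then show ?thesis using K1_pos[of \<theta>] by (simp add: of_nat_diff)
    qed simp
    then have "(real (p - 2) * K1 \<theta> ^ (p - 2 - 1) * K2 \<theta>) * K2 \<theta> + K3 \<theta> * K1 \<theta> ^ (p - 2) =
        K1 \<theta> ^ (p - 2) / K1 \<theta> * ((real p - 2) * (K2 \<theta>)\<^sup>2 + K3 \<theta> * K1 \<theta>)"
      using K1_pos[of \<theta>] by (simp add: distrib_left power2_eq_square)
    ultimately show ?thesis by (simp only:)
  qed
  then have w: "(w has_real_derivative v \<theta>) (at \<theta>)" for \<theta>
    unfolding w_def v_def mult.assoc by (rule DERIV_cmult)
  have w_pos: "w \<theta> > 0" for \<theta> unfolding w_def using p1 K1_pos K2_pos by simp
  have cont: "continuous_on UNIV K1" "continuous_on UNIV K2" "continuous_on UNIV K3"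
    using isCont_cumulant_derivs by (simp_all add: continuous_at_imp_continuous_on)
  have v_cont: "continuous_on UNIV v"
    unfolding v_def
  proof (intro continuous_intros cont)
    show "\<forall>\<theta>\<in>UNIV. K1 \<theta> \<noteq> 0" using K1_pos by (metis less_irrefl)
  qed
  have zero: "\<theta> = c" if "v \<theta> = 0" for \<theta>
  proof -
    have "(real p - 2) * (K2 \<theta>)\<^sup>2 + K3 \<theta> * K1 \<theta> = 0"
      using that p1 K1_pos[of \<theta>] by (simp add: v_def)
    then have "K3 \<theta> * K1 \<theta> = - ((real p - 2) * (K2 \<theta>)\<^sup>2)" by linarith
    then show ?thesis by (intro unique) (simp only: mult_minus_left)
  qed
  have Q: "((\<lambda>\<theta>. K1 \<theta> ^ (p - 1)) has_real_derivative w \<theta>) (at \<theta>)" for \<theta>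
  proof -
    have "((\<lambda>\<theta>. K1 \<theta> ^ (p - 1)) has_real_derivative real (p - 1) * K1 \<theta> ^ (p - 1 - 1) * K2 \<theta>) (at \<theta>)"
      by (auto intro!: derivative_eq_intros K1_deriv)
    moreover have "p - 1 - 1 = p - 2" by simp
    ultimately show ?thesis by (simp add: w_def mult.assoc)
  qed
  have Q_bounds: "0 \<le> K1 \<theta> ^ (p - 1)" "K1 \<theta> ^ (p - 1) \<le> 1" for \<theta>
    using K1_pos[of \<theta>] K1_le[of \<theta>] by (auto intro: power_le_one less_imp_le)
  note sign_right = derivative_sign_right[OF w w_pos v_cont zero Q Q_bounds]
  note sign_left = derivative_sign_left[OF w w_pos v_cont zero Q Q_bounds]
  have w_cont: "continuous_on A w" for A using w DERIV_isCont by (meson continuous_at_imp_continuous_on)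
  show "K1 x ^ (p - 2) * K2 x < K1 y ^ (p - 2) * K2 y" if "x < y" "y \<le> c"
  proof -
    have "w x < w y"
    proof (rule DERIV_pos_imp_increasing_open[OF that(1) _ w_cont])
      fix t assume "x < t" "t < y"
      then show "\<exists>d. (w has_real_derivative d) (at t) \<and> 0 < d" using w sign_left[of t] that by auto
    qed
    then show ?thesis using p1 by (simp add: w_def)
  qed
  show "K1 y ^ (p - 2) * K2 y < K1 x ^ (p - 2) * K2 x" if "c \<le> x" "x < y"
  proof -
    have "w y < w x"
    proof (rule DERIV_neg_imp_decreasing_open[OF that(2) _ w_cont])
      fix t assume "x < t" "t < y"
      then show "\<exists>d. (w has_real_derivative d) (at t) \<and> d < 0" using w sign_right[of t] that by auto
    qed
    then show ?thesis using p1 by (simp add: w_def)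
  qed
qed

end

section \<open>The limiting normalization constant\<close>

context weight_distribution
begin

text \<open>With \<open>u = K1 \<theta>\<close> the last term is half of the rate function at \<open>u\<close>, since \<open>\<theta>\<close> is the tilt for
  which the supremum in the Legendre transform of the cumulant generating function is attained.\<close>

definition free_energy :: "nat \<Rightarrow> real \<Rightarrow> real \<Rightarrow> real \<Rightarrow> real" where
  "free_energy p b1 b2 \<theta> = b1 * K1 \<theta> + b2 * K1 \<theta> ^ p - (\<theta> * K1 \<theta> - cumulant_gf \<mu> \<theta>) / 2"

lemma prob_space_random_weights: "prob_space (random_weights \<mu> n)"
  unfolding random_weights_def by (intro prob_space_PiM) unfold_locales

lemma AE_random_weights: "AE w in random_weights \<mu> n. \<forall>e\<in>vertex_pairs n. 0 \<le> w e \<and> w e \<le> 1"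
proof (rule AE_finite_allI[OF finite_vertex_pairs])
  fix e assume e: "e \<in> vertex_pairs n"
  show "AE w in random_weights \<mu> n. 0 \<le> w e \<and> w e \<le> 1"
    unfolding random_weights_def
    by (rule AE_PiM_component[OF _ e AE_unit]) unfold_locales
qed

lemma edge_weight_bounds:
  assumes "\<forall>e\<in>vertex_pairs n. 0 \<le> w e \<and> w e \<le> 1"
  shows "0 \<le> edge_weight n w i j \<and> edge_weight n w i j \<le> 1"
  using assms by (auto simp: edge_weight_def)

lemma measurable_weight:
  "e \<in> vertex_pairs n \<Longrightarrow> (\<lambda>w. w e) \<in> borel_measurable (random_weights \<mu> n)"
  unfolding random_weights_def by (rule measurable_compose[OF measurable_component_singleton]) auto

lemma measurable_edge_weight: "(\<lambda>w. edge_weight n w i j) \<in> borel_measurable (random_weights \<mu> n)"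
  unfolding edge_weight_def
  by (cases "(i, j) \<in> vertex_pairs n"; cases "(j, i) \<in> vertex_pairs n") (simp_all add: measurable_weight)

lemma measurable_hom_sum: "(\<lambda>w. hom_sum I V E (edge_weight n w)) \<in> borel_measurable (random_weights \<mu> n)"
  unfolding hom_sum_def by (intro borel_measurable_sum borel_measurable_prod measurable_edge_weight)

lemma hom_sum_bounds:
  assumes "finite I" "finite V" "\<And>i j. 0 \<le> h i j \<and> h i j \<le> 1"
  shows "0 \<le> hom_sum I V E h" "hom_sum I V E h \<le> real (card V) ^ card I"
proof -
  have "0 \<le> (\<Prod>e\<in>E. h (\<phi> (fst e)) (\<phi> (snd e))) \<and> (\<Prod>e\<in>E. h (\<phi> (fst e)) (\<phi> (snd e))) \<le> 1" for \<phi>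
    using assms(3) by (intro conjI prod_nonneg prod_le_1) auto
  then have "0 \<le> hom_sum I V E h" "hom_sum I V E h \<le> real (card (I \<rightarrow>\<^sub>E V)) * 1"
    unfolding hom_sum_def by (intro sum_nonneg sum_bounded_above; blast)+
  then show "0 \<le> hom_sum I V E h" "hom_sum I V E h \<le> real (card V) ^ card I"
    using assms by (simp_all add: card_PiE)
qed

definition hamiltonian :: "sgraph \<Rightarrow> nat \<Rightarrow> real \<Rightarrow> real \<Rightarrow> (nat \<times> nat \<Rightarrow> real) \<Rightarrow> real" where
  "hamiltonian H n b1 b2 w = (real n)\<^sup>2 * (b1 * hom_density single_edge n w + b2 * hom_density H n w)"

lemma hamiltonian_eq:
  assumes "simple_graph H" "n > 0"
  shows "hamiltonian H n b1 b2 w = b1 * (\<Sum>e\<in>vertex_pairs n. 2 * w e) +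
    b2 * ((real n)\<^sup>2 * (hom_sum {1..fst H} {1..n} (graph_edges H) (edge_weight n w) / real n ^ fst H))"
  unfolding hamiltonian_def hom_density_single_edge[OF assms(2), symmetric] hom_density_eq[OF assms]
  by (simp add: algebra_simps)

lemma integrable_exp_hamiltonian:
  assumes H: "simple_graph H" and n: "n > 0"
  shows "integrable (random_weights \<mu> n) (\<lambda>w. exp (hamiltonian H n b1 b2 w))"
proof -
  interpret W: prob_space "random_weights \<mu> n" by (rule prob_space_random_weights)
  let ?B = "\<bar>b1\<bar> * (\<Sum>e\<in>vertex_pairs n. 2) + \<bar>b2\<bar> * ((real n)\<^sup>2 * 1)"
  have "hamiltonian H n b1 b2 \<in> borel_measurable (random_weights \<mu> n)"
    unfolding hamiltonian_eq[OF assms, abs_def]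
    by (intro borel_measurable_add borel_measurable_times borel_measurable_const
        borel_measurable_sum borel_measurable_divide measurable_hom_sum measurable_weight)
  from measurable_compose[OF this borel_measurable_exp]
  have "(\<lambda>w. exp (hamiltonian H n b1 b2 w)) \<in> borel_measurable (random_weights \<mu> n)" .
  moreover have "AE w in random_weights \<mu> n. norm (exp (hamiltonian H n b1 b2 w)) \<le> exp ?B"
    using AE_random_weights
  proof eventually_elim
    case (elim w)
    let ?t = "hom_sum {1..fst H} {1..n} (graph_edges H) (edge_weight n w)"
    have "0 \<le> ?t" "?t \<le> real n ^ fst H"
      using hom_sum_bounds[of "{1..fst H}" "{1..n}" "edge_weight n w"] edge_weight_bounds[OF elim] by auto
    then have t: "0 \<le> ?t / real n ^ fst H" "?t / real n ^ fst H \<le> 1" using n by (auto simp: divide_le_eq)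
    have s: "0 \<le> (\<Sum>e\<in>vertex_pairs n. 2 * w e)" using elim by (intro sum_nonneg) auto
    have s': "(\<Sum>e\<in>vertex_pairs n. 2 * w e) \<le> (\<Sum>e\<in>vertex_pairs n. 2)"
      using elim by (intro sum_mono) auto
    have "b1 * (\<Sum>e\<in>vertex_pairs n. 2 * w e) \<le> \<bar>b1\<bar> * (\<Sum>e\<in>vertex_pairs n. 2)"
      using s s' by (intro mult_mono) auto
    moreover have "b2 * ((real n)\<^sup>2 * (?t / real n ^ fst H)) \<le> \<bar>b2\<bar> * ((real n)\<^sup>2 * 1)"
      using t by (intro mult_mono mult_left_mono mult_nonneg_nonneg) auto
    ultimately show ?case unfolding hamiltonian_eq[OF assms] by simp
  qed
  ultimately show ?thesis by (intro W.integrable_const_bound)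
qed

text \<open>Convex duality.  At \<open>\<theta> = 2 \<alpha>\<close> the free energy with \<open>u ^ p\<close> replaced by its tangent at \<open>v\<close> is
  half of the cumulant generating function at \<open>2 \<alpha>\<close> plus \<open>b2\<close> times the constant term of the
  tangent, and the tangent lies below \<open>u ^ p\<close>.\<close>

lemma tilted_block_bound:
  assumes b2: "b2 \<ge> 0" and V: "\<And>\<theta>. free_energy p b1 b2 \<theta> \<le> V" and "v \<ge> 0"
  shows "(LINT x|\<mu>. exp (2 * (b1 + b2 * (real p * v ^ (p - 1))) * x + 2 * (b2 * ((1 - real p) * v ^ p)))) \<le> exp (2 * V)"
proof -
  define \<alpha> where "\<alpha> = b1 + b2 * (real p * v ^ (p - 1))"
  define u where "u = K1 (2 * \<alpha>)"
  have "(1 - real p) * v ^ p + real p * v ^ (p - 1) * u \<le> u ^ p"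
  proof (cases p)
    case (Suc k)
    then show ?thesis
      using power_tangent[of v u p] \<open>v \<ge> 0\<close> K1_pos[of "2 * \<alpha>"] by (simp add: u_def algebra_simps)
  qed simp
  then have "b2 * ((1 - real p) * v ^ p) \<le> b2 * (u ^ p - real p * v ^ (p - 1) * u)"
    using b2 by (intro mult_left_mono) auto
  also have "\<dots> = b2 * u ^ p + b1 * u - \<alpha> * u" by (simp add: \<alpha>_def algebra_simps)
  finally have "cumulant_gf \<mu> (2 * \<alpha>) + 2 * (b2 * ((1 - real p) * v ^ p)) \<le> 2 * V"
    using V[of "2 * \<alpha>"] unfolding free_energy_def u_def[symmetric] by argo
  then have "exp (cumulant_gf \<mu> (2 * \<alpha>)) * exp (2 * (b2 * ((1 - real p) * v ^ p))) \<le> exp (2 * V)"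
    by (simp flip: exp_add)
  moreover have "(LINT x|\<mu>. exp (2 * \<alpha> * x + 2 * (b2 * ((1 - real p) * v ^ p)))) =
      exp (cumulant_gf \<mu> (2 * \<alpha>)) * exp (2 * (b2 * ((1 - real p) * v ^ p)))"
    unfolding exp_cumulant tilted_moment_def by (simp add: exp_add)
  ultimately show ?thesis unfolding \<alpha>_def by simp
qed

lemma integrable_exp_affine: "integrable \<mu> (\<lambda>x. exp (a * x + b))"
  using integrable_tilted_moment[of 0 a] by (simp add: exp_add)

text \<open>The exponential of the Hamiltonian is at most the sum, over all colourings and all choices of
  grid points, of exponentials of linear functions of the weights.  The weights are independent, so each term
  factorizes over the pairs of vertices.  There are \<open>M ^ n (L + 1) ^ (M\<^sup>2)\<close> terms, which is negligible on
  the scale \<open>exp (n\<^sup>2)\<close>.\<close>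

lemma partition_upper:
  assumes H: "simple_graph H" "card (snd H) = p" "p \<ge> 1" and b2: "b2 \<ge> 0" and n: "n > 0" and L: "L > 0"
    and V: "\<And>\<theta>. free_energy p b1 b2 \<theta> \<le> V"
    and M: "\<And>h. (\<And>x. x \<in> {1..n} \<times> {1..n} \<Longrightarrow> 0 \<le> h x \<and> h x \<le> 1) \<Longrightarrow>
      \<exists>c. c ` {1..n} \<subseteq> {..<M} \<and> cut_regular {1..n} \<epsilon> c h"
  shows "(LINT w|random_weights \<mu> n. exp (hamiltonian H n b1 b2 w)) \<le>
    real M ^ n * real (L + 1) ^ (M * M) *
      exp ((real n)\<^sup>2 * (b2 * (real p * \<epsilon> + real p / real L)) + real n * (real n - 1) * V)"
proof -
  interpret product_sigma_finite "\<lambda>_ :: nat \<times> nat. \<mu>"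
    by (rule product_sigma_finite.intro) unfold_locales
  let ?P = "vertex_pairs n" and ?V = "{1..n}"
  let ?W = "random_weights \<mu> n"
  define \<delta> where "\<delta> = (real n)\<^sup>2 * (b2 * (real p * \<epsilon> + real p / real L))"
  let ?C = "?V \<rightarrow>\<^sub>E {..<M}" and ?S = "{..<M} \<times> {..<M} \<rightarrow>\<^sub>E {..L}"
  define v where "v c \<sigma> e = real (\<sigma> (c (fst e), c (snd e))) / real L" for c :: "nat \<Rightarrow> nat" and \<sigma> :: "nat \<times> nat \<Rightarrow> nat" and e
  define f where "f c \<sigma> e x = exp (2 * (b1 + b2 * (real p * v c \<sigma> e ^ (p - 1))) * x + 2 * (b2 * ((1 - real p) * v c \<sigma> e ^ p)))"
    for c \<sigma> e and x :: real
  have v_nonneg: "v c \<sigma> e \<ge> 0" for c \<sigma> e by (simp add: v_def)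
  have f_int: "integrable \<mu> (f c \<sigma> e)" for c \<sigma> e unfolding f_def by (rule integrable_exp_affine)
  have prod_f_nonneg: "0 \<le> (\<Prod>e\<in>?P. f c \<sigma> e (w e))" for c \<sigma> w by (intro prod_nonneg) (simp add: f_def)
  have prod_int: "integrable ?W (\<lambda>w. \<Prod>e\<in>?P. f c \<sigma> e (w e))" for c \<sigma>
    unfolding random_weights_def by (intro product_integrable_prod f_int) simp
  have "exp (hamiltonian H n b1 b2 w) \<le> (\<Sum>c\<in>?C. \<Sum>\<sigma>\<in>?S. exp \<delta> * (\<Prod>e\<in>?P. f c \<sigma> e (w e)))"
    if w: "\<forall>e\<in>?P. 0 \<le> w e \<and> w e \<le> 1" for w
  proof -
    let ?h = "edge_weight n w"
    note h = edge_weight_bounds[OF w]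
    obtain c where c: "c ` ?V \<subseteq> {..<M}" "cut_regular ?V \<epsilon> c (\<lambda>x. ?h (fst x) (snd x))"
      using M[of "\<lambda>x. ?h (fst x) (snd x)"] h by blast
    obtain \<sigma> where \<sigma>: "\<sigma> \<in> ?S" "\<And>i j. i \<in> ?V \<Longrightarrow> j \<in> ?V \<Longrightarrow> \<sigma> (c i, c j) = \<sigma> (c j, c i)" and
      up: "(real n)\<^sup>2 * (hom_sum {1..fst H} ?V (graph_edges H) ?h / real n ^ fst H) \<le>
      (real n)\<^sup>2 * (real p * \<epsilon> + real p / real L) +
      (\<Sum>i\<in>?V. \<Sum>j\<in>?V. real p * (real (\<sigma> (c i, c j)) / real L) ^ (p - 1) * ?h i j
         + (1 - real p) * (real (\<sigma> (c i, c j)) / real L) ^ p)"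
      using hom_sum_upper[OF H n L h edge_weight_sym c] by blast
    let ?g = "\<lambda>i j. real p * (real (\<sigma> (c i, c j)) / real L) ^ (p - 1) * ?h i j
         + (1 - real p) * (real (\<sigma> (c i, c j)) / real L) ^ p"
    \<comment> \<open>on the diagonal the weights vanish and the constant term of a tangent is not positive\<close>
    have "(\<Sum>i\<in>?V. ?g i i) \<le> 0"
      using H(3) by (intro sum_nonpos) (simp add: edge_weight_diag mult_nonpos_nonneg)
    then have "(\<Sum>i\<in>?V. \<Sum>j\<in>?V. ?g i j) \<le> (\<Sum>(i, j)\<in>?P. ?g i j + ?g j i)"
      unfolding sum_vertex_pairs by linarith
    also have "\<dots> = (\<Sum>e\<in>?P. 2 * (real p * v c \<sigma> e ^ (p - 1) * w e + (1 - real p) * v c \<sigma> e ^ p))"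
    proof (rule sum.cong[OF refl])
      fix e assume e: "e \<in> ?P"
      obtain i j where ij: "e = (i, j)" by fastforce
      then have "i \<in> ?V" "j \<in> ?V" using e by (auto simp: vertex_pairs_def)
      moreover have "?h i j = w e" using e ij by (simp add: edge_weight_def)
      moreover from this have "?h j i = w e" by (simp add: edge_weight_sym)
      ultimately show "(case e of (i, j) \<Rightarrow> ?g i j + ?g j i) =
          2 * (real p * v c \<sigma> e ^ (p - 1) * w e + (1 - real p) * v c \<sigma> e ^ p)"
        using \<sigma>(2)[of i j] unfolding ij by (simp add: v_def)
    qed
    finally have "b2 * ((real n)\<^sup>2 * (hom_sum {1..fst H} ?V (graph_edges H) ?h / real n ^ fst H)) \<le>
        b2 * ((real n)\<^sup>2 * (real p * \<epsilon> + real p / real L) +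
          (\<Sum>e\<in>?P. 2 * (real p * v c \<sigma> e ^ (p - 1) * w e + (1 - real p) * v c \<sigma> e ^ p)))"
      using up b2 by (intro mult_left_mono) linarith+
    then have "hamiltonian H n b1 b2 w \<le> b1 * (\<Sum>e\<in>?P. 2 * w e) + (\<delta> +
          b2 * (\<Sum>e\<in>?P. 2 * (real p * v c \<sigma> e ^ (p - 1) * w e + (1 - real p) * v c \<sigma> e ^ p)))"
      unfolding hamiltonian_eq[OF H(1) n] \<delta>_def by (simp add: algebra_simps)
    also have "\<dots> = \<delta> + (\<Sum>e\<in>?P. 2 * (b1 + b2 * (real p * v c \<sigma> e ^ (p - 1))) * w e + 2 * (b2 * ((1 - real p) * v c \<sigma> e ^ p)))"
      by (simp add: sum_distrib_left sum.distrib[symmetric] algebra_simps)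
    finally have "exp (hamiltonian H n b1 b2 w) \<le> exp \<delta> * (\<Prod>e\<in>?P. f c \<sigma> e (w e))"
      by (simp add: f_def exp_add[symmetric] flip: exp_sum)
    also have "(\<Prod>e\<in>?P. f c \<sigma> e (w e)) = (\<Prod>e\<in>?P. f (restrict c ?V) \<sigma> e (w e))"
      by (intro prod.cong refl) (auto simp: f_def v_def vertex_pairs_def)
    also have "exp \<delta> * \<dots> \<le> (\<Sum>\<sigma>\<in>?S. exp \<delta> * (\<Prod>e\<in>?P. f (restrict c ?V) \<sigma> e (w e)))"
      using \<sigma>(1) by (intro member_le_sum[where f = "\<lambda>\<sigma>. exp \<delta> * (\<Prod>e\<in>?P. f (restrict c ?V) \<sigma> e (w e))"])
        (auto simp: finite_PiE prod_f_nonneg)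
    also have "\<dots> \<le> (\<Sum>c\<in>?C. \<Sum>\<sigma>\<in>?S. exp \<delta> * (\<Prod>e\<in>?P. f c \<sigma> e (w e)))"
      using c(1) by (intro member_le_sum[where f = "\<lambda>c. \<Sum>\<sigma>\<in>?S. exp \<delta> * (\<Prod>e\<in>?P. f c \<sigma> e (w e))"])
        (auto simp: finite_PiE intro!: sum_nonneg mult_nonneg_nonneg prod_f_nonneg)
    finally show ?thesis .
  qed
  then have "(LINT w|?W. exp (hamiltonian H n b1 b2 w)) \<le>
      (LINT w|?W. (\<Sum>c\<in>?C. \<Sum>\<sigma>\<in>?S. exp \<delta> * (\<Prod>e\<in>?P. f c \<sigma> e (w e))))"
    using AE_random_weights[of n]
    by (intro integral_mono_AE integrable_exp_hamiltonian H n Bochner_Integration.integrable_sum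
        integrable_mult_right prod_int) (auto elim!: eventually_mono)
  also have "\<dots> = (\<Sum>c\<in>?C. \<Sum>\<sigma>\<in>?S. exp \<delta> * (LINT w|?W. (\<Prod>e\<in>?P. f c \<sigma> e (w e))))"
    by (simp add: Bochner_Integration.integral_sum Bochner_Integration.integrable_sum prod_int)
  also have "\<dots> \<le> (\<Sum>c\<in>?C. \<Sum>\<sigma>\<in>?S. exp \<delta> * exp (real n * (real n - 1) * V))"
  proof (intro sum_mono mult_left_mono)
    fix c \<sigma>
    have "(LINT w|?W. (\<Prod>e\<in>?P. f c \<sigma> e (w e))) = (\<Prod>e\<in>?P. LINT x|\<mu>. f c \<sigma> e x)"
      unfolding random_weights_def by (intro product_integral_prod f_int) simp
    also have "\<dots> \<le> (\<Prod>e\<in>?P. exp (2 * V))"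
      using tilted_block_bound[OF b2 V v_nonneg] unfolding f_def by (intro prod_mono) (auto intro: integral_nonneg_AE)
    also have "\<dots> = exp (2 * real (card ?P) * V)" by (simp add: exp_of_nat_mult[symmetric] mult_ac)
    finally show "(LINT w|?W. (\<Prod>e\<in>?P. f c \<sigma> e (w e))) \<le> exp (real n * (real n - 1) * V)"
      unfolding card_vertex_pairs .
  qed simp
  also have "\<dots> = real M ^ n * real (L + 1) ^ (M * M) * exp (\<delta> + real n * (real n - 1) * V)"
    by (simp add: card_PiE card_cartesian_product exp_add)
  finally show ?thesis by (simp add: \<delta>_def)
qed

text \<open>Density, with respect to the product measure, of independent weights with mean \<open>K1 \<theta>\<close>.\<close>

definition tilt :: "nat \<Rightarrow> real \<Rightarrow> (nat \<times> nat \<Rightarrow> real) \<Rightarrow> real" where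
  "tilt n \<theta> w = (\<Prod>e\<in>vertex_pairs n. exp (\<theta> * w e - cumulant_gf \<mu> \<theta>))"

lemma tilt_moment:
  assumes A: "A \<subseteq> vertex_pairs n"
  shows "integrable (random_weights \<mu> n) (\<lambda>w. (\<Prod>e\<in>A. w e) * tilt n \<theta> w)"
    and "(LINT w|random_weights \<mu> n. (\<Prod>e\<in>A. w e) * tilt n \<theta> w) = K1 \<theta> ^ card A"
proof -
  interpret product_sigma_finite "\<lambda>_ :: nat \<times> nat. \<mu>"
    by (rule product_sigma_finite.intro) unfold_locales
  let ?P = "vertex_pairs n"
  define f where "f e x = x ^ (if e \<in> A then 1 else 0) * exp (\<theta> * x) * exp (- cumulant_gf \<mu> \<theta>)" for e and x :: real
  have f: "integrable \<mu> (f e)" "(LINT x|\<mu>. f e x) = (if e \<in> A then K1 \<theta> else 1)" for e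
  proof -
    show "integrable \<mu> (f e)" unfolding f_def by (intro integrable_mult_left integrable_tilted_moment)
    have "(LINT x|\<mu>. f e x) = tilted_moment (if e \<in> A then 1 else 0) \<theta> * exp (- cumulant_gf \<mu> \<theta>)"
      unfolding f_def tilted_moment_def by (rule integral_mult_left_zero)
    then show "(LINT x|\<mu>. f e x) = (if e \<in> A then K1 \<theta> else 1)"
      using tilted_moment_pos[of \<theta>] by (simp add: exp_minus exp_cumulant K1_def divide_inverse)
  qed
  have eq: "(\<Prod>e\<in>A. w e) * tilt n \<theta> w = (\<Prod>e\<in>?P. f e (w e))" for w
  proof -
    have "(\<Prod>e\<in>A. w e) = (\<Prod>e\<in>?P. if e \<in> A then w e else 1)"
      using A by (simp add: prod.inter_restrict[symmetric] Int_absorb1)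
    then show ?thesis
      unfolding tilt_def by (simp add: prod.distrib[symmetric] f_def)
        (intro prod.cong refl, simp add: exp_diff exp_minus divide_inverse)
  qed
  show "integrable (random_weights \<mu> n) (\<lambda>w. (\<Prod>e\<in>A. w e) * tilt n \<theta> w)"
    unfolding eq random_weights_def by (intro product_integrable_prod f) simp
  have "(LINT w|random_weights \<mu> n. (\<Prod>e\<in>A. w e) * tilt n \<theta> w) = (\<Prod>e\<in>?P. LINT x|\<mu>. f e x)"
    unfolding eq random_weights_def by (intro product_integral_prod f) simp
  also have "\<dots> = (\<Prod>e\<in>?P. if e \<in> A then K1 \<theta> else 1)" by (simp only: f)
  also have "\<dots> = (\<Prod>e\<in>A. K1 \<theta>)"
    using A by (simp add: prod.inter_restrict[symmetric] Int_absorb1)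
  finally show "(LINT w|random_weights \<mu> n. (\<Prod>e\<in>A. w e) * tilt n \<theta> w) = K1 \<theta> ^ card A" by simp
qed

lemma tilt_nonneg: "tilt n \<theta> w \<ge> 0" by (simp add: tilt_def prod_nonneg)

end

text \<open>At most \<open>k\<^sup>2\<close> pairs of points can collide, and each collision costs a factor \<open>n\<close>.\<close>

lemma card_injective_maps:
  "real n ^ k - (real k)\<^sup>2 * real n ^ (k - 1) \<le> real (card {\<phi> \<in> {1..k} \<rightarrow>\<^sub>E {1..n}. inj_on \<phi> {1..k}})"
proof -
  let ?\<Phi> = "{1..k} \<rightarrow>\<^sub>E {1..n}"
  let ?D = "{x \<in> {1..k} \<times> {1..k}. fst x \<noteq> snd x}"
  have fin: "finite ?\<Phi>" by (simp add: finite_PiE)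
  have coll: "real (card {\<phi>\<in>?\<Phi>. \<phi> (fst x) = \<phi> (snd x)}) \<le> real n ^ (k - 1)" if x: "x \<in> ?D" for x
  proof -
    have k: "k \<ge> 2" using x by auto
    have "real (card {\<phi>\<in>?\<Phi>. \<phi> (fst x) = \<phi> (snd x)}) = (\<Sum>\<phi>\<in>?\<Phi>. if \<phi> (fst x) = \<phi> (snd x) then 1 else 0)"
      using fin by (simp add: sum.inter_filter[symmetric])
    also have "\<dots> = real n ^ (k - 2) * (\<Sum>a\<in>{1..n}. \<Sum>b\<in>{1..n}. if a = b then 1 else 0)"
      using hom_sum_pair[of "{1..k}" "fst x" "snd x" "\<lambda>a b. if a = b then 1 else 0" "{1..n}"] x by auto
    also have "(\<Sum>a\<in>{1..n}. \<Sum>b\<in>{1..n}. if a = b then 1 else 0 :: real) = real n" by simp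
    also have "real n ^ (k - 2) * real n = real n ^ (k - 1)"
      using k by (metis Suc_1 Suc_diff_Suc Suc_le_lessD power_Suc2)
    finally show ?thesis by simp
  qed
  have "{\<phi>\<in>?\<Phi>. \<not> inj_on \<phi> {1..k}} \<subseteq> (\<Union>x\<in>?D. {\<phi>\<in>?\<Phi>. \<phi> (fst x) = \<phi> (snd x)})"
    unfolding inj_on_def by fastforce
  then have "card {\<phi>\<in>?\<Phi>. \<not> inj_on \<phi> {1..k}} \<le> card (\<Union>x\<in>?D. {\<phi>\<in>?\<Phi>. \<phi> (fst x) = \<phi> (snd x)})"
    using fin by (intro card_mono) auto
  also have "\<dots> \<le> (\<Sum>x\<in>?D. card {\<phi>\<in>?\<Phi>. \<phi> (fst x) = \<phi> (snd x)})" by (rule card_UN_le) simp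
  finally have "real (card {\<phi>\<in>?\<Phi>. \<not> inj_on \<phi> {1..k}}) \<le> (\<Sum>x\<in>?D. real (card {\<phi>\<in>?\<Phi>. \<phi> (fst x) = \<phi> (snd x)}))"
    by (simp flip: of_nat_sum)
  also have "\<dots> \<le> real (card ?D) * real n ^ (k - 1)" by (intro sum_bounded_above coll)
  also have "\<dots> \<le> (real k)\<^sup>2 * real n ^ (k - 1)"
  proof (rule mult_right_mono)
    have "card ?D \<le> card ({1..k} \<times> {1..k})" by (intro card_mono) auto
    then show "real (card ?D) \<le> (real k)\<^sup>2"
      by (simp add: card_cartesian_product power2_eq_square flip: of_nat_mult)
  qed simp
  finally have bad: "real (card {\<phi>\<in>?\<Phi>. \<not> inj_on \<phi> {1..k}}) \<le> (real k)\<^sup>2 * real n ^ (k - 1)" .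
  have "card ?\<Phi> = card {\<phi>\<in>?\<Phi>. inj_on \<phi> {1..k}} + card {\<phi>\<in>?\<Phi>. \<not> inj_on \<phi> {1..k}}"
    using fin by (subst card_Un_disjoint[symmetric]) (auto intro!: arg_cong[where f = card])
  then have "real n ^ k = real (card {\<phi>\<in>?\<Phi>. inj_on \<phi> {1..k}}) + real (card {\<phi>\<in>?\<Phi>. \<not> inj_on \<phi> {1..k}})"
    by (simp add: card_PiE flip: of_nat_power of_nat_add)
  then show ?thesis using bad by linarith
qed

context weight_distribution
begin

text \<open>An injective map sends distinct edges of \<open>H\<close> to distinct pairs of vertices, whose tilted
  weights are independent.\<close>

lemma injective_map_moment:
  assumes H: "simple_graph H" and \<phi>: "\<phi> \<in> {1..fst H} \<rightarrow>\<^sub>E {1..n}" "inj_on \<phi> {1..fst H}"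
  shows "(LINT w|random_weights \<mu> n. (\<Prod>e\<in>graph_edges H. edge_weight n w (\<phi> (fst e)) (\<phi> (snd e))) * tilt n \<theta> w)
    = K1 \<theta> ^ card (snd H)"
proof -
  let ?E = "graph_edges H"
  \<comment> \<open>the pair of vertices that carries the weight of the image of \<open>e\<close>\<close>
  define m where "m e = (min (\<phi> (fst e)) (\<phi> (snd e)), max (\<phi> (fst e)) (\<phi> (snd e)))" for e
  have ends: "\<phi> (fst e) \<in> {1..n}" "\<phi> (snd e) \<in> {1..n}" "\<phi> (fst e) \<noteq> \<phi> (snd e)" if "e \<in> ?E" for e
  proof -
    note v = graph_edges_vertices[OF H that]
    show "\<phi> (fst e) \<in> {1..n}" "\<phi> (snd e) \<in> {1..n}" using v \<phi>(1) by blast+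
    show "\<phi> (fst e) \<noteq> \<phi> (snd e)" using v inj_onD[OF \<phi>(2), of "fst e" "snd e"] by auto
  qed
  have m_in: "m e \<in> vertex_pairs n" if "e \<in> ?E" for e
    using ends[OF that] by (auto simp: m_def vertex_pairs_def min_def max_def)
  have m_inj: "inj_on m ?E"
  proof (rule inj_onI)
    fix e e' assume e: "e \<in> ?E" "e' \<in> ?E" "m e = m e'"
    note v = graph_edges_vertices[OF H e(1)] and v' = graph_edges_vertices[OF H e(2)]
    have "{\<phi> (fst e), \<phi> (snd e)} = {\<phi> (fst e'), \<phi> (snd e')}"
      using e(3) unfolding m_def min_def max_def by (auto split: if_splits)
    then have "\<phi> ` {fst e, snd e} = \<phi> ` {fst e', snd e'}" by simp
    then have "{fst e, snd e} = {fst e', snd e'}"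
      using inj_on_image_eq_iff[OF \<phi>(2), of "{fst e, snd e}" "{fst e', snd e'}"] v v' by simp
    then show "e = e'" using v v' by (auto simp: doubleton_eq_iff prod_eq_iff)
  qed
  have "edge_weight n w (\<phi> (fst e)) (\<phi> (snd e)) = w (m e)" if "e \<in> ?E" for e w
    using m_in[OF that] ends[OF that] by (auto simp: m_def edge_weight_def vertex_pairs_def min_def max_def)
  then have "(\<Prod>e\<in>?E. edge_weight n w (\<phi> (fst e)) (\<phi> (snd e))) = (\<Prod>x\<in>m ` ?E. w x)" for w
    using m_inj by (simp add: prod.reindex)
  then show ?thesis
    using tilt_moment(2)[of "m ` ?E" n \<theta>] m_in card_image[OF m_inj] card_graph_edges[OF H] by (simp add: image_subset_iff)
qed

lemma hom_sum_tilt: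
  assumes H: "simple_graph H" and n: "n > 0"
  defines "k \<equiv> fst H" and "p \<equiv> card (snd H)"
  shows "integrable (random_weights \<mu> n) (\<lambda>w. hom_sum {1..k} {1..n} (graph_edges H) (edge_weight n w) * tilt n \<theta> w)"
    and "(real n ^ k - (real k)\<^sup>2 * real n ^ (k - 1)) * K1 \<theta> ^ p \<le>
      (LINT w|random_weights \<mu> n. hom_sum {1..k} {1..n} (graph_edges H) (edge_weight n w) * tilt n \<theta> w)"
proof -
  let ?W = "random_weights \<mu> n" and ?\<Phi> = "{1..k} \<rightarrow>\<^sub>E {1..n}" and ?E = "graph_edges H"
  define F where "F \<phi> w = (\<Prod>e\<in>?E. edge_weight n w (\<phi> (fst e)) (\<phi> (snd e)))" for \<phi> w
  have tilt_int: "integrable ?W (tilt n \<theta>)" using tilt_moment(1)[of "{}" n \<theta>] by simp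
  have F_bounds: "AE w in ?W. 0 \<le> F \<phi> w \<and> F \<phi> w \<le> 1" for \<phi>
    using AE_random_weights
  proof eventually_elim
    case (elim w)
    then show ?case
      unfolding F_def using edge_weight_bounds by (intro conjI prod_nonneg prod_le_1) blast+
  qed
  have int: "integrable ?W (\<lambda>w. F \<phi> w * tilt n \<theta> w)" for \<phi>
  proof (rule Bochner_Integration.integrable_bound[OF tilt_int])
    have "F \<phi> \<in> borel_measurable ?W" unfolding F_def[abs_def] by (intro borel_measurable_prod measurable_edge_weight)
    then show "(\<lambda>w. F \<phi> w * tilt n \<theta> w) \<in> borel_measurable ?W"
      using tilt_int by (intro borel_measurable_times) auto
    show "AE w in ?W. norm (F \<phi> w * tilt n \<theta> w) \<le> norm (tilt n \<theta> w)"
      using F_bounds[of \<phi>]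
    proof eventually_elim
      case (elim w)
      then show ?case using tilt_nonneg[of n \<theta> w] by (simp add: abs_mult mult_left_le_one_le)
    qed
  qed
  have eq: "hom_sum {1..k} {1..n} ?E (edge_weight n w) * tilt n \<theta> w = (\<Sum>\<phi>\<in>?\<Phi>. F \<phi> w * tilt n \<theta> w)" for w
    by (simp add: hom_sum_def F_def sum_distrib_right)
  show "integrable ?W (\<lambda>w. hom_sum {1..k} {1..n} ?E (edge_weight n w) * tilt n \<theta> w)"
    unfolding eq by (intro Bochner_Integration.integrable_sum int)
  have "(real n ^ k - (real k)\<^sup>2 * real n ^ (k - 1)) * K1 \<theta> ^ p \<le>
      real (card {\<phi> \<in> ?\<Phi>. inj_on \<phi> {1..k}}) * K1 \<theta> ^ p"
    using card_injective_maps[of n k] K1_pos[of \<theta>] by (intro mult_right_mono) auto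
  also have "\<dots> = (\<Sum>\<phi>\<in>{\<phi> \<in> ?\<Phi>. inj_on \<phi> {1..k}}. LINT w|?W. F \<phi> w * tilt n \<theta> w)"
    using injective_map_moment[OF H, of _ n \<theta>] by (simp add: F_def k_def p_def)
  also have "\<dots> \<le> (\<Sum>\<phi>\<in>?\<Phi>. LINT w|?W. F \<phi> w * tilt n \<theta> w)"
  proof (rule sum_mono2)
    show "0 \<le> (LINT w|?W. F \<phi> w * tilt n \<theta> w)" for \<phi>
      using F_bounds[of \<phi>] by (intro integral_nonneg_AE) (auto elim!: eventually_mono simp: tilt_nonneg)
  qed (auto simp: finite_PiE)
  also have "\<dots> = (LINT w|?W. hom_sum {1..k} {1..n} ?E (edge_weight n w) * tilt n \<theta> w)"
    unfolding eq by (simp add: Bochner_Integration.integral_sum int)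
  finally show "(real n ^ k - (real k)\<^sup>2 * real n ^ (k - 1)) * K1 \<theta> ^ p \<le>
      (LINT w|?W. hom_sum {1..k} {1..n} ?E (edge_weight n w) * tilt n \<theta> w)" .
qed

text \<open>Gibbs' inequality.  Jensen's inequality for the tilted measure bounds the logarithm of the
  partition function from below by the mean energy minus the relative entropy.  Jensen's inequality for the
  exponential function is used in the form \<open>exp s (1 + S - s) \<le> exp S\<close> with \<open>s\<close> the tilted mean of \<open>S\<close>.\<close>

lemma partition_lower:
  fixes b1 \<theta> :: real
  assumes H: "simple_graph H" "card (snd H) = p" "p \<ge> 1" and b2: "b2 \<ge> 0" and n: "n > 0"
  defines "c \<equiv> b1 * K1 \<theta> + b2 * (real (fst H))\<^sup>2 * K1 \<theta> ^ p - (\<theta> * K1 \<theta> - cumulant_gf \<mu> \<theta>) / 2"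
  shows "exp ((real n)\<^sup>2 * free_energy p b1 b2 \<theta> - real n * c) \<le>
    (LINT w|random_weights \<mu> n. exp (hamiltonian H n b1 b2 w))"
proof -
  let ?W = "random_weights \<mu> n" and ?P = "vertex_pairs n" and ?k = "fst H"
  let ?u = "K1 \<theta>" and ?K = "cumulant_gf \<mu> \<theta>"
  let ?hs = "\<lambda>w. hom_sum {1..?k} {1..n} (graph_edges H) (edge_weight n w)"
  let ?\<rho> = "tilt n \<theta>"
  \<comment> \<open>energy minus log-density of the tilted measure\<close>
  define S where "S w = hamiltonian H n b1 b2 w - (\<Sum>e\<in>?P. \<theta> * w e - ?K)" for w
  have \<rho>_eq: "?\<rho> w = exp (\<Sum>e\<in>?P. \<theta> * w e - ?K)" for w by (simp add: tilt_def exp_sum)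
  have \<rho>_int: "integrable ?W ?\<rho>" "(LINT w|?W. ?\<rho> w) = 1"
    using tilt_moment[of "{}" n \<theta>] by simp_all
  have w_int: "integrable ?W (\<lambda>w. w e * ?\<rho> w)" "(LINT w|?W. w e * ?\<rho> w) = ?u" if "e \<in> ?P" for e
    using tilt_moment[of "{e}" n \<theta>] that by simp_all
  note hs = hom_sum_tilt[OF H(1) n, of \<theta>]
  have S\<rho>: "S w * ?\<rho> w = b1 * (\<Sum>e\<in>?P. 2 * (w e * ?\<rho> w)) + b2 * (real n)\<^sup>2 / real n ^ ?k * (?hs w * ?\<rho> w)
      - (\<Sum>e\<in>?P. \<theta> * (w e * ?\<rho> w) - ?K * ?\<rho> w)" for w
    unfolding S_def hamiltonian_eq[OF H(1) n]
    by (simp add: algebra_simps sum_distrib_left sum_distrib_right sum_subtractf)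
  have S_int: "integrable ?W (\<lambda>w. S w * ?\<rho> w)"
    unfolding S\<rho> by (intro Bochner_Integration.integrable_diff Bochner_Integration.integrable_add integrable_mult_right
        Bochner_Integration.integrable_sum w_int \<rho>_int hs(1)) auto
  define s where "s = (LINT w|?W. S w * ?\<rho> w)"
  define hm where "hm = (LINT w|?W. ?hs w * ?\<rho> w)"
  have "s = b1 * (\<Sum>e\<in>?P. 2 * ?u) + b2 * (real n)\<^sup>2 / real n ^ ?k * hm - (\<Sum>e\<in>?P. \<theta> * ?u - ?K)"
  proof -
    have i1: "integrable ?W (\<lambda>w. b1 * (\<Sum>e\<in>?P. 2 * (w e * ?\<rho> w)))"
      and i2: "integrable ?W (\<lambda>w. b2 * (real n)\<^sup>2 / real n ^ ?k * (?hs w * ?\<rho> w))"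
      and i3: "integrable ?W (\<lambda>w. \<Sum>e\<in>?P. \<theta> * (w e * ?\<rho> w) - ?K * ?\<rho> w)"
      by (intro integrable_mult_right Bochner_Integration.integrable_sum Bochner_Integration.integrable_diff
          w_int \<rho>_int hs(1); assumption)+
    have "s = (LINT w|?W. b1 * (\<Sum>e\<in>?P. 2 * (w e * ?\<rho> w))) + (LINT w|?W. b2 * (real n)\<^sup>2 / real n ^ ?k * (?hs w * ?\<rho> w))
      - (LINT w|?W. (\<Sum>e\<in>?P. \<theta> * (w e * ?\<rho> w) - ?K * ?\<rho> w))"
      unfolding s_def S\<rho>
      by (simp only: Bochner_Integration.integral_diff[OF Bochner_Integration.integrable_add[OF i1 i2] i3]
          Bochner_Integration.integral_add[OF i1 i2])
    also have "(LINT w|?W. b1 * (\<Sum>e\<in>?P. 2 * (w e * ?\<rho> w))) = b1 * (\<Sum>e\<in>?P. 2 * ?u)"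
      by (simp add: Bochner_Integration.integral_sum w_int)
    also have "(LINT w|?W. b2 * (real n)\<^sup>2 / real n ^ ?k * (?hs w * ?\<rho> w)) = b2 * (real n)\<^sup>2 / real n ^ ?k * hm"
      unfolding hm_def by (rule integral_mult_right_zero)
    also have "(LINT w|?W. (\<Sum>e\<in>?P. \<theta> * (w e * ?\<rho> w) - ?K * ?\<rho> w)) = (\<Sum>e\<in>?P. \<theta> * ?u - ?K)"
      by (subst Bochner_Integration.integral_sum) (simp_all add: w_int \<rho>_int)
    finally show ?thesis .
  qed
  also have "\<dots> = (2 * real (card ?P)) * (b1 * ?u - (\<theta> * ?u - ?K) / 2) + b2 * (real n)\<^sup>2 / real n ^ ?k * hm"
    by (simp add: field_simps)
  finally have s_eq: "s = real n * (real n - 1) * (b1 * ?u - (\<theta> * ?u - ?K) / 2) + b2 * (real n)\<^sup>2 / real n ^ ?k * hm"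
    unfolding card_vertex_pairs .
  have k: "?k \<ge> 1"
  proof -
    have "snd H \<noteq> {}" using H by auto
    then have "graph_edges H \<noteq> {}" using card_graph_edges[OF H(1)] H by auto
    then obtain e where "e \<in> graph_edges H" by blast
    from graph_edges_vertices[OF H(1) this] show ?thesis by auto
  qed
  have "b2 * ((real n)\<^sup>2 - (real ?k)\<^sup>2 * real n) * ?u ^ p \<le> b2 * (real n)\<^sup>2 / real n ^ ?k * hm"
  proof -
    have "b2 * (real n)\<^sup>2 / real n ^ ?k * ((real n ^ ?k - (real ?k)\<^sup>2 * real n ^ (?k - 1)) * ?u ^ p) \<le>
        b2 * (real n)\<^sup>2 / real n ^ ?k * hm"
      using hs(2) b2 unfolding hm_def H(2) by (intro mult_left_mono) auto
    moreover have "(real n)\<^sup>2 / real n ^ ?k * (real n ^ ?k - (real ?k)\<^sup>2 * real n ^ (?k - 1)) =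
        (real n)\<^sup>2 - (real ?k)\<^sup>2 * real n"
    proof -
      obtain j where "?k = Suc j" using k by (cases ?k) auto
      then show ?thesis using n by (simp add: field_simps power2_eq_square)
    qed
    ultimately show ?thesis by (metis mult.assoc times_divide_eq_right)
  qed
  then have "real n * (real n - 1) * (b1 * ?u - (\<theta> * ?u - ?K) / 2) + b2 * ((real n)\<^sup>2 - (real ?k)\<^sup>2 * real n) * ?u ^ p \<le> s"
    unfolding s_eq by simp
  moreover have "real n * (real n - 1) * (b1 * ?u - (\<theta> * ?u - ?K) / 2) + b2 * ((real n)\<^sup>2 - (real ?k)\<^sup>2 * real n) * ?u ^ p
      = (real n)\<^sup>2 * free_energy p b1 b2 \<theta> - real n * c"
    by (simp add: free_energy_def c_def power2_eq_square algebra_simps) (simp add: field_simps)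
  ultimately have "exp ((real n)\<^sup>2 * free_energy p b1 b2 \<theta> - real n * c) \<le> exp s" by simp
  also have "exp s = (LINT w|?W. exp s * (?\<rho> w + S w * ?\<rho> w - s * ?\<rho> w))"
    using S_int \<rho>_int by (simp add: s_def[symmetric])
  also have "\<dots> \<le> (LINT w|?W. exp (hamiltonian H n b1 b2 w))"
  proof (rule integral_mono)
    show "integrable ?W (\<lambda>w. exp s * (?\<rho> w + S w * ?\<rho> w - s * ?\<rho> w))"
      using S_int \<rho>_int by simp
    show "integrable ?W (\<lambda>w. exp (hamiltonian H n b1 b2 w))" by (rule integrable_exp_hamiltonian[OF H(1) n])
    fix w
    have "exp s * (1 + (S w - s)) \<le> exp s * exp (S w - s)" by (intro mult_left_mono exp_ge_add_one_self) simp
    then have "exp s * (1 + (S w - s)) * ?\<rho> w \<le> exp s * exp (S w - s) * ?\<rho> w"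
      by (rule mult_right_mono[OF _ tilt_nonneg])
    also have "\<dots> = exp (hamiltonian H n b1 b2 w)" unfolding \<rho>_eq exp_add[symmetric] by (simp add: S_def)
    finally show "exp s * (?\<rho> w + S w * ?\<rho> w - s * ?\<rho> w) \<le> exp (hamiltonian H n b1 b2 w)"
      by (simp add: algebra_simps)
  qed
  finally show ?thesis .
qed

lemma psi_n_eq: "psi_n \<mu> single_edge H n (b1, b2) =
    ln (LINT w|random_weights \<mu> n. exp (hamiltonian H n b1 b2 w)) / (real n)\<^sup>2"
  by (simp add: psi_n_def hamiltonian_def)

text \<open>The lower bound has an error of order \<open>1 / n\<close>.  In the upper bound the regularity error
  \<open>\<epsilon>\<close> and the mesh \<open>1 / L\<close> are fixed first, and then the number of terms is negligible as \<open>n\<close> grows.\<close>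

theorem psi_n_tendsto:
  assumes H: "simple_graph H" "card (snd H) = p" "p \<ge> 1" and b2: "b2 \<ge> 0"
    and V: "\<And>\<theta>. free_energy p b1 b2 \<theta> \<le> V" and attained: "free_energy p b1 b2 \<theta> = V"
  shows "(\<lambda>n. psi_n \<mu> single_edge H n (b1, b2)) \<longlonglongrightarrow> V"
proof (rule order_tendstoI)
  let ?Z = "\<lambda>n. LINT w|random_weights \<mu> n. exp (hamiltonian H n b1 b2 w)"
  obtain c where low: "\<And>n. n > 0 \<Longrightarrow> exp ((real n)\<^sup>2 * V - real n * c) \<le> ?Z n"
    using partition_lower[OF H b2, of _ b1 \<theta>] unfolding attained by blast
  have Z_pos: "?Z n > 0" if "n > 0" for n using low[OF that] exp_gt_zero less_le_trans by blast
  {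
    fix a assume "a < V"
    have "(\<lambda>n. V - c * (1 / real n)) \<longlonglongrightarrow> V - c * 0"
      by (intro tendsto_intros lim_1_over_n)
    then have "\<forall>\<^sub>F n in sequentially. a < V - c * (1 / real n)"
      using \<open>a < V\<close> by (intro order_tendstoD(1)[of _ "V - c * 0"]) auto
    then show "\<forall>\<^sub>F n in sequentially. a < psi_n \<mu> single_edge H n (b1, b2)"
      using eventually_gt_at_top[of 0]
    proof eventually_elim
      case (elim n)
      have "(real n)\<^sup>2 * V - real n * c \<le> ln (?Z n)"
        using low[OF elim(2)] Z_pos[OF elim(2)] by (simp add: ln_ge_iff)
      then have "((real n)\<^sup>2 * V - real n * c) / (real n)\<^sup>2 \<le> psi_n \<mu> single_edge H n (b1, b2)"
        unfolding psi_n_eq by (rule divide_right_mono) simp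
      moreover have "((real n)\<^sup>2 * V - real n * c) / (real n)\<^sup>2 = V - c * (1 / real n)"
        using elim(2) by (simp add: field_simps power2_eq_square)
      ultimately show ?case using elim(1) by linarith
    qed
  }
  {
    fix a assume "V < a"
    define d where "d = a - V"
    \<comment> \<open>a positive bound for the factor of the errors, also if \<open>b2 = 0\<close>\<close>
    define q where "q = b2 * real p + 1"
    have "d > 0" "q > 0" using \<open>V < a\<close> b2 by (auto simp: d_def q_def add_nonneg_pos)
    define \<epsilon> where "\<epsilon> = d / (4 * q)"
    have "\<epsilon> > 0" using \<open>d > 0\<close> \<open>q > 0\<close> by (simp add: \<epsilon>_def)
    obtain L :: nat where L: "L > 0" "1 / real L < \<epsilon>"
      using nat_approx_posE[OF \<open>\<epsilon> > 0\<close>] by (metis zero_less_Suc)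
    have \<delta>: "b2 * (real p * \<epsilon> + real p / real L) \<le> d / 2"
    proof -
      have "b2 * (real p * \<epsilon> + real p / real L) = b2 * real p * (\<epsilon> + 1 / real L)" by (simp add: algebra_simps)
      also have "\<dots> \<le> q * (\<epsilon> + \<epsilon>)"
        using L b2 \<open>\<epsilon> > 0\<close> by (intro mult_mono) (auto simp: q_def)
      also have "\<dots> = d / 2" using \<open>q > 0\<close> by (simp add: \<epsilon>_def)
      finally show ?thesis .
    qed
    obtain M where M: "M > 0" "\<And>(V :: nat set) h. finite V \<Longrightarrow> V \<noteq> {} \<Longrightarrow> (\<And>x. x \<in> V \<times> V \<Longrightarrow> 0 \<le> h x \<and> h x \<le> 1) \<Longrightarrow>
        \<exists>c. c ` V \<subseteq> {..<M} \<and> cut_regular V \<epsilon> c h"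
      using weak_regularity[OF \<open>\<epsilon> > 0\<close>] by metis
    define C where "C = real (M * M) * ln (real (L + 1))"
    have "(\<lambda>n. d / 2 + V + (ln (real M) - V) * (1 / real n) + C * ((1 / real n) * (1 / real n))) \<longlonglongrightarrow>
        d / 2 + V + (ln (real M) - V) * 0 + C * (0 * 0)"
      by (intro tendsto_intros lim_1_over_n)
    then have "\<forall>\<^sub>F n in sequentially. d / 2 + V + (ln (real M) - V) * (1 / real n) + C * ((1 / real n) * (1 / real n)) < a"
      using \<open>d > 0\<close> by (intro order_tendstoD(2)[of _ "d / 2 + V + (ln (real M) - V) * 0 + C * (0 * 0)"]) (auto simp: d_def field_simps)
    then show "\<forall>\<^sub>F n in sequentially. psi_n \<mu> single_edge H n (b1, b2) < a"
      using eventually_gt_at_top[of 0]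
    proof eventually_elim
      case (elim n)
      let ?X = "(real n)\<^sup>2 * (b2 * (real p * \<epsilon> + real p / real L)) + real n * (real n - 1) * V"
      have "?Z n \<le> real M ^ n * real (L + 1) ^ (M * M) * exp ?X"
      proof (rule partition_upper[OF H b2 elim(2) L(1) V])
        show "\<exists>c. c ` {1..n} \<subseteq> {..<M} \<and> cut_regular {1..n} \<epsilon> c h"
          if "\<And>x. x \<in> {1..n} \<times> {1..n} \<Longrightarrow> 0 \<le> h x \<and> h x \<le> 1" for h
          using elim(2) that by (intro M(2)) auto
      qed
      then have "ln (?Z n) \<le> ln (real M ^ n * real (L + 1) ^ (M * M) * exp ?X)"
        using Z_pos[OF elim(2)] by (intro ln_mono) auto
      also have "\<dots> = real n * ln (real M) + C + ?X"
        using M(1) by (simp add: ln_mult ln_realpow C_def)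
      also have "\<dots> \<le> real n * ln (real M) + C + ((real n)\<^sup>2 * (d / 2) + real n * (real n - 1) * V)"
        using \<delta> by (intro add_left_mono add_right_mono mult_left_mono) auto
      finally have "psi_n \<mu> single_edge H n (b1, b2) \<le>
          (real n * ln (real M) + C + ((real n)\<^sup>2 * (d / 2) + real n * (real n - 1) * V)) / (real n)\<^sup>2"
        unfolding psi_n_eq by (rule divide_right_mono) simp
      also have "\<dots> = d / 2 + V + (ln (real M) - V) * (1 / real n) + C * ((1 / real n) * (1 / real n))"
        using elim(2) by (simp add: field_simps power2_eq_square)
      finally show ?case using elim(1) by linarith
    qed
  }
qed

end

section \<open>The one-dimensional variational problem\<close>

text \<open>The properties of \<open>K\<close> and its first two derivatives on which the phase diagram depends.
  The function \<open>K1 ^ (p - 2) * K2\<close> is, up to a constant factor, the derivative of \<open>K1 ^ (p - 1)\<close>; that it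
  increases up to \<open>\<theta>\<^sub>0\<close> and decreases afterwards makes \<open>K1 ^ (p - 1)\<close> a sigmoid.\<close>

locale sigmoid_tilt =
  fixes K K1 K2 :: "real \<Rightarrow> real" and p :: nat and \<theta>\<^sub>0 :: real
  assumes K_deriv: "(K has_real_derivative K1 \<theta>) (at \<theta>)"
    and K1_deriv: "(K1 has_real_derivative K2 \<theta>) (at \<theta>)"
    and K2_cont: "isCont K2 \<theta>"
    and K2_pos: "K2 \<theta> > 0"
    and K1_pos: "K1 \<theta> > 0"
    and K1_le: "K1 \<theta> \<le> 1"
    and p_ge: "p \<ge> 2"
    and left_incr: "\<theta> < \<theta>' \<Longrightarrow> \<theta>' \<le> \<theta>\<^sub>0 \<Longrightarrow>
      K1 \<theta> ^ (p - 2) * K2 \<theta> < K1 \<theta>' ^ (p - 2) * K2 \<theta>'"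
    and right_decr: "\<theta>\<^sub>0 \<le> \<theta> \<Longrightarrow> \<theta> < \<theta>' \<Longrightarrow>
      K1 \<theta>' ^ (p - 2) * K2 \<theta>' < K1 \<theta> ^ (p - 2) * K2 \<theta>"
    and K_extends: "\<exists>Kc r. r > 0 \<and> Kc holomorphic_on ball (complex_of_real x) r \<and>
      (\<forall>t. \<bar>t - x\<bar> < r \<longrightarrow> Kc (complex_of_real t) = complex_of_real (K t))"
begin

definition q :: "real \<Rightarrow> real" where
  "q \<theta> = real p * K1 \<theta> ^ (p - 1)"

definition dq :: "real \<Rightarrow> real" where
  "dq \<theta> = real p * (real p - 1) * (K1 \<theta> ^ (p - 2) * K2 \<theta>)"

definition ell :: "real \<times> real \<Rightarrow> real \<Rightarrow> real" where
  "ell \<beta> \<theta> = fst \<beta> * K1 \<theta> + snd \<beta> * K1 \<theta> ^ p - (\<theta> * K1 \<theta> - K \<theta>) / 2"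

definition slope :: "real \<times> real \<Rightarrow> real \<Rightarrow> real" where
  "slope \<beta> \<theta> = fst \<beta> + snd \<beta> * q \<theta> - \<theta> / 2"

definition maximizer :: "real set \<Rightarrow> real \<times> real \<Rightarrow> real \<Rightarrow> bool" where
  "maximizer T \<beta> t \<longleftrightarrow> t \<in> T \<and> (\<forall>s\<in>T. ell \<beta> s \<le> ell \<beta> t)"

definition val :: "real set \<Rightarrow> real \<times> real \<Rightarrow> real" where
  "val T \<beta> = (SUP t\<in>T. ell \<beta> t)"

text \<open>How much the best value to the right of \<open>\<theta>\<^sub>0\<close> exceeds the best value to the left.\<close>

definition gap :: "real \<times> real \<Rightarrow> real" where
  "gap \<beta> = val {\<theta>\<^sub>0..} \<beta> - val {..\<theta>\<^sub>0} \<beta>"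

lemma q_deriv: "(q has_real_derivative dq \<theta>) (at \<theta>)"
proof -
  have "((\<lambda>\<theta>. real p * K1 \<theta> ^ (p - 1)) has_real_derivative
     real p * (real (p - 1) * K1 \<theta> ^ (p - 1 - 1) * K2 \<theta>)) (at \<theta>)"
    by (auto intro!: derivative_eq_intros K1_deriv)
  moreover have "real p * (real (p - 1) * K1 \<theta> ^ (p - 1 - 1) * K2 \<theta>) = dq \<theta>"
    using p_ge by (simp add: dq_def of_nat_diff numeral_2_eq_2)
  moreover have "q = (\<lambda>\<theta>. real p * K1 \<theta> ^ (p - 1))"
    by (auto simp: q_def)
  ultimately show ?thesis by simp
qed

lemma dq_pos: "dq \<theta> > 0"
  using p_ge K1_pos K2_pos by (simp add: dq_def)

lemma dq_less_left: "\<theta> < \<theta>' \<Longrightarrow> \<theta>' \<le> \<theta>\<^sub>0 \<Longrightarrow> dq \<theta> < dq \<theta>'"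
  unfolding dq_def using left_incr[of \<theta> \<theta>'] p_ge by (intro mult_strict_left_mono) auto

lemma dq_less_right: "\<theta>\<^sub>0 \<le> \<theta> \<Longrightarrow> \<theta> < \<theta>' \<Longrightarrow> dq \<theta>' < dq \<theta>"
  unfolding dq_def using right_decr[of \<theta> \<theta>'] p_ge by (intro mult_strict_left_mono) auto

lemma dq_cont: "isCont dq \<theta>"
proof -
  have "isCont K1 \<theta>" using K1_deriv DERIV_isCont by blast
  then show ?thesis unfolding dq_def[abs_def] by (intro continuous_intros K2_cont)
qed

lemma ell_deriv: "(ell \<beta> has_real_derivative K2 \<theta> * slope \<beta> \<theta>) (at \<theta>)"
proof -
  have "((\<lambda>\<theta>. fst \<beta> * K1 \<theta> + snd \<beta> * K1 \<theta> ^ p - (\<theta> * K1 \<theta> - K \<theta>) / 2) has_real_derivative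
     fst \<beta> * K2 \<theta> + snd \<beta> * (real p * K1 \<theta> ^ (p - 1) * K2 \<theta>)
      - (\<theta> * K2 \<theta> + K1 \<theta> - K1 \<theta>) / 2) (at \<theta>)"
    by (rule derivative_eq_intros K1_deriv K_deriv refl | simp)+
  moreover have "fst \<beta> * K2 \<theta> + snd \<beta> * (real p * K1 \<theta> ^ (p - 1) * K2 \<theta>)
      - (\<theta> * K2 \<theta> + K1 \<theta> - K1 \<theta>) / 2 = K2 \<theta> * slope \<beta> \<theta>"
    by (simp add: slope_def q_def algebra_simps)
  moreover have "ell \<beta> = (\<lambda>\<theta>. fst \<beta> * K1 \<theta> + snd \<beta> * K1 \<theta> ^ p - (\<theta> * K1 \<theta> - K \<theta>) / 2)"
    by (auto simp: ell_def)
  ultimately show ?thesis by simp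
qed

lemma slope_deriv: "(slope \<beta> has_real_derivative snd \<beta> * dq \<theta> - 1 / 2) (at \<theta>)"
  unfolding slope_def[abs_def] by (auto intro!: derivative_eq_intros q_deriv)

lemma K1_mono: "s < t \<Longrightarrow> K1 s < K1 t"
  by (rule DERIV_pos_imp_increasing) (use K1_deriv K2_pos in blast)+

lemma K1_pow_bounds: "0 < K1 \<theta> ^ n" "K1 \<theta> ^ n \<le> 1"
  using K1_pos[of \<theta>] K1_le[of \<theta>] by (auto intro: power_le_one)

lemma q_bounds: "0 < q \<theta>" "q \<theta> \<le> p"
  using K1_pow_bounds[of \<theta> "p - 1"] p_ge by (auto simp: q_def mult_le_cancel_left2)

lemma ell_cont: "continuous_on A (ell \<beta>)"
  using ell_deriv DERIV_isCont by (meson continuous_at_imp_continuous_on)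

text \<open>The domains of maximization: the whole line, and the two rays that compete with each other.\<close>

definition line_or_ray :: "real set \<Rightarrow> bool" where
  "line_or_ray T \<longleftrightarrow> T \<in> {UNIV, {\<theta>\<^sub>0..}, {..\<theta>\<^sub>0}}"

text \<open>Outside of this radius \<open>slope\<close> has the sign of \<open>- \<theta> / 2\<close>, since \<open>q\<close> takes values between \<open>0\<close>
  and \<open>p\<close>.\<close>

definition radius :: "real \<times> real \<Rightarrow> real" where
  "radius \<beta> = 2 * (\<bar>fst \<beta>\<bar> + \<bar>snd \<beta>\<bar> * real p) + \<bar>\<theta>\<^sub>0\<bar> + 1"

lemma radius_bounds: "\<bar>\<theta>\<^sub>0\<bar> < radius \<beta>" "0 < radius \<beta>"
proof -
  have "0 \<le> 2 * (\<bar>fst \<beta>\<bar> + \<bar>snd \<beta>\<bar> * real p)" by simp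
  then show *: "\<bar>\<theta>\<^sub>0\<bar> < radius \<beta>" unfolding radius_def by linarith
  then show "0 < radius \<beta>" by linarith
qed

lemma slope_far:
  assumes "radius \<beta> \<le> \<bar>t\<bar>"
  shows "t > 0 \<Longrightarrow> slope \<beta> t < 0" "t < 0 \<Longrightarrow> slope \<beta> t > 0"
proof -
  have "\<bar>snd \<beta> * q t\<bar> \<le> \<bar>snd \<beta>\<bar> * real p"
    using q_bounds[of t] by (simp add: abs_mult mult_left_mono)
  then show "t > 0 \<Longrightarrow> slope \<beta> t < 0" "t < 0 \<Longrightarrow> slope \<beta> t > 0"
    using assms unfolding slope_def radius_def by (auto simp: abs_le_iff)
qed

lemma ell_far:
  assumes "line_or_ray T" "t \<in> T" "radius \<beta> < \<bar>t\<bar>"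
  obtains s where "s \<in> T" "\<bar>s\<bar> \<le> radius \<beta>" "ell \<beta> t < ell \<beta> s"
proof -
  have R: "\<theta>\<^sub>0 \<le> radius \<beta>" "- radius \<beta> \<le> \<theta>\<^sub>0" "0 < radius \<beta>"
    using radius_bounds[of \<beta>] by (auto simp: abs_less_iff)
  show ?thesis
  proof (cases "t > 0")
    case True
    have "ell \<beta> t < ell \<beta> (radius \<beta>)"
    proof (rule DERIV_neg_imp_decreasing[of "radius \<beta>" t "ell \<beta>"])
      show "radius \<beta> < t" using assms True by simp
    next
      fix x assume "radius \<beta> \<le> x" "x \<le> t"
      then have "slope \<beta> x < 0" using R(3) by (intro slope_far(1)) linarith+
      then have "K2 x * slope \<beta> x < 0" using K2_pos[of x] by (simp add: mult_pos_neg)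
      then show "\<exists>y. (ell \<beta> has_real_derivative y) (at x) \<and> y < 0"
        using ell_deriv by blast
    qed
    moreover have "radius \<beta> \<in> T" using assms(1,2,3) True R(1) by (auto simp: line_or_ray_def)
    ultimately show ?thesis using that[of "radius \<beta>"] R by simp
  next
    case False
    have "ell \<beta> t < ell \<beta> (- radius \<beta>)"
    proof (rule DERIV_pos_imp_increasing[of t "- radius \<beta>" "ell \<beta>"])
      show "t < - radius \<beta>" using assms False by simp
    next
      fix x assume "t \<le> x" "x \<le> - radius \<beta>"
      then have "slope \<beta> x > 0" using R(3) by (intro slope_far(2)) linarith+
      then have "K2 x * slope \<beta> x > 0" using K2_pos[of x] by simp
      then show "\<exists>y. (ell \<beta> has_real_derivative y) (at x) \<and> y > 0"
        using ell_deriv by blast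
    qed
    moreover have "- radius \<beta> \<in> T" using assms(1,2,3) False R(2) by (auto simp: line_or_ray_def)
    ultimately show ?thesis using that[of "- radius \<beta>"] R by simp
  qed
qed

lemma maximizer_bound:
  assumes "line_or_ray T" "maximizer T \<beta> t"
  shows "\<bar>t\<bar> \<le> radius \<beta>"
proof (rule ccontr)
  assume "\<not> ?thesis"
  then obtain s where "s \<in> T" "ell \<beta> t < ell \<beta> s"
    using ell_far[OF assms(1), of t \<beta>] assms(2) by (auto simp: maximizer_def)
  moreover from this have "ell \<beta> s \<le> ell \<beta> t" using assms(2) by (simp add: maximizer_def)
  ultimately show False by simp
qed

lemma maximizer_exists:
  assumes "line_or_ray T"
  shows "\<exists>t. maximizer T \<beta> t"
proof -
  let ?C = "T \<inter> {- radius \<beta>..radius \<beta>}"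
  have "closed T" using assms by (auto simp: line_or_ray_def)
  then have "compact ?C" by (simp add: closed_Int_compact)
  moreover have "\<theta>\<^sub>0 \<in> ?C" using assms radius_bounds(1)[of \<beta>] by (auto simp: line_or_ray_def)
  ultimately obtain t where t: "t \<in> ?C" "\<forall>s\<in>?C. ell \<beta> s \<le> ell \<beta> t"
    using continuous_attains_sup[of ?C "ell \<beta>"] ell_cont by blast
  have "ell \<beta> s \<le> ell \<beta> t" if "s \<in> T" for s
  proof (cases "s \<in> ?C")
    case False
    then have "radius \<beta> < \<bar>s\<bar>" using that by auto
    from ell_far[OF assms that this] obtain s' where "s' \<in> T" "\<bar>s'\<bar> \<le> radius \<beta>" "ell \<beta> s < ell \<beta> s'" .
    moreover from this have "s' \<in> ?C" by auto
    with t have "ell \<beta> s' \<le> ell \<beta> t" by blast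
    ultimately show ?thesis by linarith
  qed (use t in auto)
  then show ?thesis using t unfolding maximizer_def by blast
qed

lemma val_eq: "maximizer T \<beta> t \<Longrightarrow> val T \<beta> = ell \<beta> t"
  unfolding val_def maximizer_def by (intro cSup_eq_maximum) auto

lemma ell_le_val: "line_or_ray T \<Longrightarrow> t \<in> T \<Longrightarrow> ell \<beta> t \<le> val T \<beta>"
  by (metis maximizer_exists maximizer_def val_eq)

lemma maximizerI: "line_or_ray T \<Longrightarrow> t \<in> T \<Longrightarrow> ell \<beta> t = val T \<beta> \<Longrightarrow> maximizer T \<beta> t"
  using ell_le_val by (auto simp: maximizer_def)

lemma line_or_rays [simp]: "line_or_ray UNIV" "line_or_ray {\<theta>\<^sub>0..}" "line_or_ray {..\<theta>\<^sub>0}"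
  by (auto simp: line_or_ray_def)

lemma ell_diff: "ell \<beta>' t - ell \<beta> t = (fst \<beta>' - fst \<beta>) * K1 t + (snd \<beta>' - snd \<beta>) * K1 t ^ p"
  by (simp add: ell_def algebra_simps)

text \<open>The coefficients \<open>K1 t\<close> and \<open>K1 t ^ p\<close> of the parameters lie in \<open>[0, 1]\<close>.\<close>

lemma ell_Lipschitz: "\<bar>ell \<beta>' t - ell \<beta> t\<bar> \<le> 2 * dist \<beta>' \<beta>"
proof -
  have "\<bar>(fst \<beta>' - fst \<beta>) * K1 t\<bar> \<le> dist \<beta>' \<beta>"
    using K1_pos[of t] K1_le[of t] dist_fst_le[of \<beta>' \<beta>]
      mult_mono[of "\<bar>fst \<beta>' - fst \<beta>\<bar>" "dist \<beta>' \<beta>" "K1 t" 1] by (simp add: dist_real_def abs_mult)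
  moreover have "\<bar>(snd \<beta>' - snd \<beta>) * K1 t ^ p\<bar> \<le> dist \<beta>' \<beta>"
    using K1_pow_bounds[of t p] dist_snd_le[of \<beta>' \<beta>]
      mult_mono[of "\<bar>snd \<beta>' - snd \<beta>\<bar>" "dist \<beta>' \<beta>" "K1 t ^ p" 1] by (simp add: dist_real_def abs_mult)
  ultimately show ?thesis unfolding ell_diff by linarith
qed

lemma val_Lipschitz:
  assumes "line_or_ray T"
  shows "\<bar>val T \<beta>' - val T \<beta>\<bar> \<le> 2 * dist \<beta>' \<beta>"
proof -
  have "val T \<beta>' - val T \<beta> \<le> 2 * dist \<beta>' \<beta>" for \<beta> \<beta>'
  proof -
    obtain t where t: "maximizer T \<beta>' t" using maximizer_exists[OF assms] by blast
    then have "val T \<beta>' - val T \<beta> \<le> ell \<beta>' t - ell \<beta> t"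
      using val_eq[OF t] ell_le_val[OF assms, of t \<beta>] by (auto simp: maximizer_def)
    then show ?thesis using ell_Lipschitz[of \<beta>' t \<beta>] by linarith
  qed
  from this[of \<beta>' \<beta>] this[of \<beta> \<beta>'] show ?thesis by (auto simp: dist_commute abs_le_iff)
qed

lemma isCont_val:
  assumes "line_or_ray T"
  shows "isCont (val T) \<beta>"
  unfolding continuous_at_eps_delta dist_real_def
proof (intro allI impI)
  fix e :: real assume "e > 0"
  then show "\<exists>d>0. \<forall>\<beta>'. dist \<beta>' \<beta> < d \<longrightarrow> \<bar>val T \<beta>' - val T \<beta>\<bar> < e"
  proof (intro exI[of _ "e / 2"] conjI allI impI)
    fix \<beta>' assume "dist \<beta>' \<beta> < e / 2"
    then show "\<bar>val T \<beta>' - val T \<beta>\<bar> < e" using val_Lipschitz[OF assms, of \<beta>' \<beta>] by linarith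
  qed (use \<open>e > 0\<close> in simp)
qed

lemma isCont_gap: "isCont gap \<beta>"
  unfolding gap_def[abs_def] by (intro continuous_intros isCont_val) auto

text \<open>Maximizers lie in a compact set.  On the part of it outside of a neighbourhood of the unique
  maximizer, \<open>ell\<close> stays below the maximum by a margin that survives a small change of the parameters.\<close>

lemma maximizer_stable:
  assumes T: "line_or_ray T" and \<tau>: "maximizer T \<beta> \<tau>"
    and uniq: "\<And>t. maximizer T \<beta> t \<Longrightarrow> t = \<tau>" and "e > 0"
  shows "\<exists>d>0. \<forall>\<beta>' t. dist \<beta>' \<beta> < d \<longrightarrow> maximizer T \<beta>' t \<longrightarrow> \<bar>t - \<tau>\<bar> < e"
proof -
  \<comment> \<open>bounds the radius for all parameters within distance 1\<close>
  define R where "R = radius \<beta> + 2 + 2 * real p"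
  let ?C = "T \<inter> {- R..R} \<inter> {t. e \<le> \<bar>t - \<tau>\<bar>}"
  have radius: "radius \<beta>' \<le> R" if "dist \<beta>' \<beta> < 1" for \<beta>'
  proof -
    have "\<bar>fst \<beta>'\<bar> \<le> \<bar>fst \<beta>\<bar> + 1" "\<bar>snd \<beta>'\<bar> \<le> \<bar>snd \<beta>\<bar> + 1"
      using dist_fst_le[of \<beta>' \<beta>] dist_snd_le[of \<beta>' \<beta>] that by (auto simp: dist_real_def)
    moreover from this have "\<bar>snd \<beta>'\<bar> * real p \<le> (\<bar>snd \<beta>\<bar> + 1) * real p"
      by (intro mult_right_mono) auto
    ultimately show ?thesis by (simp add: radius_def R_def algebra_simps)
  qed
  have "closed T" using T by (auto simp: line_or_ray_def)
  moreover have "closed {t. e \<le> \<bar>t - \<tau>\<bar>}"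
    by (intro closed_Collect_le continuous_intros)
  ultimately have "compact ?C"
    by (simp add: closed_Int_compact compact_Int_closed)
  have "\<exists>\<gamma>>0. \<forall>t\<in>?C. ell \<beta> t \<le> val T \<beta> - \<gamma>"
  proof (cases "?C = {}")
    case True then show ?thesis by (intro exI[of _ 1]) auto
  next
    case False
    then obtain t where t: "t \<in> ?C" "\<forall>s\<in>?C. ell \<beta> s \<le> ell \<beta> t"
      using continuous_attains_sup[OF \<open>compact ?C\<close>, of "ell \<beta>"] ell_cont by blast
    have "ell \<beta> t \<noteq> val T \<beta>"
      using uniq[OF maximizerI[OF T]] t \<open>e > 0\<close> by auto
    then have "ell \<beta> t < val T \<beta>" using ell_le_val[OF T, of t \<beta>] t by auto
    then show ?thesis using t by (intro exI[of _ "val T \<beta> - ell \<beta> t"]) auto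
  qed
  then obtain \<gamma> where \<gamma>: "\<gamma> > 0" "\<And>t. t \<in> ?C \<Longrightarrow> ell \<beta> t \<le> val T \<beta> - \<gamma>" by blast
  show ?thesis
  proof (intro exI[of _ "min 1 (\<gamma> / 4)"] conjI allI impI)
    fix \<beta>' t assume d: "dist \<beta>' \<beta> < min 1 (\<gamma> / 4)" and m: "maximizer T \<beta>' t"
    show "\<bar>t - \<tau>\<bar> < e"
    proof (rule ccontr)
      assume "\<not> ?thesis"
      then have "t \<in> ?C"
        using maximizer_bound[OF T m] radius[of \<beta>'] d m by (auto simp: maximizer_def)
      then have "ell \<beta> t \<le> val T \<beta> - \<gamma>" by (rule \<gamma>)
      moreover have "ell \<beta>' t = val T \<beta>'" using val_eq[OF m] by simp
      ultimately show False
        using ell_Lipschitz[of \<beta>' t \<beta>] val_Lipschitz[OF T, of \<beta>' \<beta>] d by auto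
    qed
  qed (use \<gamma> in auto)
qed

text \<open>On this ray \<open>slope\<close> is concave.  If its derivative at a maximizer \<open>t\<close> were nonnegative, then
  it would be nonnegative between \<open>\<theta>\<^sub>0\<close> and \<open>t\<close>, so that \<open>slope \<le> 0\<close> there and \<open>\<theta>\<^sub>0\<close> would be at least as
  good as \<open>t\<close>.  Hence \<open>slope\<close> crosses zero downwards at \<open>t\<close>, keeps decreasing, and has no further zero.\<close>

lemma right_maximizer:
  assumes \<beta>: "snd \<beta> \<ge> 0" and t: "maximizer {\<theta>\<^sub>0..} \<beta> t" and less: "ell \<beta> \<theta>\<^sub>0 < ell \<beta> t"
  shows "\<theta>\<^sub>0 < t" "slope \<beta> t = 0" "snd \<beta> * dq t < 1 / 2"
    "maximizer {\<theta>\<^sub>0..} \<beta> s \<Longrightarrow> s = t"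
proof -
  have gt: "\<theta>\<^sub>0 < s" "slope \<beta> s = 0" "snd \<beta> * dq s < 1 / 2"
    if s: "maximizer {\<theta>\<^sub>0..} \<beta> s" and less: "ell \<beta> \<theta>\<^sub>0 < ell \<beta> s" for s
  proof -
    show gt: "\<theta>\<^sub>0 < s" using s less by (cases "s = \<theta>\<^sub>0") (auto simp: maximizer_def)
    have "K2 s * slope \<beta> s = 0"
    proof (rule DERIV_local_max[OF ell_deriv])
      show "0 < s - \<theta>\<^sub>0" using gt by simp
      show "\<forall>y. \<bar>s - y\<bar> < s - \<theta>\<^sub>0 \<longrightarrow> ell \<beta> y \<le> ell \<beta> s"
        using s by (auto simp: maximizer_def)
    qed
    then show slope: "slope \<beta> s = 0" using K2_pos[of s] by simp
    show "snd \<beta> * dq s < 1 / 2"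
    proof (rule ccontr)
      assume "\<not> ?thesis"
      then have *: "1 / 2 \<le> snd \<beta> * dq s" by simp
      have mono: "0 \<le> snd \<beta> * dq x - 1 / 2" if "\<theta>\<^sub>0 \<le> x" "x \<le> s" for x
      proof -
        have "dq s \<le> dq x" using dq_less_right[of x s] that by (cases "x = s") auto
        then have "snd \<beta> * dq s \<le> snd \<beta> * dq x" using \<beta> by (rule mult_left_mono)
        then show ?thesis using * by simp
      qed
      have "slope \<beta> x \<le> 0" if "\<theta>\<^sub>0 \<le> x" "x \<le> s" for x
      proof -
        have "slope \<beta> x \<le> slope \<beta> s"
          using that mono by (intro DERIV_nonneg_imp_nondecreasing[of x s "slope \<beta>"])
            (auto intro!: exI slope_deriv)
        then show ?thesis using slope by simp
      qed
      then have "ell \<beta> \<theta>\<^sub>0 \<ge> ell \<beta> s"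
        using gt K2_pos by (intro DERIV_nonpos_imp_nonincreasing[of \<theta>\<^sub>0 s "ell \<beta>"])
            (auto intro!: exI ell_deriv mult_nonneg_nonpos simp: less_imp_le)
      then show False using less by simp
    qed
  qed
  show "\<theta>\<^sub>0 < t" "slope \<beta> t = 0" "snd \<beta> * dq t < 1 / 2"
    using gt t less by auto
  have no_larger: False if "maximizer {\<theta>\<^sub>0..} \<beta> s" "maximizer {\<theta>\<^sub>0..} \<beta> s'" "s < s'" for s s'
  proof -
    have eq: "ell \<beta> s = ell \<beta> t" "ell \<beta> s' = ell \<beta> t" using t that val_eq by metis+
    note 1 = gt[OF that(1)] and 2 = gt[OF that(2)]
    have "slope \<beta> s' < slope \<beta> s"
    proof (rule DERIV_neg_imp_decreasing[OF that(3)])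
      fix x assume "s \<le> x" "x \<le> s'"
      then have "dq x \<le> dq s" using dq_less_right[of s x] 1 eq less by (cases "x = s") auto
      then have "snd \<beta> * dq x \<le> snd \<beta> * dq s" using \<beta> by (rule mult_left_mono)
      then have "snd \<beta> * dq x - 1 / 2 < 0" using 1 eq less by simp
      then show "\<exists>y. (slope \<beta> has_real_derivative y) (at x) \<and> y < 0"
        using slope_deriv by blast
    qed
    then show False using 1 2 eq less by simp
  qed
  show "maximizer {\<theta>\<^sub>0..} \<beta> s \<Longrightarrow> s = t"
    using no_larger[of s t] no_larger[of t s] t by (cases s t rule: linorder_cases) auto
qed

text \<open>The mirror image of the preceding lemma: on this ray \<open>slope\<close> is convex.\<close>

lemma left_maximizer:
  assumes \<beta>: "snd \<beta> \<ge> 0" and t: "maximizer {..\<theta>\<^sub>0} \<beta> t" and less: "ell \<beta> \<theta>\<^sub>0 < ell \<beta> t"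
  shows "t < \<theta>\<^sub>0" "slope \<beta> t = 0" "snd \<beta> * dq t < 1 / 2"
    "maximizer {..\<theta>\<^sub>0} \<beta> s \<Longrightarrow> s = t"
proof -
  have lt: "s < \<theta>\<^sub>0" "slope \<beta> s = 0" "snd \<beta> * dq s < 1 / 2"
    if s: "maximizer {..\<theta>\<^sub>0} \<beta> s" and less: "ell \<beta> \<theta>\<^sub>0 < ell \<beta> s" for s
  proof -
    show lt: "s < \<theta>\<^sub>0" using s less by (cases "s = \<theta>\<^sub>0") (auto simp: maximizer_def)
    have "K2 s * slope \<beta> s = 0"
    proof (rule DERIV_local_max[OF ell_deriv])
      show "0 < \<theta>\<^sub>0 - s" using lt by simp
      show "\<forall>y. \<bar>s - y\<bar> < \<theta>\<^sub>0 - s \<longrightarrow> ell \<beta> y \<le> ell \<beta> s"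
        using s by (auto simp: maximizer_def)
    qed
    then show slope: "slope \<beta> s = 0" using K2_pos[of s] by simp
    show "snd \<beta> * dq s < 1 / 2"
    proof (rule ccontr)
      assume "\<not> ?thesis"
      then have *: "1 / 2 \<le> snd \<beta> * dq s" by simp
      have mono: "0 \<le> snd \<beta> * dq x - 1 / 2" if "s \<le> x" "x \<le> \<theta>\<^sub>0" for x
      proof -
        have "dq s \<le> dq x" using dq_less_left[of s x] that by (cases "x = s") auto
        then have "snd \<beta> * dq s \<le> snd \<beta> * dq x" using \<beta> by (rule mult_left_mono)
        then show ?thesis using * by simp
      qed
      have "slope \<beta> x \<ge> 0" if "s \<le> x" "x \<le> \<theta>\<^sub>0" for x
      proof -
        have "slope \<beta> s \<le> slope \<beta> x"
          using that mono by (intro DERIV_nonneg_imp_nondecreasing[of s x "slope \<beta>"])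
            (auto intro!: exI slope_deriv)
        then show ?thesis using slope by simp
      qed
      then have "ell \<beta> s \<le> ell \<beta> \<theta>\<^sub>0"
        using lt K2_pos by (intro DERIV_nonneg_imp_nondecreasing[of s \<theta>\<^sub>0 "ell \<beta>"])
            (auto intro!: exI ell_deriv mult_nonneg_nonneg simp: less_imp_le)
      then show False using less by simp
    qed
  qed
  show "t < \<theta>\<^sub>0" "slope \<beta> t = 0" "snd \<beta> * dq t < 1 / 2"
    using lt t less by auto
  have no_larger: False if "maximizer {..\<theta>\<^sub>0} \<beta> s" "maximizer {..\<theta>\<^sub>0} \<beta> s'" "s < s'" for s s'
  proof -
    have eq: "ell \<beta> s = ell \<beta> t" "ell \<beta> s' = ell \<beta> t" using t that val_eq by metis+
    note 1 = lt[OF that(1)] and 2 = lt[OF that(2)]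
    have "slope \<beta> s' < slope \<beta> s"
    proof (rule DERIV_neg_imp_decreasing[OF that(3)])
      fix x assume "s \<le> x" "x \<le> s'"
      then have "dq x \<le> dq s'" using dq_less_left[of x s'] 2 eq less by (cases "x = s'") auto
      then have "snd \<beta> * dq x \<le> snd \<beta> * dq s'" using \<beta> by (rule mult_left_mono)
      then have "snd \<beta> * dq x - 1 / 2 < 0" using 2 eq less by simp
      then show "\<exists>y. (slope \<beta> has_real_derivative y) (at x) \<and> y < 0"
        using slope_deriv by blast
    qed
    then show False using 1 2 eq less by simp
  qed
  show "maximizer {..\<theta>\<^sub>0} \<beta> s \<Longrightarrow> s = t"
    using no_larger[of s t] no_larger[of t s] t by (cases s t rule: linorder_cases) auto
qed

lemma maximizer_UNIV_cases:
  assumes "maximizer UNIV \<beta> t"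
  shows "t \<ge> \<theta>\<^sub>0 \<and> maximizer {\<theta>\<^sub>0..} \<beta> t \<and> gap \<beta> \<ge> 0 \<or> t \<le> \<theta>\<^sub>0 \<and> maximizer {..\<theta>\<^sub>0} \<beta> t \<and> gap \<beta> \<le> 0"
proof -
  obtain l r where lr: "maximizer {..\<theta>\<^sub>0} \<beta> l" "maximizer {\<theta>\<^sub>0..} \<beta> r"
    using maximizer_exists line_or_rays by meson
  then have "gap \<beta> = ell \<beta> r - ell \<beta> l" by (simp add: gap_def val_eq)
  then show ?thesis
    using assms lr by (cases "t \<ge> \<theta>\<^sub>0") (auto simp: maximizer_def intro: order_trans)
qed

lemma gap_zero_maximizer:
  assumes "gap \<beta> = 0" "maximizer {..\<theta>\<^sub>0} \<beta> t \<or> maximizer {\<theta>\<^sub>0..} \<beta> t"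
  shows "maximizer UNIV \<beta> t"
proof -
  obtain l r where lr: "maximizer {..\<theta>\<^sub>0} \<beta> l" "maximizer {\<theta>\<^sub>0..} \<beta> r"
    using maximizer_exists line_or_rays by meson
  then have eq: "ell \<beta> r = ell \<beta> l" using assms by (simp add: gap_def val_eq)
  have "ell \<beta> s \<le> ell \<beta> r" for s
    using lr eq by (cases "s \<ge> \<theta>\<^sub>0") (auto simp: maximizer_def)
  moreover have "ell \<beta> t = ell \<beta> r" using assms(2) lr eq val_eq by metis
  ultimately show ?thesis by (simp add: maximizer_def)
qed

text \<open>Increasing a parameter raises \<open>ell\<close> the more, the larger \<open>\<theta>\<close> is.  So the right maximum gains at
  least as much as \<open>\<theta>\<^sub>0\<close> does, and the left maximum at most as much.  One of these comparisons is strict,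
  unless \<open>\<theta>\<^sub>0\<close> is both a right maximizer before and a left maximizer after the change; then
  \<open>slope\<close> at \<open>\<theta>\<^sub>0\<close> increases, hence it is negative before, and \<open>\<theta>\<^sub>0\<close> is no left maximizer before, or it
  is positive after, and \<open>\<theta>\<^sub>0\<close> is no right maximizer after.\<close>

lemma gap_strict_mono:
  assumes "fst \<beta> \<le> fst \<beta>'" "snd \<beta> \<le> snd \<beta>'" "\<beta> \<noteq> \<beta>'"
  shows "gap \<beta> < gap \<beta>'"
proof -
  obtain r l r' l' where m: "maximizer {\<theta>\<^sub>0..} \<beta> r" "maximizer {..\<theta>\<^sub>0} \<beta> l"
      "maximizer {\<theta>\<^sub>0..} \<beta>' r'" "maximizer {..\<theta>\<^sub>0} \<beta>' l'"
    using maximizer_exists line_or_rays by meson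
  define \<delta> where "\<delta> t = ell \<beta>' t - ell \<beta> t" for t
  have delta_mono: "\<delta> s \<le> \<delta> t" if "s \<le> t" for s t
  proof -
    have "K1 s \<le> K1 t" using K1_mono[of s t] that by (cases "s = t") auto
    then show ?thesis unfolding \<delta>_def ell_diff
      using assms K1_pos[of s] by (intro add_mono mult_left_mono power_mono) auto
  qed
  have delta_less: "\<delta> s < \<delta> t" if "s < t" for s t
  proof -
    have "K1 s < K1 t" using K1_mono[of s t] that by auto
    moreover from this have "K1 s ^ p < K1 t ^ p"
      using K1_pos[of s] p_ge by (intro power_strict_mono) auto
    moreover have "fst \<beta> < fst \<beta>' \<or> snd \<beta> < snd \<beta>'" using assms by (auto simp: prod_eq_iff)
    ultimately show ?thesis unfolding \<delta>_def ell_diff using assms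
      by (elim disjE) (intro add_less_le_mono add_le_less_mono mult_left_mono mult_strict_left_mono; simp)+
  qed
  have gap: "gap \<beta> = ell \<beta> r - ell \<beta> l" "gap \<beta>' = ell \<beta>' r' - ell \<beta>' l'"
    using m by (simp_all add: gap_def val_eq)
  have 1: "ell \<beta> r + \<delta> r \<le> ell \<beta>' r'" "ell \<beta>' l' \<le> ell \<beta> l + \<delta> l'"
    using m by (auto simp: \<delta>_def maximizer_def)
  have 2: "\<delta> l' \<le> \<delta> \<theta>\<^sub>0" "\<delta> \<theta>\<^sub>0 \<le> \<delta> r"
    using m by (auto simp: maximizer_def intro: delta_mono)
  show ?thesis
  proof (cases "r = \<theta>\<^sub>0 \<and> l' = \<theta>\<^sub>0")
    case False
    then have "\<delta> l' < \<delta> \<theta>\<^sub>0 \<or> \<delta> \<theta>\<^sub>0 < \<delta> r"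
      using m by (auto simp: maximizer_def intro!: delta_less)
    then show ?thesis unfolding gap using 1 2 by linarith
  next
    case True
    have "fst \<beta> < fst \<beta>' \<or> snd \<beta> < snd \<beta>'" using assms by (auto simp: prod_eq_iff)
    then have "fst \<beta> + snd \<beta> * q \<theta>\<^sub>0 < fst \<beta>' + snd \<beta>' * q \<theta>\<^sub>0"
      using assms q_bounds(1)[of \<theta>\<^sub>0]
      by (elim disjE) (simp_all add: add_less_le_mono add_le_less_mono mult_right_mono)
    then have "slope \<beta> \<theta>\<^sub>0 < slope \<beta>' \<theta>\<^sub>0" by (simp add: slope_def)
    then consider "slope \<beta> \<theta>\<^sub>0 < 0" | "slope \<beta>' \<theta>\<^sub>0 > 0" by linarith
    then show ?thesis
    proof cases
      case 1
      then have "K2 \<theta>\<^sub>0 * slope \<beta> \<theta>\<^sub>0 < 0" using K2_pos[of \<theta>\<^sub>0] by (simp add: mult_pos_neg)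
      from DERIV_neg_dec_left[OF ell_deriv this]
      obtain d where d: "d > 0" "\<And>h. 0 < h \<Longrightarrow> h < d \<Longrightarrow> ell \<beta> \<theta>\<^sub>0 < ell \<beta> (\<theta>\<^sub>0 - h)" by blast
      then have "ell \<beta> \<theta>\<^sub>0 < ell \<beta> (\<theta>\<^sub>0 - d / 2)" by simp
      also have "\<dots> \<le> ell \<beta> l" using m d by (auto simp: maximizer_def)
      finally show ?thesis unfolding gap using \<open>ell \<beta> r + \<delta> r \<le> ell \<beta>' r'\<close> True by (simp add: \<delta>_def)
    next
      case 2
      then have "K2 \<theta>\<^sub>0 * slope \<beta>' \<theta>\<^sub>0 > 0" using K2_pos[of \<theta>\<^sub>0] by simp
      from DERIV_pos_inc_right[OF ell_deriv this]
      obtain d where d: "d > 0" "\<And>h. 0 < h \<Longrightarrow> h < d \<Longrightarrow> ell \<beta>' \<theta>\<^sub>0 < ell \<beta>' (\<theta>\<^sub>0 + h)" by blast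
      then have "ell \<beta>' \<theta>\<^sub>0 < ell \<beta>' (\<theta>\<^sub>0 + d / 2)" by simp
      also have "\<dots> \<le> ell \<beta>' r'" using m d by (auto simp: maximizer_def)
      finally show ?thesis unfolding gap using \<open>ell \<beta>' l' \<le> ell \<beta> l + \<delta> l'\<close> True by (simp add: \<delta>_def)
    qed
  qed
qed

text \<open>The largest \<open>\<beta>\<^sub>2\<close> for which \<open>slope\<close> is monotone, its derivative being \<open>\<beta>\<^sub>2 dq - 1 / 2\<close>.\<close>

definition critical_coupling :: real where
  "critical_coupling = 1 / (2 * dq \<theta>\<^sub>0)"

text \<open>Here \<open>slope\<close> and its derivative both vanish at \<open>\<theta>\<^sub>0\<close>.\<close>

definition critical_point :: "real \<times> real" where
  "critical_point = (\<theta>\<^sub>0 / 2 - critical_coupling * q \<theta>\<^sub>0, critical_coupling)"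

lemma dq_le_peak: "dq \<theta> \<le> dq \<theta>\<^sub>0" "\<theta> \<noteq> \<theta>\<^sub>0 \<Longrightarrow> dq \<theta> < dq \<theta>\<^sub>0"
proof -
  show *: "\<theta> \<noteq> \<theta>\<^sub>0 \<Longrightarrow> dq \<theta> < dq \<theta>\<^sub>0"
    using dq_less_left[of \<theta> \<theta>\<^sub>0] dq_less_right[of \<theta>\<^sub>0 \<theta>] by linarith
  then show "dq \<theta> \<le> dq \<theta>\<^sub>0" by (cases "\<theta> = \<theta>\<^sub>0") auto
qed

lemma critical_coupling_pos: "critical_coupling > 0"
  using dq_pos[of \<theta>\<^sub>0] by (simp add: critical_coupling_def)

lemma slope_strict_antimono:
  assumes "0 \<le> snd \<beta>" "snd \<beta> \<le> critical_coupling" "x < y"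
  shows "slope \<beta> y < slope \<beta> x"
proof -
  have neg: "snd \<beta> * dq \<theta> - 1 / 2 < 0" if "\<theta> \<noteq> \<theta>\<^sub>0" for \<theta>
  proof (cases "snd \<beta> = 0")
    case False
    then have "snd \<beta> * dq \<theta> < snd \<beta> * dq \<theta>\<^sub>0" using that dq_le_peak(2) assms by simp
    also have "\<dots> \<le> critical_coupling * dq \<theta>\<^sub>0" using assms dq_pos[of \<theta>\<^sub>0] by (intro mult_right_mono) auto
    also have "\<dots> = 1 / 2" using dq_pos[of \<theta>\<^sub>0] by (simp add: critical_coupling_def)
    finally show ?thesis by simp
  qed auto
  have cont: "continuous_on A (slope \<beta>)" for A
    using slope_deriv DERIV_isCont by (meson continuous_at_imp_continuous_on)
  have side: "slope \<beta> y < slope \<beta> x" if "x < y" "\<theta>\<^sub>0 \<notin> {x<..<y}" for x y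
  proof (rule DERIV_neg_imp_decreasing_open[OF that(1) _ cont])
    fix \<theta> assume "x < \<theta>" "\<theta> < y"
    then have "\<theta> \<noteq> \<theta>\<^sub>0" using that(2) by auto
    then show "\<exists>z. (slope \<beta> has_real_derivative z) (at \<theta>) \<and> z < 0"
      using neg slope_deriv by blast
  qed
  show ?thesis
  proof (cases "\<theta>\<^sub>0 \<in> {x<..<y}")
    case True
    then show ?thesis using side[of x \<theta>\<^sub>0] side[of \<theta>\<^sub>0 y] by auto
  qed (use side assms in auto)
qed

lemma maximizer_slope:
  assumes "maximizer UNIV \<beta> t"
  shows "slope \<beta> t = 0"
proof -
  have "K2 t * slope \<beta> t = 0"
    by (rule DERIV_local_max[OF ell_deriv zero_less_one]) (use assms in \<open>auto simp: maximizer_def\<close>)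
  then show ?thesis using K2_pos[of t] by simp
qed

lemma subcritical_maximizer:
  assumes "0 \<le> snd \<beta>" "snd \<beta> \<le> critical_coupling" "maximizer UNIV \<beta> s" "maximizer UNIV \<beta> t"
  shows "s = t"
  using slope_strict_antimono[OF assms(1,2), of s t] slope_strict_antimono[OF assms(1,2), of t s]
    maximizer_slope[OF assms(3)] maximizer_slope[OF assms(4)]
  by (cases s t rule: linorder_cases) auto

lemma subcritical_gap_zero:
  assumes "0 \<le> snd \<beta>" "snd \<beta> \<le> critical_coupling" "gap \<beta> = 0" "maximizer UNIV \<beta> t"
  shows "t = \<theta>\<^sub>0"
proof -
  obtain l r where lr: "maximizer {..\<theta>\<^sub>0} \<beta> l" "maximizer {\<theta>\<^sub>0..} \<beta> r"
    using maximizer_exists line_or_rays by meson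
  then have "maximizer UNIV \<beta> l" "maximizer UNIV \<beta> r"
    using gap_zero_maximizer[OF assms(3)] by auto
  then have "l = t" "r = t" using subcritical_maximizer assms by blast+
  then show ?thesis using lr by (auto simp: maximizer_def)
qed

lemma gap_critical_point: "gap critical_point = 0"
proof -
  obtain t where t: "maximizer UNIV critical_point t" using maximizer_exists line_or_rays by meson
  have "slope critical_point \<theta>\<^sub>0 = 0" by (simp add: slope_def critical_point_def)
  then have "t = \<theta>\<^sub>0"
    using slope_strict_antimono[of critical_point t \<theta>\<^sub>0] slope_strict_antimono[of critical_point \<theta>\<^sub>0 t]
      maximizer_slope[OF t] critical_coupling_pos
    by (cases t \<theta>\<^sub>0 rule: linorder_cases) (auto simp: critical_point_def)
  then have "maximizer {..\<theta>\<^sub>0} critical_point \<theta>\<^sub>0" "maximizer {\<theta>\<^sub>0..} critical_point \<theta>\<^sub>0"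
    using t by (auto simp: maximizer_def)
  then show ?thesis by (simp add: gap_def val_eq)
qed

text \<open>Above the critical coupling \<open>slope\<close> increases through \<open>\<theta>\<^sub>0\<close>, so that a zero of \<open>slope\<close> at \<open>\<theta>\<^sub>0\<close>
  is a strict local minimum of \<open>ell\<close>.\<close>

lemma supercritical_not_centre:
  assumes "critical_coupling < snd \<beta>"
  shows "\<not> maximizer UNIV \<beta> \<theta>\<^sub>0"
proof
  assume m: "maximizer UNIV \<beta> \<theta>\<^sub>0"
  have "snd \<beta> * dq \<theta>\<^sub>0 - 1 / 2 > 0"
    using assms dq_pos[of \<theta>\<^sub>0] by (simp add: critical_coupling_def field_simps)
  from DERIV_pos_inc_right[OF slope_deriv this]
  obtain d where d: "d > 0" "\<And>h. 0 < h \<Longrightarrow> h < d \<Longrightarrow> slope \<beta> \<theta>\<^sub>0 < slope \<beta> (\<theta>\<^sub>0 + h)" by blast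
  have "ell \<beta> \<theta>\<^sub>0 < ell \<beta> (\<theta>\<^sub>0 + d / 2)"
  proof (rule DERIV_pos_imp_increasing_open[of \<theta>\<^sub>0 "\<theta>\<^sub>0 + d / 2" "ell \<beta>"])
    fix x assume x: "\<theta>\<^sub>0 < x" "x < \<theta>\<^sub>0 + d / 2"
    then have "slope \<beta> x > 0"
      using d(2)[of "x - \<theta>\<^sub>0"] d(1) maximizer_slope[OF m] by simp
    then have "K2 x * slope \<beta> x > 0" using K2_pos[of x] by simp
    then show "\<exists>y. (ell \<beta> has_real_derivative y) (at x) \<and> 0 < y"
      using ell_deriv by blast
  qed (use d ell_cont in auto)
  moreover have "ell \<beta> (\<theta>\<^sub>0 + d / 2) \<le> ell \<beta> \<theta>\<^sub>0" using m by (simp add: maximizer_def)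
  ultimately show False by simp
qed

end

section \<open>The coexistence curve\<close>

context sigmoid_tilt
begin

lemma gap_less_snd: "y < y' \<Longrightarrow> gap (x, y) < gap (x, y')"
  by (rule gap_strict_mono) auto

lemma gap_less_fst: "x < x' \<Longrightarrow> gap (x, y) < gap (x', y)"
  by (rule gap_strict_mono) auto

lemma gap_mono: "fst \<beta> \<le> fst \<beta>' \<Longrightarrow> snd \<beta> \<le> snd \<beta>' \<Longrightarrow> gap \<beta> \<le> gap \<beta>'"
  by (cases "\<beta> = \<beta>'") (simp_all add: gap_strict_mono less_imp_le)

text \<open>The term \<open>y K1 ^ p\<close> favours the right side at a rate that is bounded below.\<close>

lemma gap_pos_for_large: "\<exists>y\<ge>Y. gap (x, y) > 0"
proof -
  define c where "c = ell (x, 0) (\<theta>\<^sub>0 + 1) - val {..\<theta>\<^sub>0} (x, 0)"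
  define d where "d = K1 (\<theta>\<^sub>0 + 1) ^ p - K1 \<theta>\<^sub>0 ^ p"
  have "d > 0"
    unfolding d_def using K1_pos[of \<theta>\<^sub>0] K1_mono[of \<theta>\<^sub>0 "\<theta>\<^sub>0 + 1"] p_ge
    by (simp add: power_strict_mono)
  have lower: "c + y * d \<le> gap (x, y)" if "y \<ge> 0" for y
  proof -
    obtain l where l: "maximizer {..\<theta>\<^sub>0} (x, y) l" using maximizer_exists line_or_rays by meson
    then have "K1 l \<le> K1 \<theta>\<^sub>0" using K1_mono[of l \<theta>\<^sub>0] by (cases "l = \<theta>\<^sub>0") (auto simp: maximizer_def)
    then have "y * K1 l ^ p \<le> y * K1 \<theta>\<^sub>0 ^ p"
      using that K1_pos[of l] by (intro mult_left_mono power_mono) auto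
    moreover have "val {..\<theta>\<^sub>0} (x, y) = ell (x, 0) l + y * K1 l ^ p"
      using val_eq[OF l] by (simp add: ell_def)
    moreover have "ell (x, 0) l \<le> val {..\<theta>\<^sub>0} (x, 0)"
      using l by (intro ell_le_val) (auto simp: maximizer_def)
    moreover have "ell (x, 0) (\<theta>\<^sub>0 + 1) + y * K1 (\<theta>\<^sub>0 + 1) ^ p \<le> val {\<theta>\<^sub>0..} (x, y)"
      using ell_le_val[of "{\<theta>\<^sub>0..}" "\<theta>\<^sub>0 + 1" "(x, y)"] by (simp add: ell_def)
    ultimately show ?thesis by (simp add: gap_def c_def d_def algebra_simps)
  qed
  define y where "y = max (max Y 0) ((\<bar>c\<bar> + 1) / d)"
  have "(\<bar>c\<bar> + 1) / d \<le> y" by (simp add: y_def)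
  then have "\<bar>c\<bar> + 1 \<le> y * d" using \<open>d > 0\<close> by (simp add: field_simps)
  moreover have "c + y * d \<le> gap (x, y)" by (rule lower) (simp add: y_def)
  ultimately have "gap (x, y) > 0" by linarith
  then show ?thesis by (intro exI[of _ y]) (auto simp: y_def)
qed

text \<open>The zero is unique because the gap is strictly increasing in \<open>y\<close>.\<close>

definition coexistence :: "real \<Rightarrow> real" where
  "coexistence x = (THE y. gap (x, y) = 0)"

lemma coexistence_eqI:
  assumes "gap (x, y) = 0"
  shows "coexistence x = y"
  unfolding coexistence_def
proof (rule the_equality)
  fix y' assume "gap (x, y') = 0"
  then show "y' = y"
    using assms gap_less_snd[of y y' x] gap_less_snd[of y' y x] by (cases y y' rule: linorder_cases) auto
qed fact

lemma critical_coupling_eq [simp]: "snd critical_point = critical_coupling"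
  by (simp add: critical_point_def)

lemma coexistence_critical: "coexistence (fst critical_point) = critical_coupling"
  using gap_critical_point by (intro coexistence_eqI) (simp flip: critical_coupling_eq)

lemma coexistence_gap:
  assumes "x \<le> fst critical_point"
  shows "gap (x, coexistence x) = 0" "critical_coupling \<le> coexistence x"
proof -
  have "gap (x, critical_coupling) \<le> 0"
    using gap_less_fst[of x "fst critical_point" critical_coupling] gap_critical_point assms
    by (cases "x = fst critical_point") (auto simp flip: critical_coupling_eq)
  moreover obtain Y where "critical_coupling \<le> Y" "gap (x, Y) > 0" using gap_pos_for_large by blast
  moreover have "continuous_on {critical_coupling..Y} (\<lambda>y. gap (x, y))"
    by (intro continuous_at_imp_continuous_on ballI isCont_o2[OF _ isCont_gap]) (intro continuous_intros)
  ultimately obtain y where "critical_coupling \<le> y" "gap (x, y) = 0"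
    using IVT'[of "\<lambda>y. gap (x, y)" critical_coupling 0 Y] by auto
  then show "gap (x, coexistence x) = 0" "critical_coupling \<le> coexistence x"
    using coexistence_eqI[of x y] by auto
qed

lemma coexistence_decreasing:
  assumes "x < y" "y \<le> fst critical_point"
  shows "coexistence y < coexistence x"
proof (rule ccontr)
  assume "\<not> ?thesis"
  then have "gap (x, coexistence x) < gap (y, coexistence y)"
    using assms by (intro gap_strict_mono) auto
  then show False using coexistence_gap assms by simp
qed

text \<open>Slightly above and below \<open>coexistence x\<close> the gap is positive and negative, and this
  persists for nearby \<open>x'\<close>.\<close>

lemma coexistence_continuous: "continuous_on {..fst critical_point} coexistence"
  unfolding continuous_on_iff
proof (intro ballI allI impI)
  fix x e :: real assume x: "x \<in> {..fst critical_point}" and "e > 0"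
  have gap0: "gap (x, coexistence x) = 0" using coexistence_gap x by simp
  have cont: "isCont (\<lambda>x. gap (x, y)) x" for y
    by (rule isCont_o2[OF _ isCont_gap]) (intro continuous_intros)
  have "\<forall>\<^sub>F x' in at x. gap (x', coexistence x + e) > 0"
    using gap_less_snd[of "coexistence x" "coexistence x + e" x] gap0 \<open>e > 0\<close> cont
    by (intro order_tendstoD) (auto simp: isCont_def)
  moreover have "\<forall>\<^sub>F x' in at x. gap (x', coexistence x - e) < 0"
    using gap_less_snd[of "coexistence x - e" "coexistence x" x] gap0 \<open>e > 0\<close> cont
    by (intro order_tendstoD) (auto simp: isCont_def)
  ultimately have "\<forall>\<^sub>F x' in at x. gap (x', coexistence x - e) < 0 \<and> gap (x', coexistence x + e) > 0"
    by eventually_elim simp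
  then obtain d where d: "d > 0" "\<And>x'. x' \<noteq> x \<Longrightarrow> dist x' x < d \<Longrightarrow>
      gap (x', coexistence x - e) < 0 \<and> gap (x', coexistence x + e) > 0"
    by (auto simp: eventually_at)
  show "\<exists>d>0. \<forall>x'\<in>{..fst critical_point}. dist x' x < d \<longrightarrow> dist (coexistence x') (coexistence x) < e"
  proof (intro exI[of _ d] conjI ballI impI)
    fix x' assume x': "x' \<in> {..fst critical_point}" "dist x' x < d"
    show "dist (coexistence x') (coexistence x) < e"
    proof (cases "x' = x")
      case False
      have gap': "gap (x', coexistence x') = 0" using coexistence_gap x' by simp
      have mono: "y < y'" if "gap (x', y) < gap (x', y')" for y y'
        using gap_less_snd[of y' y x'] that by (cases y y' rule: linorder_cases) auto
      have "coexistence x - e < coexistence x'" "coexistence x' < coexistence x + e"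
        using d(2)[OF False x'(2)] gap' mono[of "coexistence x - e" "coexistence x'"]
          mono[of "coexistence x'" "coexistence x + e"] by simp_all
      then show ?thesis by (simp add: dist_real_def abs_less_iff)
    qed (use \<open>e > 0\<close> in simp)
  qed (rule d)
qed

text \<open>Below the critical coupling a vanishing gap does not mean that two maximizers coexist but only
  that the unique maximizer is \<open>\<theta>\<^sub>0\<close>.\<close>

definition pure_phase :: "(real \<times> real) set" where
  "pure_phase = {\<beta>. snd \<beta> \<ge> 0 \<and> (gap \<beta> \<noteq> 0 \<or> snd \<beta> < critical_coupling)}"

lemma pure_phase_eq:
  "pure_phase = parameter_space - {(x, coexistence x) | x. x \<le> fst critical_point}"
proof -
  have iff: "(gap (x, y) = 0 \<and> critical_coupling \<le> y) \<longleftrightarrow> (y = coexistence x \<and> x \<le> fst critical_point)" for x y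
  proof
    assume *: "gap (x, y) = 0 \<and> critical_coupling \<le> y"
    have "x \<le> fst critical_point"
    proof (rule ccontr)
      assume "\<not> ?thesis"
      then have "gap critical_point < gap (x, y)" using * by (intro gap_strict_mono) (auto simp: prod_eq_iff)
      then show False using * gap_critical_point by simp
    qed
    then show "y = coexistence x \<and> x \<le> fst critical_point" using coexistence_eqI[of x y] * by simp
  qed (use coexistence_gap in auto)
  have "(x, y) \<in> pure_phase \<longleftrightarrow> y \<ge> 0 \<and> \<not> (gap (x, y) = 0 \<and> critical_coupling \<le> y)" for x y
    by (auto simp: pure_phase_def)
  moreover have "(x, y) \<in> parameter_space - {(x, coexistence x) | x. x \<le> fst critical_point} \<longleftrightarrow>
      y \<ge> 0 \<and> \<not> (y = coexistence x \<and> x \<le> fst critical_point)" for x y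
    by (auto simp: parameter_space_def)
  ultimately have "\<beta> \<in> pure_phase \<longleftrightarrow>
      \<beta> \<in> parameter_space - {(x, coexistence x) | x. x \<le> fst critical_point}" for \<beta>
    by (cases \<beta>) (simp only: iff)
  then show ?thesis by (rule set_eqI)
qed

lemma openin_pure_phase: "openin (top_of_set parameter_space) pure_phase"
proof -
  have "open {\<beta>. gap \<beta> \<noteq> 0}"
    by (intro open_Collect_neq continuous_at_imp_continuous_on ballI isCont_gap continuous_intros)
  moreover have "open {\<beta> :: real \<times> real. snd \<beta> < critical_coupling}"
    by (intro open_Collect_less continuous_intros)
  ultimately have "open ({\<beta>. gap \<beta> \<noteq> 0} \<union> {\<beta>. snd \<beta> < critical_coupling})" by blast
  moreover have "pure_phase = parameter_space \<inter> ({\<beta>. gap \<beta> \<noteq> 0} \<union> {\<beta>. snd \<beta> < critical_coupling})"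
    by (auto simp: pure_phase_def parameter_space_def)
  ultimately show ?thesis by (auto simp: openin_open)
qed

text \<open>Every point is joined to one point \<open>a\<close> on the axis \<open>\<beta>\<^sub>2 = 0\<close>.  From a positive gap, moving
  to the right keeps the gap positive, and to the right of the critical point one can descend.  Otherwise
  one can descend at once, since the gap decreases.\<close>

lemma connected_pure_phase: "connected pure_phase"
proof -
  define a :: "real \<times> real" where "a = (fst critical_point + 1, 0)"
  have axis: "(x, 0) \<in> pure_phase" for x
    using critical_coupling_pos by (simp add: pure_phase_def)
  have seg: "\<exists>C. connected C \<and> C \<subseteq> pure_phase \<and> \<beta> \<in> C \<and> a \<in> C" if "\<beta> \<in> pure_phase" for \<beta>
  proof (cases "gap \<beta> > 0")
    case True
    define m where "m = max (fst \<beta>) (fst critical_point + 1)"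
    have right: "closed_segment \<beta> (m, snd \<beta>) \<subseteq> pure_phase"
    proof
      fix z assume "z \<in> closed_segment \<beta> (m, snd \<beta>)"
      then obtain u where u: "0 \<le> u" "u \<le> 1" "z = (1 - u) *\<^sub>R \<beta> + u *\<^sub>R (m, snd \<beta>)"
        by (auto simp: closed_segment_def)
      have z: "snd z = snd \<beta>" "fst z = fst \<beta> + u * (m - fst \<beta>)"
        unfolding u(3) by (simp_all add: algebra_simps)
      have "0 \<le> u * (m - fst \<beta>)" using u by (intro mult_nonneg_nonneg) (auto simp: m_def)
      then have "gap \<beta> \<le> gap z"
        using z by (intro gap_mono) linarith+
      then show "z \<in> pure_phase" using True that z by (auto simp: pure_phase_def)
    qed
    have down: "closed_segment (m, snd \<beta>) (m, 0) \<subseteq> pure_phase"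
    proof
      fix z assume "z \<in> closed_segment (m, snd \<beta>) (m, 0)"
      then obtain u where u: "0 \<le> u" "u \<le> 1" "z = (1 - u) *\<^sub>R (m, snd \<beta>) + u *\<^sub>R (m, 0)"
        by (auto simp: closed_segment_def)
      have "fst z = m" "snd z = (1 - u) * snd \<beta>" unfolding u(3) by (simp_all add: algebra_simps)
      then have z: "fst z = m" "snd z \<ge> 0" using u that by (auto simp: pure_phase_def)
      have "gap z \<noteq> 0 \<or> snd z < critical_coupling"
      proof (rule ccontr)
        assume *: "\<not> ?thesis"
        then have "gap critical_point < gap z"
          using z by (intro gap_strict_mono) (auto simp: m_def)
        then show False using * gap_critical_point by simp
      qed
      then show "z \<in> pure_phase" using z by (simp add: pure_phase_def)
    qed
    have base: "closed_segment (m, 0) a \<subseteq> pure_phase"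
      using axis by (auto simp: closed_segment_def a_def)
    let ?C = "closed_segment \<beta> (m, snd \<beta>) \<union> (closed_segment (m, snd \<beta>) (m, 0) \<union> closed_segment (m, 0) a)"
    have "connected ?C"
      by (intro connected_Un connected_segment) auto
    then show ?thesis using right down base by (intro exI[of _ ?C]) auto
  next
    case False
    have down: "closed_segment \<beta> (fst \<beta>, 0) \<subseteq> pure_phase"
    proof
      fix z assume "z \<in> closed_segment \<beta> (fst \<beta>, 0)"
      then obtain u where u: "0 \<le> u" "u \<le> 1" "z = (1 - u) *\<^sub>R \<beta> + u *\<^sub>R (fst \<beta>, 0)"
        by (auto simp: closed_segment_def)
      have z: "fst z = fst \<beta>" "snd z = (1 - u) * snd \<beta>" unfolding u(3) by (simp_all add: algebra_simps)
      then have "0 \<le> snd z" "snd z \<le> snd \<beta>"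
        using u that by (auto simp: pure_phase_def mult_left_le_one_le)
      have "gap z < 0" if "z \<noteq> \<beta>"
        using gap_strict_mono[of z \<beta>] z(1) \<open>snd z \<le> snd \<beta>\<close> that False by linarith
      then show "z \<in> pure_phase"
        using \<open>0 \<le> snd z\<close> \<open>\<beta> \<in> pure_phase\<close>
        by (cases "z = \<beta>") (simp_all add: pure_phase_def)
    qed
    have base: "closed_segment (fst \<beta>, 0) a \<subseteq> pure_phase"
      using axis by (auto simp: closed_segment_def a_def)
    let ?C = "closed_segment \<beta> (fst \<beta>, 0) \<union> closed_segment (fst \<beta>, 0) a"
    have "connected ?C" by (intro connected_Un connected_segment) auto
    then show ?thesis using down base by (intro exI[of _ ?C]) auto
  qed
  have "pure_phase = \<Union>{C. connected C \<and> C \<subseteq> pure_phase \<and> a \<in> C}"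
    using seg by blast
  moreover have "connected (\<Union>{C. connected C \<and> C \<subseteq> pure_phase \<and> a \<in> C})"
    by (rule connected_Union) auto
  ultimately show ?thesis by simp
qed

text \<open>At these points the global maximizer is unique.  Besides the pure phase they include the
  critical point, where the maximizer is degenerate.\<close>

definition regular :: "real \<times> real \<Rightarrow> bool" where
  "regular \<beta> \<longleftrightarrow> snd \<beta> \<ge> 0 \<and> (gap \<beta> \<noteq> 0 \<or> snd \<beta> \<le> critical_coupling)"

definition \<Theta> :: "real \<times> real \<Rightarrow> real" where
  "\<Theta> \<beta> = (SOME t. maximizer UNIV \<beta> t)"

lemma pure_phase_regular: "\<beta> \<in> pure_phase \<Longrightarrow> regular \<beta>"
  by (auto simp: pure_phase_def regular_def)

lemma critical_regular: "regular critical_point"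
  using critical_coupling_pos by (simp add: regular_def)

lemma \<Theta>_maximizer: "maximizer UNIV \<beta> (\<Theta> \<beta>)"
  unfolding \<Theta>_def using maximizer_exists[OF line_or_rays(1)] by (rule someI_ex)

lemma gap_pos_maximizer:
  assumes "gap \<beta> > 0" "maximizer UNIV \<beta> t"
  shows "maximizer {\<theta>\<^sub>0..} \<beta> t" "ell \<beta> \<theta>\<^sub>0 < ell \<beta> t"
proof -
  show *: "maximizer {\<theta>\<^sub>0..} \<beta> t" using maximizer_UNIV_cases[OF assms(2)] assms by auto
  show "ell \<beta> \<theta>\<^sub>0 < ell \<beta> t"
    using ell_le_val[of "{..\<theta>\<^sub>0}" \<theta>\<^sub>0 \<beta>] val_eq[OF *] assms by (simp add: gap_def)
qed

lemma gap_neg_maximizer: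
  assumes "gap \<beta> < 0" "maximizer UNIV \<beta> t"
  shows "maximizer {..\<theta>\<^sub>0} \<beta> t" "ell \<beta> \<theta>\<^sub>0 < ell \<beta> t"
proof -
  show *: "maximizer {..\<theta>\<^sub>0} \<beta> t" using maximizer_UNIV_cases[OF assms(2)] assms by auto
  show "ell \<beta> \<theta>\<^sub>0 < ell \<beta> t"
    using ell_le_val[of "{\<theta>\<^sub>0..}" \<theta>\<^sub>0 \<beta>] val_eq[OF *] assms by (simp add: gap_def)
qed

lemma regular_unique:
  assumes "regular \<beta>" "maximizer UNIV \<beta> t"
  shows "t = \<Theta> \<beta>"
proof -
  consider "gap \<beta> > 0" | "gap \<beta> < 0" | "gap \<beta> = 0" "snd \<beta> \<le> critical_coupling"
    using assms linorder_less_linear[of "gap \<beta>" 0] by (auto simp: regular_def)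
  then show ?thesis
  proof cases
    case 1
    then show ?thesis
      using right_maximizer(4)[of \<beta> "\<Theta> \<beta>" t] gap_pos_maximizer[OF 1] \<Theta>_maximizer assms
      by (auto simp: regular_def)
  next
    case 2
    then show ?thesis
      using left_maximizer(4)[of \<beta> "\<Theta> \<beta>" t] gap_neg_maximizer[OF 2] \<Theta>_maximizer assms
      by (auto simp: regular_def)
  next
    case 3
    then show ?thesis using subcritical_maximizer[OF _ _ assms(2) \<Theta>_maximizer] assms
      by (auto simp: regular_def)
  qed
qed

lemma pure_phase_nondegenerate:
  assumes "\<beta> \<in> pure_phase"
  shows "snd \<beta> * dq (\<Theta> \<beta>) < 1 / 2"
proof -
  have \<beta>: "snd \<beta> \<ge> 0" using assms by (simp add: pure_phase_def)
  consider "gap \<beta> > 0" | "gap \<beta> < 0" | "snd \<beta> < critical_coupling"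
    using assms linorder_less_linear[of "gap \<beta>" 0] by (auto simp: pure_phase_def)
  then show ?thesis
  proof cases
    case 1
    then show ?thesis using right_maximizer(3)[OF \<beta> gap_pos_maximizer] \<Theta>_maximizer by blast
  next
    case 2
    then show ?thesis using left_maximizer(3)[OF \<beta> gap_neg_maximizer] \<Theta>_maximizer by blast
  next
    case 3
    have "snd \<beta> * dq (\<Theta> \<beta>) \<le> snd \<beta> * dq \<theta>\<^sub>0" using \<beta> dq_le_peak(1) by (intro mult_left_mono)
    also have "\<dots> < critical_coupling * dq \<theta>\<^sub>0" using 3 dq_pos by (intro mult_strict_right_mono)
    also have "\<dots> = 1 / 2" using dq_pos[of \<theta>\<^sub>0] by (simp add: critical_coupling_def)
    finally show ?thesis .
  qed
qed

lemma isCont_\<Theta>: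
  assumes "regular \<beta>"
  shows "isCont \<Theta> \<beta>"
  unfolding continuous_at_eps_delta
proof (intro allI impI)
  fix e :: real assume "e > 0"
  then obtain d where "d > 0" "\<forall>\<beta>' t. dist \<beta>' \<beta> < d \<longrightarrow> maximizer UNIV \<beta>' t \<longrightarrow> \<bar>t - \<Theta> \<beta>\<bar> < e"
    using maximizer_stable[OF line_or_rays(1) \<Theta>_maximizer, of \<beta> e] regular_unique[OF assms] by blast
  then show "\<exists>d>0. \<forall>\<beta>'. dist \<beta>' \<beta> < d \<longrightarrow> dist (\<Theta> \<beta>') (\<Theta> \<beta>) < e"
    using \<Theta>_maximizer by (intro exI[of _ d]) (auto simp: dist_real_def)
qed

lemma isCont_K1: "isCont K1 x" using K1_deriv DERIV_isCont by blast

lemma isCont_K1_\<Theta>: "regular \<beta> \<Longrightarrow> isCont (\<lambda>\<beta>. K1 (\<Theta> \<beta>)) \<beta>"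
  using isCont_o2[of \<beta> \<Theta> K1] isCont_\<Theta> isCont_K1 by blast

lemma isCont_along_line:
  fixes g :: "real \<times> real \<Rightarrow> real"
  assumes "isCont g \<beta>"
  shows "isCont (\<lambda>t. g (\<beta> + t *\<^sub>R v)) 0"
proof -
  have "isCont (\<lambda>t. \<beta> + t *\<^sub>R v) 0" by (intro continuous_intros)
  moreover have "isCont g (\<beta> + 0 *\<^sub>R v)" using assms by simp
  ultimately show ?thesis using isCont_o2[of 0 "\<lambda>t. \<beta> + t *\<^sub>R v" g] by blast
qed

text \<open>The envelope theorem.  Testing the maximum at \<open>\<beta>\<close> with the maximizer at \<open>\<beta> + t v\<close> and conversely
  encloses the increment between \<open>t g 0\<close> and \<open>t g t\<close>, and \<open>g\<close> is continuous because the maximizer is.\<close>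

lemma val_direction_deriv:
  assumes "regular \<beta>"
  shows "((\<lambda>t. val UNIV (\<beta> + t *\<^sub>R v)) has_real_derivative
    fst v * K1 (\<Theta> \<beta>) + snd v * K1 (\<Theta> \<beta>) ^ p) (at 0)"
proof -
  define g where "g t = fst v * K1 (\<Theta> (\<beta> + t *\<^sub>R v)) + snd v * K1 (\<Theta> (\<beta> + t *\<^sub>R v)) ^ p" for t
  define f where "f t = val UNIV (\<beta> + t *\<^sub>R v)" for t
  have diff: "ell (\<beta> + t *\<^sub>R v) \<theta> - ell \<beta> \<theta> = t * (fst v * K1 \<theta> + snd v * K1 \<theta> ^ p)" for t \<theta>
    by (simp add: ell_diff algebra_simps)
  have val: "val UNIV \<beta> = ell \<beta> (\<Theta> \<beta>)" for \<beta> using val_eq \<Theta>_maximizer by blast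
  have sand: "t * g 0 \<le> f t - f 0" "f t - f 0 \<le> t * g t" for t
  proof -
    have "ell (\<beta> + t *\<^sub>R v) (\<Theta> \<beta>) \<le> f t" "ell \<beta> (\<Theta> (\<beta> + t *\<^sub>R v)) \<le> f 0"
      unfolding f_def by (auto intro!: ell_le_val)
    then show "t * g 0 \<le> f t - f 0" "f t - f 0 \<le> t * g t"
      using diff[of t "\<Theta> \<beta>"] diff[of t "\<Theta> (\<beta> + t *\<^sub>R v)"] val[of "\<beta> + t *\<^sub>R v"] val[of \<beta>]
      by (auto simp: f_def g_def)
  qed
  have "isCont (\<lambda>t. K1 (\<Theta> (\<beta> + t *\<^sub>R v))) 0"
    using isCont_K1_\<Theta>[OF assms] by (rule isCont_along_line)
  then have "isCont g 0" unfolding g_def[abs_def] by (intro continuous_intros)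
  then have "((\<lambda>t. \<bar>g t - g 0\<bar>) \<longlongrightarrow> 0) (at 0)"
    by (simp add: isCont_def LIM_zero tendsto_rabs_zero)
  moreover have "\<forall>\<^sub>F t in at 0. norm ((f t - f 0) / t - g 0) \<le> \<bar>g t - g 0\<bar>"
    unfolding eventually_at_filter
  proof (intro always_eventually allI impI)
    fix t :: real assume "t \<noteq> 0"
    have "\<bar>f t - f 0 - t * g 0\<bar> \<le> \<bar>t * g t - t * g 0\<bar>" using sand[of t] by linarith
    also have "\<dots> = \<bar>t\<bar> * \<bar>g t - g 0\<bar>" by (simp add: abs_mult flip: right_diff_distrib)
    finally have "\<bar>f t - f 0 - t * g 0\<bar> / \<bar>t\<bar> \<le> \<bar>g t - g 0\<bar>"
      using \<open>t \<noteq> 0\<close> by (simp add: field_simps)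
    moreover have "(f t - f 0) / t - g 0 = (f t - f 0 - t * g 0) / t" using \<open>t \<noteq> 0\<close> by (simp add: field_simps)
    ultimately show "norm ((f t - f 0) / t - g 0) \<le> \<bar>g t - g 0\<bar>" by simp
  qed
  ultimately have "((\<lambda>t. (f t - f 0) / t - g 0) \<longlongrightarrow> 0) (at 0)"
    by (rule Lim_null_comparison[rotated])
  then have "((\<lambda>t. (f t - f 0) / t) \<longlongrightarrow> g 0) (at 0)" by (rule LIM_zero_cancel)
  then have "(f has_real_derivative g 0) (at 0)" by (simp add: DERIV_def)
  then show ?thesis by (simp add: f_def[abs_def] g_def)
qed

text \<open>Along a horizontal line \<open>\<Theta>\<close> inverts \<open>\<theta> \<mapsto> \<theta> / 2 - \<beta>\<^sub>2 q \<theta> - \<beta>\<^sub>1\<close>.\<close>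

lemma \<Theta>_horizontal_deriv:
  assumes "\<beta> \<in> pure_phase"
  shows "((\<lambda>t. K1 (\<Theta> (\<beta> + t *\<^sub>R (1, 0)))) has_real_derivative
    K2 (\<Theta> \<beta>) / (1 / 2 - snd \<beta> * dq (\<Theta> \<beta>))) (at 0)"
proof -
  define g where "g t = \<Theta> (\<beta> + t *\<^sub>R (1, 0))" for t
  define f where "f \<theta> = \<theta> / 2 - snd \<beta> * q \<theta> - fst \<beta>" for \<theta>
  have fg: "f (g t) = t" for t
    using maximizer_slope[OF \<Theta>_maximizer, of "\<beta> + t *\<^sub>R (1, 0)"] by (simp add: slope_def f_def g_def)
  have g0: "g 0 = \<Theta> \<beta>" by (simp add: g_def flip: zero_prod_def)
  have cont: "isCont g 0"
    unfolding g_def[abs_def]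
    using isCont_\<Theta>[OF pure_phase_regular[OF assms]] by (rule isCont_along_line)
  have "(f has_real_derivative 1 / 2 - snd \<beta> * dq (g 0)) (at (g 0))"
    unfolding f_def[abs_def] by (auto intro!: derivative_eq_intros q_deriv)
  then have "(g has_real_derivative inverse (1 / 2 - snd \<beta> * dq (g 0))) (at 0)"
    using pure_phase_nondegenerate[OF assms] cont fg
    by (intro DERIV_inverse_function[where f = f and a = "- 1" and b = 1]) (auto simp: g0)
  from DERIV_chain2[OF K1_deriv this] have "((\<lambda>t. K1 (g t)) has_real_derivative
    K2 (g 0) * inverse (1 / 2 - snd \<beta> * dq (g 0))) (at 0)" .
  then show ?thesis unfolding g0 unfolding g_def divide_inverse .
qed

end

section \<open>Phase transitions along the curve\<close>

lemma Basis_real_pair: "(Basis :: (real \<times> real) set) = {(1, 0), (0, 1)}"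
  by (auto simp: Basis_prod_def)

text \<open>On the horizontal line through the centre only the terms free of the second variable
  remain.\<close>

lemma analytic_within_horizontal_sums:
  assumes "analytic_within S f (x, y)"
  obtains a :: "nat \<Rightarrow> real" and \<rho> where "\<rho> > 0"
    "\<And>t. (x + t, y) \<in> S \<Longrightarrow> \<bar>t\<bar> < \<rho> \<Longrightarrow> (\<lambda>i. a i * t ^ i) sums f (x + t, y)"
proof -
  obtain c :: "nat \<Rightarrow> nat \<Rightarrow> real" and \<rho> where "\<rho> > 0" and
    sum: "\<And>x' y'. (x', y') \<in> S \<Longrightarrow> \<bar>x' - x\<bar> < \<rho> \<Longrightarrow> \<bar>y' - y\<bar> < \<rho> \<Longrightarrow>
      ((\<lambda>(i, j). c i j * (x' - x) ^ i * (y' - y) ^ j) has_sum f (x', y')) UNIV"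
    using assms by (auto simp: analytic_within_def)
  have "(\<lambda>i. c i 0 * t ^ i) sums f (x + t, y)" if "(x + t, y) \<in> S" "\<bar>t\<bar> < \<rho>" for t
  proof -
    have "((\<lambda>(i, j). c i j * t ^ i * 0 ^ j) has_sum f (x + t, y)) UNIV"
      using sum[OF that(1)] that(2) \<open>\<rho> > 0\<close> by simp
    also have "?this \<longleftrightarrow> ((\<lambda>(i, j). c i j * t ^ i * 0 ^ j) has_sum f (x + t, y)) (range (\<lambda>i. (i, 0)))"
      by (rule has_sum_cong_neutral) (auto simp: power_0_left)
    also have "\<dots> \<longleftrightarrow> ((\<lambda>i. c i 0 * t ^ i) has_sum f (x + t, y)) UNIV"
      by (subst has_sum_reindex) (auto simp: inj_on_def o_def)
    finally show ?thesis by (rule has_sum_imp_sums)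
  qed
  from that[OF \<open>\<rho> > 0\<close> this] show ?thesis .
qed

context sigmoid_tilt
begin

abbreviation density :: "real \<times> real \<Rightarrow> real" where
  "density \<beta> \<equiv> K1 (\<Theta> \<beta>)"

abbreviation susceptibility :: "real \<times> real \<Rightarrow> real" where
  "susceptibility \<beta> \<equiv> K2 (\<Theta> \<beta>) / (1 / 2 - snd \<beta> * dq (\<Theta> \<beta>))"

lemma off_curve:
  assumes "x \<le> fst critical_point" "t \<noteq> 0"
  shows "(x + t, coexistence x) \<in> pure_phase"
proof -
  have "gap (x + t, coexistence x) \<noteq> 0"
    using gap_less_fst[of x "x + t" "coexistence x"] gap_less_fst[of "x + t" x "coexistence x"]
      coexistence_gap(1)[OF assms(1)] assms(2) by (cases "t > 0") simp_all
  moreover have "coexistence x \<ge> 0"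
    using coexistence_gap(2)[OF assms(1)] critical_coupling_pos by simp
  ultimately show ?thesis by (simp add: pure_phase_def)
qed

lemma off_curve_gap:
  assumes "x \<le> fst critical_point"
  shows "t > 0 \<Longrightarrow> gap (x + t, coexistence x) > 0" "t < 0 \<Longrightarrow> gap (x + t, coexistence x) < 0"
  using gap_less_fst[of x "x + t" "coexistence x"] gap_less_fst[of "x + t" x "coexistence x"]
      coexistence_gap(1)[OF assms(1)] by simp_all

lemma filterlim_off_curve:
  assumes "x \<le> fst critical_point"
  shows "filterlim (\<lambda>t. (x + t, coexistence x)) (at (x, coexistence x) within pure_phase) (at 0)"
proof -
  have "((\<lambda>t. (x + t, coexistence x)) \<longlongrightarrow> (x + 0, coexistence x)) (at 0)"
    by (intro tendsto_intros)
  then show ?thesis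
    using off_curve[OF assms] by (auto simp: filterlim_at eventually_at_filter)
qed

text \<open>To the right of the curve the maximizer is close to the right one of the two maximizers on the
  curve, and to the left of it to the left one.\<close>

lemma density_jump:
  assumes x: "x < fst critical_point"
  shows "\<nexists>l. ((\<lambda>t. density (x + t, coexistence x)) \<longlongrightarrow> l) (at 0)"
proof
  assume "\<exists>l. ((\<lambda>t. density (x + t, coexistence x)) \<longlongrightarrow> l) (at 0)"
  then obtain l where l: "((\<lambda>t. density (x + t, coexistence x)) \<longlongrightarrow> l) (at 0)" by blast
  let ?\<beta> = "(x, coexistence x)"
  have xle: "x \<le> fst critical_point" using x by simp
  have gap0: "gap ?\<beta> = 0" and pos: "0 \<le> snd ?\<beta>"
    using coexistence_gap[OF xle] critical_coupling_pos by simp_all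
  have super: "critical_coupling < snd ?\<beta>"
    using coexistence_decreasing[of x "fst critical_point"] x coexistence_critical by simp
  obtain tl tr where tl: "maximizer {..\<theta>\<^sub>0} ?\<beta> tl" and tr: "maximizer {\<theta>\<^sub>0..} ?\<beta> tr"
    using maximizer_exists line_or_rays by meson
  have above: "ell ?\<beta> \<theta>\<^sub>0 < ell ?\<beta> t" if "maximizer {..\<theta>\<^sub>0} ?\<beta> t \<or> maximizer {\<theta>\<^sub>0..} ?\<beta> t" for t
  proof -
    have t: "maximizer UNIV ?\<beta> t" using gap_zero_maximizer[OF gap0 that] .
    obtain s where "ell ?\<beta> \<theta>\<^sub>0 < ell ?\<beta> s"
      using supercritical_not_centre[OF super] by (auto simp: maximizer_def not_le)
    moreover have "ell ?\<beta> s \<le> ell ?\<beta> t" using t by (simp add: maximizer_def)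
    ultimately show ?thesis by simp
  qed
  note R = right_maximizer[OF pos tr above] and L = left_maximizer[OF pos tl above]
  have near: "dist (x + t, coexistence x) ?\<beta> = \<bar>t\<bar>" for t by (simp add: dist_Pair_Pair dist_real_def)
  have limR: "((\<lambda>t. density (x + t, coexistence x)) \<longlongrightarrow> K1 tr) (at_right 0)"
  proof (rule isCont_tendsto_compose[OF isCont_K1], rule tendstoI)
    fix e :: real assume "e > 0"
    then obtain d where d: "d > 0" "\<forall>\<beta>' t. dist \<beta>' ?\<beta> < d \<longrightarrow> maximizer {\<theta>\<^sub>0..} \<beta>' t \<longrightarrow> \<bar>t - tr\<bar> < e"
      using maximizer_stable[OF line_or_rays(2) tr] R(4) tr by blast
    have "dist (\<Theta> (x + t, coexistence x)) tr < e" if "0 < t" "t < d" for t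
      unfolding dist_real_def
    proof (rule d(2)[rule_format])
      show "dist (x + t, coexistence x) ?\<beta> < d" using near[of t] that by simp
    qed (rule gap_pos_maximizer(1)[OF off_curve_gap(1)[OF xle that(1)] \<Theta>_maximizer])
    then show "\<forall>\<^sub>F t in at_right 0. dist (\<Theta> (x + t, coexistence x)) tr < e"
      using d(1) by (auto simp: eventually_at_right_field)
  qed
  have limL: "((\<lambda>t. density (x + t, coexistence x)) \<longlongrightarrow> K1 tl) (at_left 0)"
  proof (rule isCont_tendsto_compose[OF isCont_K1], rule tendstoI)
    fix e :: real assume "e > 0"
    then obtain d where d: "d > 0" "\<forall>\<beta>' t. dist \<beta>' ?\<beta> < d \<longrightarrow> maximizer {..\<theta>\<^sub>0} \<beta>' t \<longrightarrow> \<bar>t - tl\<bar> < e"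
      using maximizer_stable[OF line_or_rays(3) tl] L(4) tl by blast
    have "dist (\<Theta> (x + t, coexistence x)) tl < e" if "t < 0" "- d < t" for t
      unfolding dist_real_def
    proof (rule d(2)[rule_format])
      show "dist (x + t, coexistence x) ?\<beta> < d" using near[of t] that by simp
    qed (rule gap_neg_maximizer(1)[OF off_curve_gap(2)[OF xle that(1)] \<Theta>_maximizer])
    then show "\<forall>\<^sub>F t in at_left 0. dist (\<Theta> (x + t, coexistence x)) tl < e"
      using d(1) unfolding eventually_at_left_field by (intro exI[of _ "- d"]) auto
  qed
  have sides: "((\<lambda>t. density (x + t, coexistence x)) \<longlongrightarrow> l) (at_left 0)"
    "((\<lambda>t. density (x + t, coexistence x)) \<longlongrightarrow> l) (at_right 0)"
    using l by (simp_all add: filterlim_at_split)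
  have "K1 tl = l" by (rule tendsto_unique[OF trivial_limit_at_left_real limL sides(1)])
  moreover have "K1 tr = l" by (rule tendsto_unique[OF trivial_limit_at_right_real limR sides(2)])
  moreover have "K1 tl < K1 tr" using R(1) L(1) tl tr by (intro K1_mono) auto
  ultimately show False by simp
qed

text \<open>The denominator tends to \<open>1 / 2 - critical_coupling * dq \<theta>\<^sub>0 = 0\<close>, and the numerator to
  \<open>K2 \<theta>\<^sub>0 > 0\<close>.\<close>

lemma susceptibility_blow_up:
  "\<nexists>l. ((\<lambda>t. susceptibility (fst critical_point + t, coexistence (fst critical_point))) \<longlongrightarrow> l) (at 0)"
proof
  let ?\<beta> = "\<lambda>t. (fst critical_point + t, coexistence (fst critical_point))"
  have \<beta>0: "?\<beta> 0 = critical_point" by (simp add: prod_eq_iff coexistence_critical)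
  assume "\<exists>l. ((\<lambda>t. susceptibility (?\<beta> t)) \<longlongrightarrow> l) (at 0)"
  then obtain l where l: "((\<lambda>t. susceptibility (?\<beta> t)) \<longlongrightarrow> l) (at 0)" by blast
  have "\<Theta> critical_point = \<theta>\<^sub>0"
    using subcritical_gap_zero[OF _ _ gap_critical_point \<Theta>_maximizer] critical_coupling_pos by simp
  moreover have "isCont \<Theta> (?\<beta> 0)" unfolding \<beta>0 by (rule isCont_\<Theta>[OF critical_regular])
  moreover have "(?\<beta> \<longlongrightarrow> ?\<beta> 0) (at 0)" by (intro tendsto_intros)
  ultimately have lim: "((\<lambda>t. \<Theta> (?\<beta> t)) \<longlongrightarrow> \<theta>\<^sub>0) (at 0)"
    using isCont_tendsto_compose[of "?\<beta> 0" \<Theta> ?\<beta> "at 0"] \<beta>0 by simp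
  have "((\<lambda>t. 1 / 2 - critical_coupling * dq (\<Theta> (?\<beta> t))) \<longlongrightarrow> 1 / 2 - critical_coupling * dq \<theta>\<^sub>0) (at 0)"
    by (intro tendsto_intros isCont_tendsto_compose[OF dq_cont] lim)
  moreover have "1 / 2 - critical_coupling * dq \<theta>\<^sub>0 = 0"
    using dq_pos[of \<theta>\<^sub>0] by (simp add: critical_coupling_def)
  ultimately have "((\<lambda>t. 1 / 2 - critical_coupling * dq (\<Theta> (?\<beta> t))) \<longlongrightarrow> 0) (at 0)" by simp
  from tendsto_mult[OF l this]
  have "((\<lambda>t. susceptibility (?\<beta> t) * (1 / 2 - critical_coupling * dq (\<Theta> (?\<beta> t)))) \<longlongrightarrow> 0) (at 0)" by simp
  moreover have "\<forall>\<^sub>F t in at 0. susceptibility (?\<beta> t) * (1 / 2 - critical_coupling * dq (\<Theta> (?\<beta> t))) = K2 (\<Theta> (?\<beta> t))"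
    unfolding eventually_at_filter
  proof (intro always_eventually allI impI)
    fix t :: real assume "t \<noteq> 0"
    then have "critical_coupling * dq (\<Theta> (?\<beta> t)) < 1 / 2"
      using pure_phase_nondegenerate[OF off_curve[OF order_refl]] coexistence_critical by simp
    then show "susceptibility (?\<beta> t) * (1 / 2 - critical_coupling * dq (\<Theta> (?\<beta> t))) = K2 (\<Theta> (?\<beta> t))"
      by (simp add: coexistence_critical)
  qed
  ultimately have "((\<lambda>t. K2 (\<Theta> (?\<beta> t))) \<longlongrightarrow> 0) (at 0)"
    by (rule Lim_transform_eventually)
  moreover have "((\<lambda>t. K2 (\<Theta> (?\<beta> t))) \<longlongrightarrow> K2 \<theta>\<^sub>0) (at 0)"
    by (rule isCont_tendsto_compose[OF K2_cont lim])
  ultimately have "K2 \<theta>\<^sub>0 = 0" by (rule tendsto_unique[OF trivial_limit_at, rotated])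
  then show False using K2_pos[of \<theta>\<^sub>0] by simp
qed

lemma horizontal_derivs:
  assumes "(x + t, y) \<in> pure_phase"
  shows "((\<lambda>t. val UNIV (x + t, y)) has_real_derivative density (x + t, y)) (at t)"
    and "((\<lambda>t. density (x + t, y)) has_real_derivative susceptibility (x + t, y)) (at t)"
proof -
  have "((\<lambda>s. val UNIV (x + t + s, y)) has_real_derivative density (x + t, y)) (at 0)"
    using val_direction_deriv[OF pure_phase_regular[OF assms], of "(1, 0)"] by simp
  then show "((\<lambda>t. val UNIV (x + t, y)) has_real_derivative density (x + t, y)) (at t)"
    using DERIV_shift[of "\<lambda>t. val UNIV (x + t, y)" "density (x + t, y)" 0 t]
    by (simp add: add_ac)
  have "((\<lambda>s. density (x + t + s, y)) has_real_derivative susceptibility (x + t, y)) (at 0)"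
    using \<Theta>_horizontal_deriv[OF assms] by simp
  then show "((\<lambda>t. density (x + t, y)) has_real_derivative susceptibility (x + t, y)) (at t)"
    using DERIV_shift[of "\<lambda>t. density (x + t, y)" "susceptibility (x + t, y)" 0 t]
    by (simp add: add_ac)
qed

lemma derivs_eq_if_locally_eq:
  assumes "(f has_real_derivative d) (at t)" "(g has_real_derivative e) (at t)"
    and "r > 0" "\<And>s. \<bar>s - t\<bar> < r \<Longrightarrow> f s = g s"
  shows "d = e"
proof -
  have "\<forall>\<^sub>F s in nhds t. f s = g s"
    using assms(3,4) by (auto simp: eventually_nhds_metric dist_real_def intro!: exI[of _ r])
  then have "(f has_real_derivative e) (at t)"
    using assms(2) by (simp add: DERIV_cong_ev)
  then show ?thesis using assms(1) DERIV_unique by blast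
qed

text \<open>A power series in \<open>t\<close> has continuous derivatives at \<open>0\<close>.  Away from \<open>0\<close> its first and second
  derivatives are the density and the susceptibility, so that both would have limits.\<close>

lemma not_analytic_on_curve:
  assumes x: "x \<le> fst critical_point" and agree: "\<And>\<beta>. \<beta> \<in> parameter_space \<Longrightarrow> \<psi> \<beta> = val UNIV \<beta>"
  shows "\<not> analytic_within parameter_space \<psi> (x, coexistence x)"
proof
  assume "analytic_within parameter_space \<psi> (x, coexistence x)"
  then obtain a \<rho> where "\<rho> > 0" and sums: "\<And>t. (x + t, coexistence x) \<in> parameter_space \<Longrightarrow>
      \<bar>t\<bar> < \<rho> \<Longrightarrow> (\<lambda>i. a i * t ^ i) sums \<psi> (x + t, coexistence x)"
    by (rule analytic_within_horizontal_sums) blast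
  have inS: "(x + t, coexistence x) \<in> parameter_space" for t
    using coexistence_gap(2)[OF x] critical_coupling_pos by (simp add: parameter_space_def)
  define r where "r = \<rho> / 2"
  have r: "r > 0" "r < \<rho>" using \<open>\<rho> > 0\<close> by (auto simp: r_def)
  define F where "F n t = (\<Sum>i. (diffs ^^ n) a i * t ^ i)" for n t
  have summ0: "summable (\<lambda>i. a i * t ^ i)" if "\<bar>t\<bar> < \<rho>" for t
    using sums[OF inS that] sums_summable by blast
  have summ: "summable (\<lambda>i. (diffs ^^ n) a i * t ^ i)" if "\<bar>t\<bar> < \<rho>" for n t
    using that
  proof (induction n arbitrary: t)
    case (Suc n)
    then show ?case using termdiff_converges[of t \<rho> "(diffs ^^ n) a"] by simp
  qed (use summ0 in simp)
  have deriv: "(F n has_real_derivative F (Suc n) t) (at t)" if "\<bar>t\<bar> < \<rho>" for n t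
    unfolding F_def using termdiffs_strong'[of \<rho> "(diffs ^^ n) a" t] summ that by simp
  have F0: "val UNIV (x + t, coexistence x) = F 0 t" if "\<bar>t\<bar> < \<rho>" for t
    using sums_unique[OF sums[OF inS that]] agree[OF inS] by (simp add: F_def)
  have F1: "density (x + t, coexistence x) = F 1 t" if "t \<noteq> 0" "\<bar>t\<bar> < \<rho>" for t
  proof (rule derivs_eq_if_locally_eq[OF horizontal_derivs(1)[OF off_curve[OF x that(1)]]])
    show "(F 0 has_real_derivative F 1 t) (at t)" using deriv[of t 0] that by simp
    show "\<rho> - \<bar>t\<bar> > 0" using that by simp
    show "val UNIV (x + s, coexistence x) = F 0 s" if "\<bar>s - t\<bar> < \<rho> - \<bar>t\<bar>" for s
      using that by (intro F0) linarith
  qed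
  have F2: "susceptibility (x + t, coexistence x) = F 2 t" if "t \<noteq> 0" "\<bar>t\<bar> < \<rho>" for t
  proof (rule derivs_eq_if_locally_eq[OF horizontal_derivs(2)[OF off_curve[OF x that(1)]]])
    show "(F 1 has_real_derivative F 2 t) (at t)" using deriv[of t 1] that by (simp add: numeral_2_eq_2)
    show "min (\<rho> - \<bar>t\<bar>) \<bar>t\<bar> > 0" using that by simp
    show "density (x + s, coexistence x) = F 1 s" if "\<bar>s - t\<bar> < min (\<rho> - \<bar>t\<bar>) \<bar>t\<bar>" for s
      using that by (intro F1) linarith+
  qed
  have cont: "(F n \<longlongrightarrow> F n 0) (at 0)" for n
    using DERIV_isCont[OF deriv[of 0 n]] \<open>\<rho> > 0\<close> by (simp add: isCont_def)
  have ev: "\<forall>\<^sub>F t in at 0. t \<noteq> 0 \<and> \<bar>t\<bar> < \<rho>"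
    unfolding eventually_at using \<open>\<rho> > 0\<close> by (intro exI[of _ \<rho>]) (simp add: dist_real_def)
  have "((\<lambda>t. density (x + t, coexistence x)) \<longlongrightarrow> F 1 0) (at 0)"
    by (rule Lim_transform_eventually[OF cont]) (use ev in eventually_elim, use F1 in simp)
  then have "x = fst critical_point" using density_jump[of x] x by (meson order_le_less)
  moreover have "((\<lambda>t. susceptibility (x + t, coexistence x)) \<longlongrightarrow> F 2 0) (at 0)"
    by (rule Lim_transform_eventually[OF cont]) (use ev in eventually_elim, use F2 in simp)
  ultimately show False using susceptibility_blow_up by blast
qed

context
  fixes \<psi> :: "real \<times> real \<Rightarrow> real"
  assumes agree: "\<And>\<beta>. \<beta> \<in> parameter_space \<Longrightarrow> \<psi> \<beta> = val UNIV \<beta>"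
begin

lemma has_partial_once:
  assumes "regular \<beta>"
  shows "has_partial parameter_space \<psi> [v] \<beta> (fst v * density \<beta> + snd v * density \<beta> ^ p)"
proof -
  have "((\<lambda>t. val UNIV (\<beta> + t *\<^sub>R v)) has_real_derivative fst v * density \<beta> + snd v * density \<beta> ^ p)
      (at 0 within {t. \<beta> + t *\<^sub>R v \<in> parameter_space})"
    using val_direction_deriv[OF assms] by (rule has_field_derivative_at_within)
  then show ?thesis
    using agree by (auto intro!: exI[of _ "\<lambda>t. val UNIV (\<beta> + t *\<^sub>R v)"])
qed

lemma has_partial_twice:
  assumes "\<beta> \<in> pure_phase"
  shows "has_partial parameter_space \<psi> [(1, 0), (1, 0)] \<beta> (susceptibility \<beta>)"
proof -
  have "\<forall>\<^sub>F t in nhds 0. regular (\<beta> + t *\<^sub>R (1, 0))"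
  proof (cases "gap \<beta> = 0")
    case True
    then show ?thesis using assms by (auto simp: pure_phase_def regular_def)
  next
    case False
    have "isCont (\<lambda>t. gap (\<beta> + t *\<^sub>R (1, 0))) 0" by (rule isCont_along_line[OF isCont_gap])
    then have "((\<lambda>t. gap (\<beta> + t *\<^sub>R (1, 0))) \<longlongrightarrow> gap (\<beta> + 0 *\<^sub>R (1, 0))) (nhds 0)"
      unfolding isCont_def by (rule tendsto_at_iff_tendsto_nhds[THEN iffD1])
    then have "((\<lambda>t. gap (\<beta> + t *\<^sub>R (1, 0))) \<longlongrightarrow> gap \<beta>) (nhds 0)"
      by (simp flip: zero_prod_def)
    then have "\<forall>\<^sub>F t in nhds 0. gap (\<beta> + t *\<^sub>R (1, 0)) \<noteq> 0"
      using False by (rule tendsto_imp_eventually_ne)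
    then show ?thesis
      by eventually_elim (use assms in \<open>auto simp: pure_phase_def regular_def\<close>)
  qed
  then have "\<forall>\<^sub>F t in nhds 0. has_partial parameter_space \<psi> [(1, 0)] (\<beta> + t *\<^sub>R (1, 0)) (density (\<beta> + t *\<^sub>R (1, 0)))"
  proof eventually_elim
    case (elim t)
    then show ?case using has_partial_once[of "\<beta> + t *\<^sub>R (1, 0)" "(1, 0)"] by simp
  qed
  then have "\<forall>\<^sub>F t in nhds 0. \<beta> + t *\<^sub>R (1, 0) \<in> parameter_space \<longrightarrow>
      has_partial parameter_space \<psi> [(1, 0)] (\<beta> + t *\<^sub>R (1, 0)) (density (\<beta> + t *\<^sub>R (1, 0)))"
    by (rule eventually_mono) blast
  moreover have "((\<lambda>t. density (\<beta> + t *\<^sub>R (1, 0))) has_real_derivative susceptibility \<beta>)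
      (at 0 within {t. \<beta> + t *\<^sub>R (1, 0) \<in> parameter_space})"
    using \<Theta>_horizontal_deriv[OF assms] by (rule has_field_derivative_at_within)
  ultimately show ?thesis unfolding has_partial.simps(2)[of _ _ _ "[(1, 0)]"]
    by (intro exI[of _ "\<lambda>t. density (\<beta> + t *\<^sub>R (1, 0))"] conjI)
qed

lemma curve_in_frontier:
  assumes "x \<le> fst critical_point"
  shows "(x, coexistence x) \<in> top_of_set parameter_space frontier_of pure_phase"
proof -
  let ?b = "(x, coexistence x)"
  have "?b \<in> parameter_space"
    using coexistence_gap(2)[OF assms] critical_coupling_pos by (simp add: parameter_space_def)
  moreover have "?b \<notin> pure_phase" using assms by (auto simp: pure_phase_eq)
  moreover have "?b \<in> closure pure_phase"
  proof -
    have "at ?b within pure_phase \<noteq> bot"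
      using filterlim_off_curve[OF assms] trivial_limit_at[of "0 :: real"]
      by (auto simp: filterlim_def filtermap_bot_iff bot_unique)
    then show ?thesis using closure_def trivial_limit_within by fastforce
  qed
  moreover have "pure_phase \<subseteq> parameter_space" by (auto simp: pure_phase_eq)
  ultimately show ?thesis
    by (auto simp: frontier_of_def closure_of_subtopology Int_absorb1
        dest: subsetD[OF interior_of_subset])
qed

lemma partial_continuous_val:
  assumes "b \<in> parameter_space"
  shows "partial_continuous parameter_space \<psi> pure_phase [] b"
proof -
  have "(val UNIV \<longlongrightarrow> val UNIV b) (at b within pure_phase)"
    using isCont_val[OF line_or_rays(1), of b] unfolding isCont_def by (rule tendsto_within_subset) simp
  moreover have "\<forall>\<^sub>F x in at b within pure_phase. val UNIV x = \<psi> x"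
    using agree by (auto simp: eventually_at_filter pure_phase_eq intro!: always_eventually)
  ultimately have "(\<psi> \<longlongrightarrow> \<psi> b) (at b within pure_phase)"
    unfolding agree[OF assms] by (rule Lim_transform_eventually)
  then show ?thesis unfolding partial_continuous_def by (intro exI[of _ \<psi>]) simp
qed

text \<open>The derivative that jumps is the one in the direction of \<open>\<beta>\<^sub>1\<close>.\<close>

lemma first_order_transition:
  assumes "x < fst critical_point"
  shows "phase_transition parameter_space \<psi> pure_phase 1 (x, coexistence x)"
proof -
  have x: "x \<le> fst critical_point" using assms by simp
  let ?b = "(x, coexistence x)"
  have "partial_discontinuous parameter_space \<psi> pure_phase [(1, 0)] ?b"
    unfolding partial_discontinuous_def
  proof (intro exI[of _ density] conjI ballI notI)
    show "has_partial parameter_space \<psi> [(1, 0)] \<beta> (density \<beta>)" if "\<beta> \<in> pure_phase" for \<beta>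
      using has_partial_once[OF pure_phase_regular[OF that], of "(1, 0)"] by simp
    assume "\<exists>l. (density \<longlongrightarrow> l) (at ?b within pure_phase)"
    then obtain l where "(density \<longlongrightarrow> l) (at ?b within pure_phase)" by blast
    from filterlim_compose[OF this filterlim_off_curve[OF x]] show False
      using density_jump[OF assms] by blast
  qed
  moreover have "?b \<in> parameter_space"
    using coexistence_gap(2)[OF x] critical_coupling_pos by (simp add: parameter_space_def)
  ultimately show ?thesis
    unfolding phase_transition_def
    using curve_in_frontier[OF x] partial_continuous_val[of ?b]
    by (intro conjI bexI[of _ "[(1, 0)]"]) (auto simp: Basis_real_pair)
qed

text \<open>At the critical point the maximizer is still unique, so the first derivatives exist there and
  are continuous; the second derivative in the direction of \<open>\<beta>\<^sub>1\<close> is the one without a limit.\<close>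

lemma second_order_transition:
  "phase_transition parameter_space \<psi> pure_phase 2 (fst critical_point, coexistence (fst critical_point))"
proof -
  let ?b = "(fst critical_point, coexistence (fst critical_point))"
  have b: "?b = critical_point" by (simp add: prod_eq_iff coexistence_critical)
  have discont: "partial_discontinuous parameter_space \<psi> pure_phase [(1, 0), (1, 0)] ?b"
    unfolding partial_discontinuous_def
  proof (intro exI[of _ susceptibility] conjI ballI notI has_partial_twice)
    assume "\<exists>l. (susceptibility \<longlongrightarrow> l) (at ?b within pure_phase)"
    then obtain l where "(susceptibility \<longlongrightarrow> l) (at ?b within pure_phase)" by blast
    from filterlim_compose[OF this filterlim_off_curve[OF order_refl]] show False
      using susceptibility_blow_up by blast
  qed
  have "?b \<in> parameter_space"
    using critical_coupling_pos by (simp add: parameter_space_def coexistence_critical)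
  moreover have "partial_continuous parameter_space \<psi> pure_phase [v] ?b" for v
  proof -
    let ?g = "\<lambda>\<beta>. fst v * density \<beta> + snd v * density \<beta> ^ p"
    have "isCont ?g critical_point" by (intro continuous_intros isCont_K1_\<Theta> critical_regular)
    then have "(?g \<longlongrightarrow> ?g critical_point) (at critical_point within pure_phase)"
      unfolding isCont_def by (rule tendsto_within_subset) simp
    moreover have "has_partial parameter_space \<psi> [v] \<beta> (?g \<beta>)" if "\<beta> \<in> insert critical_point pure_phase" for \<beta>
      using that pure_phase_regular critical_regular has_partial_once by blast
    ultimately show ?thesis unfolding partial_continuous_def b by (intro exI[of _ ?g]) blast
  qed
  ultimately have "partial_continuous parameter_space \<psi> pure_phase vs ?b" if "length vs < 2" for vs
    using that partial_continuous_val[of ?b] by (cases vs) auto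
  then show ?thesis
    unfolding phase_transition_def using discont curve_in_frontier[OF order_refl]
    by (intro conjI bexI[of _ "[(1, 0), (1, 0)]"]) (auto simp: Basis_real_pair)
qed

lemma single_phase:
  assumes "\<And>\<beta>. \<beta> \<in> pure_phase \<Longrightarrow> analytic_within parameter_space \<psi> \<beta>"
  shows "{Q. phase parameter_space \<psi> Q} = {pure_phase}"
proof -
  have region: "analytic_region parameter_space \<psi> pure_phase"
    using openin_pure_phase connected_pure_phase assms critical_coupling_pos
    by (auto simp: analytic_region_def pure_phase_def intro!: exI[of _ "(0, 0)"])
  have sub: "Q \<subseteq> pure_phase" if "analytic_region parameter_space \<psi> Q" for Q
  proof
    fix \<beta> assume "\<beta> \<in> Q"
    then have "\<beta> \<in> parameter_space" "analytic_within parameter_space \<psi> \<beta>"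
      using that openin_imp_subset by (auto simp: analytic_region_def)
    then show "\<beta> \<in> pure_phase"
      using not_analytic_on_curve[OF _ agree] by (auto simp: pure_phase_eq)
  qed
  have "phase parameter_space \<psi> Q \<longleftrightarrow> Q = pure_phase" for Q
  proof
    assume "phase parameter_space \<psi> Q"
    then show "Q = pure_phase" using region sub[of Q] unfolding phase_def by blast
  next
    assume "Q = pure_phase"
    then show "phase parameter_space \<psi> Q" using region sub unfolding phase_def by blast
  qed
  then show ?thesis by blast
qed

end

end

section \<open>Analyticity off the curve\<close>

text \<open>Summed along the diagonals \<open>i + j = n\<close>, this is the geometric series of \<open>a + b\<close>.\<close>

lemma double_geometric_real:
  fixes a b :: real
  assumes "0 \<le> a" "0 \<le> b" "a + b < 1"
  shows "(\<lambda>(i, j). real ((i + j) choose i) * a ^ i * b ^ j) summable_on UNIV"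
proof -
  let ?h = "\<lambda>(n, i). (i, n - i) :: nat \<times> nat"
  have bij: "bij_betw ?h (SIGMA n:UNIV. {..n}) UNIV"
    by (rule bij_betw_byWitness[where f' = "\<lambda>(i, j). (i + j, i)"]) auto
  have "(\<lambda>(n, i). real (n choose i) * a ^ i * b ^ (n - i)) summable_on (SIGMA n:UNIV. {..n})"
  proof (rule summable_on_SigmaI[where g = "\<lambda>n. (a + b) ^ n"])
    fix n
    have "(\<Sum>i\<le>n. real (n choose i) * a ^ i * b ^ (n - i)) = (a + b) ^ n"
      by (simp add: binomial_ring)
    then show "((\<lambda>i. case (n, i) of (n, i) \<Rightarrow> real (n choose i) * a ^ i * b ^ (n - i)) has_sum (a + b) ^ n) {..n}"
      by (intro has_sum_finiteI) auto
  next
    show "(\<lambda>n. (a + b) ^ n) summable_on UNIV"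
      using assms by (intro summable_nonneg_imp_summable_on summable_geometric) auto
  qed (use assms in auto)
  also have "?this \<longleftrightarrow> (\<lambda>x. (\<lambda>(i, j). real ((i + j) choose i) * a ^ i * b ^ j) (?h x)) summable_on (SIGMA n:UNIV. {..n})"
    by (intro summable_on_cong) auto
  also have "\<dots> \<longleftrightarrow> ?thesis"
    by (rule summable_on_reindex_bij_betw[OF bij])
  finally show ?thesis .
qed

lemma double_geometric:
  fixes a b :: complex
  assumes "norm a + norm b < 1"
  shows "((\<lambda>(i, j). of_nat ((i + j) choose i) * a ^ i * b ^ j) has_sum 1 / (1 - (a + b))) UNIV"
proof -
  let ?h = "\<lambda>(n, i). (i, n - i) :: nat \<times> nat"
  let ?f = "\<lambda>(i, j). of_nat ((i + j) choose i) * a ^ i * b ^ j"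
  have bij: "bij_betw ?h (SIGMA n:UNIV. {..n}) UNIV"
    by (rule bij_betw_byWitness[where f' = "\<lambda>(i, j). (i + j, i)"]) auto
  have "(\<lambda>x. norm (?f x)) summable_on UNIV"
    using double_geometric_real[OF norm_ge_zero norm_ge_zero assms]
    by (simp add: case_prod_unfold norm_mult norm_power)
  then have "?f summable_on UNIV" by (rule abs_summable_summable)
  then have "(\<lambda>x. ?f (?h x)) summable_on (SIGMA n:UNIV. {..n})"
    by (simp only: summable_on_reindex_bij_betw[OF bij])
  moreover have "((\<lambda>n. (a + b) ^ n) has_sum 1 / (1 - (a + b))) UNIV"
  proof (rule norm_summable_imp_has_sum)
    have less: "norm (a + b) < 1" using assms norm_triangle_ineq[of a b] by simp
    then show "summable (\<lambda>n. norm ((a + b) ^ n))" by (simp add: norm_power summable_geometric)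
    show "(\<lambda>n. (a + b) ^ n) sums (1 / (1 - (a + b)))" by (rule geometric_sums[OF less])
  qed
  moreover have "((\<lambda>i. ?f (?h (n, i))) has_sum (a + b) ^ n) {..n}" for n
  proof -
    have "(\<Sum>i\<le>n. ?f (?h (n, i))) = (\<Sum>i\<le>n. of_nat (n choose i) * a ^ i * b ^ (n - i))"
      by (intro sum.cong) auto
    also have "\<dots> = (a + b) ^ n" by (simp add: binomial_ring)
    finally show ?thesis by (intro has_sum_finiteI) auto
  qed
  ultimately have "((\<lambda>x. ?f (?h x)) has_sum 1 / (1 - (a + b))) (SIGMA n:UNIV. {..n})"
    by (intro has_sum_SigmaI) auto
  then show ?thesis by (simp only: has_sum_reindex_bij_betw[OF bij])
qed

text \<open>Only real arguments are considered, but the values are complex, as the functions arise from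
  contour integrals.\<close>

definition double_power_series :: "(real \<Rightarrow> real \<Rightarrow> complex) \<Rightarrow> bool" where
  "double_power_series F \<longleftrightarrow> (\<exists>c \<eta>. \<eta> > 0 \<and> (\<forall>x y. \<bar>x\<bar> < \<eta> \<longrightarrow> \<bar>y\<bar> < \<eta> \<longrightarrow>
     ((\<lambda>(i, j). c i j * of_real x ^ i * of_real y ^ j) has_sum F x y) UNIV))"

lemma double_power_series_add:
  assumes "double_power_series F" "double_power_series G"
  shows "double_power_series (\<lambda>x y. F x y + G x y)"
proof -
  obtain c \<eta> where 1: "\<eta> > 0" "\<And>x y. \<bar>x\<bar> < \<eta> \<Longrightarrow> \<bar>y\<bar> < \<eta> \<Longrightarrow>
     ((\<lambda>(i, j). c i j * of_real x ^ i * of_real y ^ j) has_sum F x y) UNIV"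
    using assms(1) unfolding double_power_series_def by blast
  obtain d \<eta>' where 2: "\<eta>' > 0" "\<And>x y. \<bar>x\<bar> < \<eta>' \<Longrightarrow> \<bar>y\<bar> < \<eta>' \<Longrightarrow>
     ((\<lambda>(i, j). d i j * of_real x ^ i * of_real y ^ j) has_sum G x y) UNIV"
    using assms(2) unfolding double_power_series_def by blast
  show ?thesis
    unfolding double_power_series_def
  proof (intro exI[of _ "\<lambda>i j. c i j + d i j"] exI[of _ "min \<eta> \<eta>'"] conjI allI impI)
    fix x y :: real assume "\<bar>x\<bar> < min \<eta> \<eta>'" "\<bar>y\<bar> < min \<eta> \<eta>'"
    then have "((\<lambda>z. (\<lambda>(i, j). c i j * of_real x ^ i * of_real y ^ j) z
        + (\<lambda>(i, j). d i j * of_real x ^ i * of_real y ^ j) z) has_sum F x y + G x y) UNIV"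
      using 1 2 by (intro has_sum_add) auto
    then show "((\<lambda>(i, j). (c i j + d i j) * of_real x ^ i * of_real y ^ j) has_sum F x y + G x y) UNIV"
      by (simp add: case_prod_unfold algebra_simps)
  qed (use 1 2 in auto)
qed

lemma double_power_series_monomial_mult:
  assumes "double_power_series F"
  shows "double_power_series (\<lambda>x y. of_real x ^ m * of_real y ^ n * F x y)"
proof -
  obtain c \<eta> where 1: "\<eta> > 0" "\<And>x y. \<bar>x\<bar> < \<eta> \<Longrightarrow> \<bar>y\<bar> < \<eta> \<Longrightarrow>
     ((\<lambda>(i, j). c i j * of_real x ^ i * of_real y ^ j) has_sum F x y) UNIV"
    using assms unfolding double_power_series_def by blast
  define d where "d i j = (if m \<le> i \<and> n \<le> j then c (i - m) (j - n) else 0)" for i j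
  let ?h = "\<lambda>(i, j). (i + m, j + n)"
  show ?thesis
    unfolding double_power_series_def
  proof (intro exI[of _ d] exI[of _ \<eta>] conjI allI impI)
    fix x y :: real assume xy: "\<bar>x\<bar> < \<eta>" "\<bar>y\<bar> < \<eta>"
    let ?f = "\<lambda>(i, j). d i j * of_real x ^ i * of_real y ^ j :: complex"
    have "((\<lambda>z. of_real x ^ m * of_real y ^ n * (\<lambda>(i, j). c i j * of_real x ^ i * of_real y ^ j) z)
        has_sum of_real x ^ m * of_real y ^ n * F x y) UNIV"
      by (intro has_sum_cmult_right 1 xy)
    also have "(\<lambda>z. of_real x ^ m * of_real y ^ n * (\<lambda>(i, j). c i j * of_real x ^ i * of_real y ^ j) z)
        = ?f \<circ> ?h"
      by (auto simp: d_def power_add)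
    also have "(?f \<circ> ?h has_sum of_real x ^ m * of_real y ^ n * F x y) UNIV \<longleftrightarrow>
        (?f has_sum of_real x ^ m * of_real y ^ n * F x y) (range ?h)"
      by (rule has_sum_reindex[symmetric]) (auto simp: inj_on_def)
    also have "\<dots> \<longleftrightarrow> (?f has_sum of_real x ^ m * of_real y ^ n * F x y) UNIV"
    proof (rule has_sum_cong_neutral)
      fix z assume "z \<in> UNIV - range ?h"
      then have "\<not> (m \<le> fst z \<and> n \<le> snd z)"
        using image_eqI[of z ?h "(fst z - m, snd z - n)" UNIV] by auto
      then show "?f z = 0" by (auto simp: d_def case_prod_unfold)
    qed auto
    finally show "(?f has_sum of_real x ^ m * of_real y ^ n * F x y) UNIV" .
  qed (rule 1)
qed

lemma double_power_series_cmult: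
  assumes "double_power_series F"
  shows "double_power_series (\<lambda>x y. a * F x y)"
proof -
  obtain c \<eta> where 1: "\<eta> > 0" "\<And>x y. \<bar>x\<bar> < \<eta> \<Longrightarrow> \<bar>y\<bar> < \<eta> \<Longrightarrow>
     ((\<lambda>(i, j). c i j * of_real x ^ i * of_real y ^ j) has_sum F x y) UNIV"
    using assms unfolding double_power_series_def by blast
  show ?thesis
    unfolding double_power_series_def
  proof (intro exI[of _ "\<lambda>i j. a * c i j"] exI[of _ \<eta>] conjI allI impI)
    fix x y :: real assume "\<bar>x\<bar> < \<eta>" "\<bar>y\<bar> < \<eta>"
    from has_sum_cmult_right[OF 1(2)[OF this], of a]
    show "((\<lambda>(i, j). a * c i j * of_real x ^ i * of_real y ^ j) has_sum a * F x y) UNIV"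
      by (simp add: case_prod_unfold mult.assoc)
  qed (rule 1)
qed

lemma analytic_within_double_power_series:
  assumes "double_power_series F"
    and "\<eta> > 0" "\<And>x y. \<bar>x\<bar> < \<eta> \<Longrightarrow> \<bar>y\<bar> < \<eta> \<Longrightarrow> (fst b + x, snd b + y) \<in> S \<Longrightarrow>
      F x y = complex_of_real (f (fst b + x, snd b + y))"
  shows "analytic_within S f b"
proof -
  obtain c \<eta>' where 1: "\<eta>' > 0" "\<And>x y. \<bar>x\<bar> < \<eta>' \<Longrightarrow> \<bar>y\<bar> < \<eta>' \<Longrightarrow>
     ((\<lambda>(i, j). c i j * of_real x ^ i * of_real y ^ j) has_sum F x y) UNIV"
    using assms unfolding double_power_series_def by blast
  show ?thesis
    unfolding analytic_within_def
  proof (intro exI[of _ "\<lambda>i j. Re (c i j)"] exI[of _ "min \<eta> \<eta>'"] conjI allI impI)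
    fix x y assume "(x, y) \<in> S" "\<bar>x - fst b\<bar> < min \<eta> \<eta>'" "\<bar>y - snd b\<bar> < min \<eta> \<eta>'"
    then have "((\<lambda>(i, j). c i j * of_real (x - fst b) ^ i * of_real (y - snd b) ^ j)
        has_sum complex_of_real (f (x, y))) UNIV"
      using 1(2)[of "x - fst b" "y - snd b"] assms(3)[of "x - fst b" "y - snd b"] by simp
    from has_sum_bounded_linear[OF bounded_linear_Re this]
    show "((\<lambda>(i, j). Re (c i j) * (x - fst b) ^ i * (y - snd b) ^ j) has_sum f (x, y)) UNIV"
      by (simp add: case_prod_unfold mult.assoc flip: of_real_power of_real_mult of_real_diff)
  qed (use 1 assms in auto)
qed

text \<open>On the circle \<open>1 / (f + (x + y g))\<close> is expanded into a double geometric series, which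
  converges uniformly and can be integrated term by term.\<close>

lemma double_power_series_circle_integral:
  fixes f g h :: "complex \<Rightarrow> complex"
  assumes "\<rho> > 0" and cont: "continuous_on (sphere z0 \<rho>) f" "continuous_on (sphere z0 \<rho>) g"
      "continuous_on (sphere z0 \<rho>) h"
    and nz: "\<And>z. z \<in> sphere z0 \<rho> \<Longrightarrow> f z \<noteq> 0"
  shows "double_power_series (\<lambda>x y. contour_integral (circlepath z0 \<rho>)
    (\<lambda>z. h z / (f z + of_real x + of_real y * g z)))"
proof -
  have cpt: "compact (sphere z0 \<rho>)" by simp
  have ne: "sphere z0 \<rho> \<noteq> {}" using \<open>\<rho> > 0\<close> by simp
  obtain B where B: "B > 0" "\<And>z. z \<in> sphere z0 \<rho> \<Longrightarrow> norm (g z) \<le> B"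
    using compact_imp_bounded[OF compact_continuous_image[OF cont(2) cpt]] unfolding bounded_pos by auto
  obtain D where D: "D > 0" "\<And>z. z \<in> sphere z0 \<rho> \<Longrightarrow> norm (h z) \<le> D"
    using compact_imp_bounded[OF compact_continuous_image[OF cont(3) cpt]] unfolding bounded_pos by auto
  obtain z1 where z1: "z1 \<in> sphere z0 \<rho>" "\<And>z. z \<in> sphere z0 \<rho> \<Longrightarrow> norm (f z1) \<le> norm (f z)"
    using continuous_attains_inf[OF cpt ne continuous_on_norm[OF cont(1)]] by blast
  define \<delta> where "\<delta> = norm (f z1)"
  have \<delta>: "\<delta> > 0" "\<And>z. z \<in> sphere z0 \<rho> \<Longrightarrow> \<delta> \<le> norm (f z)" using z1 nz by (auto simp: \<delta>_def)
  \<comment> \<open>for parameters below \<open>\<eta>\<close> the ratio of the geometric series is at most 1/2\<close>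
  define \<eta> where "\<eta> = \<delta> / (2 * (1 + B))"
  have \<eta>_pos: "\<eta> > 0" using \<delta>(1) B(1) by (simp add: \<eta>_def)
  have "\<eta> / \<delta> + \<eta> * B / \<delta> = \<eta> * (1 + B) / \<delta>" by (simp add: add_divide_distrib distrib_left)
  also have "\<dots> = 1 / 2" using \<delta>(1) B(1) by (simp add: \<eta>_def)
  finally have "\<eta> / \<delta> + \<eta> * B / \<delta> < 1" by linarith
  note \<eta> = \<eta>_pos this
  define t where "t i j z = (-1) ^ (i + j) * of_nat ((i + j) choose i) * g z ^ j * h z / f z ^ (i + j + 1)" for i j z
  let ?\<gamma> = "circlepath z0 \<rho>"
  have t_cont: "continuous_on (sphere z0 \<rho>) (t i j)" for i j
    unfolding t_def using nz by (intro continuous_intros cont) auto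
  define c where "c i j = contour_integral ?\<gamma> (t i j)" for i j
  show ?thesis
    unfolding double_power_series_def
  proof (intro exI[of _ c] exI[of _ \<eta>] conjI allI impI)
    fix x y :: real assume xy: "\<bar>x\<bar> < \<eta>" "\<bar>y\<bar> < \<eta>"
    let ?T = "\<lambda>ij z. t (fst ij) (snd ij) z * of_real x ^ fst ij * of_real y ^ snd ij"
    let ?l = "\<lambda>z. h z / (f z + of_real x + of_real y * g z)"
    define M where "M = (\<lambda>(i, j). D / \<delta> * (real ((i + j) choose i) * (\<bar>x\<bar> / \<delta>) ^ i * (\<bar>y\<bar> * B / \<delta>) ^ j))"
    have small: "\<bar>x\<bar> / \<delta> + \<bar>y\<bar> * B / \<delta> < 1"
    proof -
      have "\<bar>x\<bar> / \<delta> \<le> \<eta> / \<delta>" "\<bar>y\<bar> * B / \<delta> \<le> \<eta> * B / \<delta>"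
        using xy \<delta>(1) B(1) by (auto intro!: divide_right_mono mult_right_mono)
      then show ?thesis using \<eta>(2) by linarith
    qed
    have "uniform_limit (sphere z0 \<rho>) (\<lambda>X z. \<Sum>ij\<in>X. ?T ij z) ?l (finite_subsets_at_top UNIV)"
    proof (rule Weierstrass_m_test_general'[where M = M])
      show "M summable_on UNIV"
        unfolding M_def case_prod_unfold
        using double_geometric_real[of "\<bar>x\<bar> / \<delta>" "\<bar>y\<bar> * B / \<delta>"] small \<delta>(1) B(1)
        by (intro summable_on_cmult_right) (simp add: case_prod_unfold)
      fix z assume z: "z \<in> sphere z0 \<rho>"
      let ?a = "- of_real x / f z" and ?b = "- of_real y * g z / f z"
      have fz: "f z \<noteq> 0" "norm (f z) > 0" using nz[OF z] by auto
      have na: "norm ?a \<le> \<bar>x\<bar> / \<delta>" using \<delta>(2)[OF z] \<delta>(1) by (auto simp: norm_divide intro!: frac_le)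
      have nb: "norm ?b \<le> \<bar>y\<bar> * B / \<delta>"
        using \<delta>(2)[OF z] \<delta>(1) B(2)[OF z] B(1)
        by (auto simp: norm_divide norm_mult intro!: frac_le mult_left_mono mult_nonneg_nonneg)
      have T: "?T (i, j) z = h z / f z * (of_nat ((i + j) choose i) * ?a ^ i * ?b ^ j)" for i j
      proof -
        have "?a ^ i = (-1) ^ i * of_real x ^ i / f z ^ i"
          by (simp only: power_divide power_minus[of "of_real x"])
        moreover have "?b ^ j = (-1) ^ j * of_real y ^ j * g z ^ j / f z ^ j"
          by (simp only: power_divide power_mult_distrib power_minus[of "of_real y"])
        ultimately show ?thesis by (simp add: t_def power_add)
      qed
      have "((\<lambda>ij. h z / f z * (\<lambda>(i, j). of_nat ((i + j) choose i) * ?a ^ i * ?b ^ j) ij) has_sum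
          h z / f z * (1 / (1 - (?a + ?b)))) UNIV"
        using na nb small by (intro has_sum_cmult_right double_geometric) linarith
      moreover have "h z / f z * (1 / (1 - (?a + ?b))) = ?l z"
      proof -
        have "f z * (1 - (?a + ?b)) = f z + of_real x + of_real y * g z"
          using fz by (simp add: field_simps)
        then show ?thesis by (metis divide_divide_eq_left mult.right_neutral times_divide_eq_right)
      qed
      moreover have "(\<lambda>ij. h z / f z * (\<lambda>(i, j). of_nat ((i + j) choose i) * ?a ^ i * ?b ^ j) ij) = (\<lambda>ij. ?T ij z)"
        using T by (auto simp: fun_eq_iff)
      ultimately show "((\<lambda>ij. ?T ij z) has_sum ?l z) UNIV" by (simp only:)
      fix ij :: "nat \<times> nat"
      obtain i j where ij: "ij = (i, j)" by fastforce
      have "norm (?T ij z) = norm (h z) / norm (f z) * (real ((i + j) choose i) * norm ?a ^ i * norm ?b ^ j)"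
        unfolding ij T by (simp add: norm_mult norm_divide norm_power)
      also have "\<dots> \<le> D / \<delta> * (real ((i + j) choose i) * (\<bar>x\<bar> / \<delta>) ^ i * (\<bar>y\<bar> * B / \<delta>) ^ j)"
        using na nb \<delta>(1) \<delta>(2)[OF z] D(2)[OF z] B(1) D(1)
        by (intro mult_mono frac_le power_mono mult_left_mono mult_nonneg_nonneg zero_le_power divide_nonneg_pos) auto
      finally show "norm (?T ij z) \<le> M ij" by (simp add: ij M_def)
    qed
    moreover have int: "(?T ij) contour_integrable_on ?\<gamma>" for ij
      using \<open>\<rho> > 0\<close> t_cont
      by (intro contour_integrable_continuous_circlepath) (auto intro!: continuous_intros)
    then have "\<forall>\<^sub>F X in finite_subsets_at_top UNIV. (\<lambda>z. \<Sum>ij\<in>X. ?T ij z) contour_integrable_on ?\<gamma>"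
      by (intro eventually_finite_subsets_at_top_weakI contour_integrable_sum) auto
    ultimately have "((\<lambda>X. contour_integral ?\<gamma> (\<lambda>z. \<Sum>ij\<in>X. ?T ij z)) \<longlongrightarrow> contour_integral ?\<gamma> ?l)
        (finite_subsets_at_top UNIV)"
      using \<open>\<rho> > 0\<close> by (intro contour_integral_uniform_limit_circlepath(2)) auto
    moreover have "\<forall>\<^sub>F X in finite_subsets_at_top UNIV. contour_integral ?\<gamma> (\<lambda>z. \<Sum>ij\<in>X. ?T ij z) =
        (\<Sum>ij\<in>X. c (fst ij) (snd ij) * of_real x ^ fst ij * of_real y ^ snd ij)"
    proof (rule eventually_finite_subsets_at_top_weakI)
      fix X :: "(nat \<times> nat) set" assume "finite X"
      then have "contour_integral ?\<gamma> (\<lambda>z. \<Sum>ij\<in>X. ?T ij z) = (\<Sum>ij\<in>X. contour_integral ?\<gamma> (?T ij))"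
        using int by (intro contour_integral_sum) auto
      moreover have "contour_integral ?\<gamma> (?T (i, j)) = c i j * of_real x ^ i * of_real y ^ j" for i j
        using contour_integral_rmul[of "t i j" ?\<gamma> "of_real x ^ i * of_real y ^ j"]
          contour_integrable_continuous_circlepath[of z0 \<rho> "t i j"] t_cont \<open>\<rho> > 0\<close>
        by (simp add: c_def mult.assoc)
      ultimately show "contour_integral ?\<gamma> (\<lambda>z. \<Sum>ij\<in>X. ?T ij z) =
        (\<Sum>ij\<in>X. c (fst ij) (snd ij) * of_real x ^ fst ij * of_real y ^ snd ij)" by simp
    qed
    ultimately show "((\<lambda>(i, j). c i j * of_real x ^ i * of_real y ^ j) has_sum contour_integral ?\<gamma> ?l) UNIV"
      unfolding has_sum_def case_prod_unfold by (rule Lim_transform_eventually)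
  qed (rule \<eta>)
qed

text \<open>The argument principle with a weight \<open>g\<close>, for a single simple zero.\<close>

lemma simple_zero_circle_integral:
  assumes "0 < \<rho>" "\<rho> < r" and f: "f holomorphic_on ball z0 r" and g: "g holomorphic_on ball z0 r"
    and t: "t \<in> ball z0 \<rho>" "f t = 0" "deriv f t \<noteq> 0"
    and only: "\<And>z. z \<in> ball z0 r \<Longrightarrow> f z = 0 \<Longrightarrow> z = t"
  shows "contour_integral (circlepath z0 \<rho>) (\<lambda>z. deriv f z * g z / f z) = 2 * of_real pi * \<i> * g t"
proof -
  have tr: "t \<in> ball z0 r" using t assms by auto
  have zeros: "{w \<in> ball z0 r. f w = 0 \<or> w \<in> {}} = {t}"
    using t(2) tr only by blast
  have "sphere z0 \<rho> \<subseteq> ball z0 r" using assms by auto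
  moreover have "t \<notin> sphere z0 \<rho>" using t by auto
  ultimately have path: "path_image (circlepath z0 \<rho>) \<subseteq> ball z0 r - {w \<in> ball z0 r. f w = 0 \<or> w \<in> {}}"
    unfolding zeros using \<open>0 < \<rho>\<close> by auto
  have "zorder f t = 1"
    using f t(2,3) tr by (intro zorder_zero_eqI[where S = "ball z0 r"]) auto
  moreover have "winding_number (circlepath z0 \<rho>) t = 1"
    using t(1) by (intro winding_number_circlepath) (simp add: dist_norm norm_minus_commute)
  moreover have "winding_number (circlepath z0 \<rho>) z = 0" if "z \<notin> ball z0 r" for z
    using that path by (intro winding_number_zero_outside[of _ "ball z0 r"]) auto
  moreover have "contour_integral (circlepath z0 \<rho>) (\<lambda>z. deriv f z * g z / f z) = 2 * pi * \<i> *
      (\<Sum>p\<in>{w \<in> ball z0 r. f w = 0 \<or> w \<in> {}}. winding_number (circlepath z0 \<rho>) p * g p * zorder f p)"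
  proof (rule argument_principle)
    show "\<forall>z. z \<notin> ball z0 r \<longrightarrow> winding_number (circlepath z0 \<rho>) z = 0" using calculation by blast
    show "finite {w \<in> ball z0 r. f w = 0 \<or> w \<in> {}}" unfolding zeros by simp
  qed (use f g path in auto)
  ultimately show ?thesis unfolding zeros by simp
qed

text \<open>A holomorphic function that extends a real function has a derivative that extends the real
  derivative.\<close>

lemma deriv_of_real_trace:
  assumes f: "f holomorphic_on ball (of_real x) r"
    and trace: "\<And>t. \<bar>t - x\<bar> < r \<Longrightarrow> f (of_real t) = of_real (h t)"
    and h: "(h has_real_derivative d) (at s)" and s: "\<bar>s - x\<bar> < r"
  shows "deriv f (complex_of_real s) = of_real d"
proof -
  have "of_real s \<in> ball (complex_of_real x) r"
    using s by (simp add: dist_norm norm_minus_commute flip: of_real_diff)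
  then have "(f has_field_derivative deriv f (of_real s)) (at (of_real s))"
    using f holomorphic_derivI open_ball by blast
  then have "((\<lambda>t. f (of_real t)) has_vector_derivative deriv f (of_real s)) (at s)"
    by (rule has_vector_derivative_real_field)
  moreover have "((\<lambda>t. f (of_real t)) has_vector_derivative of_real d) (at s)"
  proof (rule has_vector_derivative_transform_within_open)
    show "((\<lambda>t. complex_of_real (h t)) has_vector_derivative of_real d) (at s)"
      using h by (rule has_vector_derivative_of_real)
    show "open (ball x r)" "s \<in> ball x r" using s by (auto simp: dist_real_def)
    show "complex_of_real (h t) = f (of_real t)" if "t \<in> ball x r" for t
      using trace[of t] that by (simp add: dist_real_def abs_minus_commute)
  qed
  ultimately show ?thesis by (rule vector_derivative_unique_at)
qed

context sigmoid_tilt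
begin

text \<open>Near \<open>b\<close> the maximizer is the only zero of \<open>slope\<close>, extended to a complex disc, and it is
  simple.  The argument principle expresses the value of \<open>ell\<close> at this zero as the circle integral of
  \<open>ell\<close> times the logarithmic derivative of \<open>slope\<close>.  The denominator \<open>slope\<close> is affine in the parameters
  and the numerator is a polynomial in them.\<close>

lemma analytic_on_pure_phase:
  assumes b: "b \<in> pure_phase" and agree: "\<And>\<beta>. \<beta> \<in> parameter_space \<Longrightarrow> \<psi> \<beta> = val UNIV \<beta>"
  shows "analytic_within parameter_space \<psi> b"
proof -
  define \<tau> where "\<tau> = \<Theta> b"
  define D where "D = snd b * dq \<tau> - 1 / 2"
  have "D < 0" using pure_phase_nondegenerate[OF b] by (simp add: D_def \<tau>_def)
  obtain Kc R where "R > 0" and Kc: "Kc holomorphic_on ball (complex_of_real \<tau>) R"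
    and Kc_real: "\<And>t. \<bar>t - \<tau>\<bar> < R \<Longrightarrow> Kc (complex_of_real t) = complex_of_real (K t)"
    using K_extends[of \<tau>] by blast
  let ?B = "ball (complex_of_real \<tau>)"
  define \<kappa> where "\<kappa> = deriv Kc"
  define Q where "Q z = of_nat p * \<kappa> z ^ (p - 1)" for z
  define Q' where "Q' = deriv Q"
  have \<kappa>: "\<kappa> holomorphic_on ?B R" unfolding \<kappa>_def using Kc by (intro holomorphic_deriv) auto
  have \<kappa>_real: "\<kappa> (complex_of_real t) = of_real (K1 t)" if "\<bar>t - \<tau>\<bar> < R" for t
    unfolding \<kappa>_def by (rule deriv_of_real_trace[OF Kc Kc_real K_deriv that])
  have Q: "Q holomorphic_on ?B R" unfolding Q_def by (intro holomorphic_intros \<kappa>)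
  have Q_real: "Q (complex_of_real t) = of_real (q t)" if "\<bar>t - \<tau>\<bar> < R" for t
    using \<kappa>_real[OF that] by (simp add: Q_def q_def)
  have Q': "Q' holomorphic_on ?B R" unfolding Q'_def using Q by (intro holomorphic_deriv) auto
  have Q_deriv: "(Q has_field_derivative Q' z) (at z)" if "z \<in> ?B R" for z
    unfolding Q'_def using holomorphic_derivI[OF Q open_ball that] .
  have Q'\<tau>: "Q' (of_real \<tau>) = of_real (dq \<tau>)"
    unfolding Q'_def by (rule deriv_of_real_trace[OF Q Q_real q_deriv]) (use \<open>R > 0\<close> in auto)
  have quarter: "a * (c / (4 * a)) = c / 4" if "a \<noteq> 0" for a c :: real using that by simp
  \<comment> \<open>on a disc where \<open>Q'\<close> varies by at most \<open>e\<close>, the derivative of \<open>slope\<close> stays within \<open>\<bar>D\<bar> / 2\<close> of \<open>D\<close>\<close>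
  define e where "e = min 1 (\<bar>D\<bar> / (4 * (\<bar>snd b\<bar> + 1)))"
  have "0 < \<bar>D\<bar> / (4 * (\<bar>snd b\<bar> + 1))" using \<open>D < 0\<close> by (intro divide_pos_pos) auto
  then have e: "e > 0" "e \<le> 1" unfolding e_def by simp_all
  have e': "\<bar>snd b\<bar> * e \<le> \<bar>D\<bar> / 4"
  proof -
    have "\<bar>snd b\<bar> * e \<le> (\<bar>snd b\<bar> + 1) * (\<bar>D\<bar> / (4 * (\<bar>snd b\<bar> + 1)))"
      using e by (intro mult_mono) (auto simp: e_def)
    also have "\<dots> = \<bar>D\<bar> / 4" by (rule quarter) linarith
    finally show ?thesis .
  qed
  have "isCont Q' (of_real \<tau>)"
    using holomorphic_on_imp_continuous_on[OF Q'] \<open>R > 0\<close> by (simp add: continuous_on_eq_continuous_at)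
  then obtain r0 where r0: "r0 > 0" "\<And>z. dist z (of_real \<tau>) < r0 \<Longrightarrow> dist (Q' z) (Q' (of_real \<tau>)) < e"
    using \<open>e > 0\<close> unfolding continuous_at_eps_delta by blast
  define r where "r = min r0 R"
  define \<rho> where "\<rho> = r / 2"
  have r: "0 < r" "r \<le> R" "0 < \<rho>" "\<rho> < r" using r0 \<open>R > 0\<close> by (auto simp: r_def \<rho>_def)
  have Q'_near: "norm (Q' z - of_real (dq \<tau>)) \<le> e" if "z \<in> ?B r" for z
    using r0(2)[of z] that Q'\<tau> by (simp add: r_def dist_norm norm_minus_commute)
  define m where "m x y z = of_real (fst b) + of_real x + (of_real (snd b) + of_real y) * Q z - z / 2"
    for x y :: real and z :: complex
  define m' where "m' y z = (of_real (snd b) + of_real y) * Q' z - 1 / 2" for y :: real and z :: complex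
  define g where "g x y z = (of_real (fst b) + of_real x) * \<kappa> z + (of_real (snd b) + of_real y) * \<kappa> z ^ p
      - (z * \<kappa> z - Kc z) / 2" for x y :: real and z :: complex
  define \<eta>1 where "\<eta>1 = \<bar>D\<bar> / (4 * (dq \<tau> + 1))"
  have \<eta>1: "\<eta>1 > 0" unfolding \<eta>1_def using \<open>D < 0\<close> dq_pos[of \<tau>] by (intro divide_pos_pos) auto
  have m_deriv: "(m x y has_field_derivative m' y z) (at z)" if "z \<in> ?B r" for x y z
    unfolding m_def m'_def using that r by (auto intro!: derivative_eq_intros Q_deriv)
  have m'_near: "norm (m' y z - of_real D) \<le> \<bar>D\<bar> / 2" if "z \<in> ?B r" "\<bar>y\<bar> < \<eta>1" for y z
  proof -
    have "m' y z - of_real D = of_real (snd b) * (Q' z - of_real (dq \<tau>)) + of_real y * Q' z"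
      by (simp add: m'_def D_def algebra_simps)
    also have "norm \<dots> \<le> \<bar>snd b\<bar> * norm (Q' z - of_real (dq \<tau>)) + \<bar>y\<bar> * norm (Q' z)"
      by (rule norm_triangle_le) (simp add: norm_mult)
    also have "\<dots> \<le> \<bar>snd b\<bar> * e + \<eta>1 * (dq \<tau> + 1)"
    proof (intro add_mono mult_mono mult_left_mono Q'_near that)
      have "norm (Q' z) \<le> norm (complex_of_real (dq \<tau>)) + norm (Q' z - of_real (dq \<tau>))"
        by (metis add_diff_cancel_left' diff_add_cancel norm_triangle_ineq add.commute)
      then show "norm (Q' z) \<le> dq \<tau> + 1" using Q'_near[OF that(1)] e dq_pos[of \<tau>] by simp
    qed (use that \<eta>1 in auto)
    also have "\<eta>1 * (dq \<tau> + 1) = \<bar>D\<bar> / 4"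
      using quarter[of "dq \<tau> + 1" "\<bar>D\<bar>"] dq_pos[of \<tau>] by (simp add: \<eta>1_def mult.commute)
    finally show ?thesis using e' by simp
  qed
  have m_inj: "\<bar>D\<bar> / 2 * norm (z - w) \<le> norm (m x y z - m x y w)"
    if "z \<in> ?B r" "w \<in> ?B r" "\<bar>y\<bar> < \<eta>1" for x y z w
  proof -
    have "norm ((m x y z - of_real D * z) - (m x y w - of_real D * w)) \<le> \<bar>D\<bar> / 2 * norm (z - w)"
    proof (rule field_differentiable_bound[OF convex_ball, where f' = "\<lambda>z. m' y z - of_real D"])
      show "((\<lambda>z. m x y z - of_real D * z) has_field_derivative m' y u - of_real D) (at u within ?B r)"
        if "u \<in> ?B r" for u
        using that by (auto intro!: derivative_eq_intros has_field_derivative_at_within[OF m_deriv])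
    qed (use that m'_near in auto)
    moreover have "(m x y z - of_real D * z) - (m x y w - of_real D * w) =
        (m x y z - m x y w) - of_real D * (z - w)" by (simp add: algebra_simps)
    moreover have "norm (complex_of_real D * (z - w)) = \<bar>D\<bar> * norm (z - w)" by (simp add: norm_mult)
    ultimately show ?thesis
      using norm_triangle_ineq2[of "of_real D * (z - w)" "m x y z - m x y w"]
      by (simp add: norm_minus_commute algebra_simps)
  qed
  have m_real: "m x y (of_real t) = of_real (slope (fst b + x, snd b + y) t)" if "\<bar>t - \<tau>\<bar> < r" for x y t
    using Q_real[of t] that r by (simp add: m_def slope_def)
  have g_real: "g x y (of_real t) = of_real (ell (fst b + x, snd b + y) t)" if "\<bar>t - \<tau>\<bar> < r" for x y t
    using \<kappa>_real[of t] Kc_real[of t] that r by (simp add: g_def ell_def)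
  have near_real: "of_real t \<in> ?B s \<longleftrightarrow> \<bar>t - \<tau>\<bar> < s" for t s
    by (simp add: dist_norm norm_minus_commute flip: of_real_diff) (simp add: abs_minus_commute)
  \<comment> \<open>the maximizer stays in the disc for nearby parameters\<close>
  obtain d where d: "d > 0" "\<And>\<beta>. dist \<beta> b < d \<Longrightarrow> dist (\<Theta> \<beta>) \<tau> < \<rho>"
    using isCont_\<Theta>[OF pure_phase_regular[OF b]] r unfolding continuous_at_eps_delta \<tau>_def by blast
  define \<eta> where "\<eta> = min \<eta>1 (d / 2)"
  have \<eta>: "\<eta> > 0" "\<eta> \<le> \<eta>1" using \<eta>1 d by (auto simp: \<eta>_def)
  let ?\<gamma> = "circlepath (complex_of_real \<tau>) \<rho>"
  have sphere: "sphere (complex_of_real \<tau>) \<rho> \<subseteq> ?B r" using r by auto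
  let ?t = "\<lambda>x y. \<Theta> (fst b + x, snd b + y)"
  have t_near: "\<bar>?t x y - \<tau>\<bar> < \<rho>" if "\<bar>x\<bar> < \<eta>" "\<bar>y\<bar> < \<eta>" for x y
  proof -
    have "dist (fst b + x, snd b + y) b \<le> \<bar>x\<bar> + \<bar>y\<bar>"
      using sqrt_sum_squares_le_sum_abs[of x y] by (cases b) (simp add: dist_Pair_Pair dist_real_def)
    also have "\<dots> < d" using that by (simp add: \<eta>_def)
    finally show ?thesis using d(2) by (simp add: dist_real_def)
  qed
  have t_zero: "m x y (of_real (?t x y)) = 0" if "\<bar>x\<bar> < \<eta>" "\<bar>y\<bar> < \<eta>" for x y
    using m_real[of "?t x y"] t_near[OF that] r maximizer_slope[OF \<Theta>_maximizer] by simp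
  have only: "z = of_real (?t x y)" if "z \<in> ?B r" "m x y z = 0" "\<bar>x\<bar> < \<eta>" "\<bar>y\<bar> < \<eta>" for x y z
  proof -
    have "of_real (?t x y) \<in> ?B r" using near_real t_near[OF that(3,4)] r by simp
    then have "\<bar>D\<bar> / 2 * norm (z - of_real (?t x y)) \<le> 0"
      using m_inj[OF that(1), of "of_real (?t x y)" y x] that t_zero[OF that(3,4)] \<eta> by simp
    moreover have "0 < \<bar>D\<bar> / 2 * norm (z - of_real (?t x y))" if "z \<noteq> of_real (?t x y)"
      using that \<open>D < 0\<close> by (intro mult_pos_pos) auto
    ultimately show ?thesis by fastforce
  qed
  have m_holo: "m x y holomorphic_on ?B r" for x y
    unfolding holomorphic_on_def field_differentiable_def
    using m_deriv has_field_derivative_at_within by blast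
  have \<kappa>r: "\<kappa> holomorphic_on ?B r" "Kc holomorphic_on ?B r" "Q holomorphic_on ?B r" "Q' holomorphic_on ?B r"
    using \<kappa> Kc Q Q' r by (auto intro: holomorphic_on_subset subset_ball)
  have g_holo: "g x y holomorphic_on ?B r" for x y
    unfolding g_def by (intro holomorphic_intros \<kappa>r) auto
  have nonzero: "m x y z \<noteq> 0" if "z \<in> sphere (of_real \<tau>) \<rho>" "\<bar>x\<bar> < \<eta>" "\<bar>y\<bar> < \<eta>" for x y z
  proof
    assume "m x y z = 0"
    then have "z = of_real (?t x y)" using only that sphere by blast
    then have "of_real (?t x y) \<in> sphere (complex_of_real \<tau>) \<rho>" using that by simp
    moreover have "of_real (?t x y) \<in> ?B \<rho>" using near_real t_near[OF that(2,3)] by simp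
    ultimately show False by simp
  qed
  have cauchy: "contour_integral ?\<gamma> (\<lambda>z. m' y z * g x y z / m x y z) =
      2 * of_real pi * \<i> * of_real (val UNIV (fst b + x, snd b + y))" if xy: "\<bar>x\<bar> < \<eta>" "\<bar>y\<bar> < \<eta>" for x y
  proof -
    have t_in: "of_real (?t x y) \<in> ?B \<rho>" "of_real (?t x y) \<in> ?B r" using near_real t_near[OF xy] r by simp_all
    have deriv_m: "deriv (m x y) z = m' y z" if "z \<in> ?B r" for z
      using m_deriv[OF that] by (rule DERIV_imp_deriv)
    have "m' y (of_real (?t x y)) \<noteq> 0"
      using m'_near[OF t_in(2), of y] xy \<eta> \<open>D < 0\<close> by auto
    then have "contour_integral ?\<gamma> (\<lambda>z. deriv (m x y) z * g x y z / m x y z) =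
        2 * of_real pi * \<i> * g x y (of_real (?t x y))"
      using r t_in t_zero[OF xy] only xy deriv_m[OF t_in(2)]
      by (intro simple_zero_circle_integral[where r = r] m_holo g_holo) auto
    moreover have "contour_integral ?\<gamma> (\<lambda>z. deriv (m x y) z * g x y z / m x y z) =
        contour_integral ?\<gamma> (\<lambda>z. m' y z * g x y z / m x y z)"
      using sphere r by (intro contour_integral_cong refl) (auto simp: deriv_m subset_iff)
    moreover have "g x y (of_real (?t x y)) = of_real (val UNIV (fst b + x, snd b + y))"
      using g_real[of "?t x y"] t_near[OF xy] r val_eq[OF \<Theta>_maximizer] by simp
    ultimately show ?thesis by simp
  qed
  \<comment> \<open>the numerator is a polynomial in the parameters\<close>
  define I where "I h x y = contour_integral ?\<gamma> (\<lambda>z. h z / (m 0 0 z + of_real x + of_real y * Q z))" for h x y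
  have cont: "continuous_on (sphere (of_real \<tau>) \<rho>) f" if "f holomorphic_on ?B r" for f
    using holomorphic_on_imp_continuous_on[OF that] sphere by (rule continuous_on_subset)
  have I: "double_power_series (I h)" if "h holomorphic_on ?B r" for h
    unfolding I_def using r \<eta> nonzero[of _ 0 0]
    by (intro double_power_series_circle_integral cont that m_holo \<kappa>r) auto
  define h1 where "h1 z = m' 0 z * g 0 0 z" for z
  define h2 where "h2 z = m' 0 z * \<kappa> z" for z
  define h3 where "h3 z = m' 0 z * \<kappa> z ^ p + g 0 0 z * Q' z" for z
  define h4 where "h4 z = Q' z * \<kappa> z" for z
  define h5 where "h5 z = Q' z * \<kappa> z ^ p" for z
  have m'_holo: "m' 0 holomorphic_on ?B r" unfolding m'_def by (intro holomorphic_intros \<kappa>r)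
  have h_holo: "h1 holomorphic_on ?B r" "h2 holomorphic_on ?B r" "h3 holomorphic_on ?B r"
      "h4 holomorphic_on ?B r" "h5 holomorphic_on ?B r"
    unfolding h1_def h2_def h3_def h4_def h5_def by (intro holomorphic_intros \<kappa>r m'_holo g_holo)+
  let ?F = "\<lambda>x y :: real. 1 / (2 * of_real pi * \<i>) * (of_real x ^ 0 * of_real y ^ 0 * I h1 x y + of_real x ^ 1 * of_real y ^ 0 * I h2 x y
      + of_real x ^ 0 * of_real y ^ 1 * I h3 x y + of_real x ^ 1 * of_real y ^ 1 * I h4 x y
      + of_real x ^ 0 * of_real y ^ 2 * I h5 x y)"
  have "double_power_series ?F"
    by (intro double_power_series_cmult double_power_series_add double_power_series_monomial_mult I h_holo)
  moreover have "?F x y = of_real (\<psi> (fst b + x, snd b + y))"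
    if xy: "\<bar>x\<bar> < \<eta>" "\<bar>y\<bar> < \<eta>" and S: "(fst b + x, snd b + y) \<in> parameter_space" for x y
  proof -
    have mxy: "m 0 0 z + of_real x + of_real y * Q z = m x y z" for z
      by (simp add: m_def algebra_simps)
    have int: "(\<lambda>z. c * (h z / m x y z)) contour_integrable_on ?\<gamma>" if "h holomorphic_on ?B r" for h c
      using r nonzero[OF _ xy] by (intro contour_integrable_continuous_circlepath)
        (auto intro!: continuous_intros cont[OF that] cont[OF m_holo])
    have lin: "c * I h x y = contour_integral ?\<gamma> (\<lambda>z. c * (h z / m x y z))" if "h holomorphic_on ?B r" for h c
      unfolding I_def mxy using int[OF that, of 1] by (subst contour_integral_lmul) simp_all
    have num: "m' y z * g x y z / m x y z = 1 * (h1 z / m x y z) + of_real x * (h2 z / m x y z)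
      + of_real y * (h3 z / m x y z) + (of_real x * of_real y) * (h4 z / m x y z)
      + of_real y ^ 2 * (h5 z / m x y z)" for z
    proof -
      have "m' y z * g x y z = h1 z + of_real x * h2 z + of_real y * h3 z
          + of_real x * of_real y * h4 z + of_real y ^ 2 * h5 z"
        by (simp add: m'_def g_def h1_def h2_def h3_def h4_def h5_def power2_eq_square algebra_simps)
      then show ?thesis by (simp add: add_divide_distrib)
    qed
    have "contour_integral ?\<gamma> (\<lambda>z. m' y z * g x y z / m x y z) = 1 * I h1 x y + of_real x * I h2 x y
      + of_real y * I h3 x y + (of_real x * of_real y) * I h4 x y + of_real y ^ 2 * I h5 x y"
      unfolding num
      by (simp only: lin[OF h_holo(1)] lin[OF h_holo(2)] lin[OF h_holo(3)] lin[OF h_holo(4)] lin[OF h_holo(5)]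
          contour_integral_add contour_integrable_add int[OF h_holo(1)] int[OF h_holo(2)]
          int[OF h_holo(3)] int[OF h_holo(4)] int[OF h_holo(5)])
    then have "?F x y = 1 / (2 * of_real pi * \<i>) * contour_integral ?\<gamma> (\<lambda>z. m' y z * g x y z / m x y z)"
      by simp
    also have "\<dots> = of_real (val UNIV (fst b + x, snd b + y))" unfolding cauchy[OF xy] by simp
    finally show ?thesis using agree[OF S] by simp
  qed
  ultimately show ?thesis using \<eta>(1) by (intro analytic_within_double_power_series)
qed

end

section \<open>The phase diagram\<close>

theorem corollary1:
  fixes \<mu> :: "real measure" and H\<^sub>2 :: sgraph and p :: nat
  assumes "real_distribution \<mu>"
    and "measure \<mu> {0..1} = 1"
    and "\<forall>a. measure \<mu> {a} \<noteq> 1"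
    and "simple_graph H\<^sub>2"
    and "card (snd H\<^sub>2) = p"
    and "p \<ge> 2"
    and "\<exists>!\<theta>::real.
           (deriv ^^ 3) (cumulant_gf \<mu>) \<theta> * deriv (cumulant_gf \<mu>) \<theta>
             = - (real p - 2) * ((deriv ^^ 2) (cumulant_gf \<mu>) \<theta>)\<^sup>2"
  shows "\<exists>(\<beta>\<^sub>1c::real) (\<beta>\<^sub>2c::real) (r :: real \<Rightarrow> real).
           continuous_on {..\<beta>\<^sub>1c} r \<and>
           (\<forall>x y. x < y \<longrightarrow> y \<le> \<beta>\<^sub>1c \<longrightarrow> r y < r x) \<and>
           r \<beta>\<^sub>1c = \<beta>\<^sub>2c \<and>
           (let \<psi> = psi_infinity \<mu> single_edge H\<^sub>2;
                curve = {(\<beta>\<^sub>1, r \<beta>\<^sub>1) | \<beta>\<^sub>1. \<beta>\<^sub>1 \<le> \<beta>\<^sub>1c};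
                P = parameter_space - curve
            in {Q. phase parameter_space \<psi> Q} = {P} \<and>
               (\<forall>\<beta>\<^sub>1<\<beta>\<^sub>1c. phase_transition parameter_space \<psi> P 1 (\<beta>\<^sub>1, r \<beta>\<^sub>1)) \<and>
               phase_transition parameter_space \<psi> P 2 (\<beta>\<^sub>1c, \<beta>\<^sub>2c))"
proof -
  interpret W: weight_distribution \<mu>
    using assms(1,2,3) by (simp add: weight_distribution_def weight_distribution_axioms_def)
  obtain \<theta>\<^sub>0 where unique: "\<And>\<theta>. W.K3 \<theta> * W.K1 \<theta> = - (real p - 2) * (W.K2 \<theta>)\<^sup>2 \<Longrightarrow> \<theta> = \<theta>\<^sub>0"
    using assms(7) unfolding W.higher_derivs by blast
  interpret T: sigmoid_tilt "cumulant_gf \<mu>" W.K1 W.K2 p \<theta>\<^sub>0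
    by unfold_locales
      (use W.K_deriv W.K1_deriv W.isCont_cumulant_derivs W.K2_pos W.K1_pos W.K1_le assms(6)
        W.curvature_unimodal[OF assms(6) unique] W.cumulant_extends in auto)
  let ?\<psi> = "psi_infinity \<mu> single_edge H\<^sub>2"
  have agree: "?\<psi> \<beta> = T.val UNIV \<beta>" if "\<beta> \<in> parameter_space" for \<beta>
  proof -
    have ell: "T.ell \<beta> = W.free_energy p (fst \<beta>) (snd \<beta>)"
      by (rule ext) (simp add: T.ell_def W.free_energy_def)
    have "T.ell \<beta> \<theta> \<le> T.val UNIV \<beta>" for \<theta> by (intro T.ell_le_val) auto
    moreover have "T.ell \<beta> (T.\<Theta> \<beta>) = T.val UNIV \<beta>" using T.val_eq[OF T.\<Theta>_maximizer] by simp
    ultimately have "(\<lambda>n. psi_n \<mu> single_edge H\<^sub>2 n (fst \<beta>, snd \<beta>)) \<longlonglongrightarrow> T.val UNIV \<beta>"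
      unfolding ell using that assms(4-6)
      by (intro W.psi_n_tendsto[where p = p and \<theta> = "T.\<Theta> \<beta>"]) (auto simp: parameter_space_def)
    then show ?thesis unfolding psi_infinity_def by (simp add: limI)
  qed
  show ?thesis
  proof (rule exI[of _ "fst T.critical_point"], rule exI[of _ T.critical_coupling],
      rule exI[of _ T.coexistence], unfold Let_def, fold T.pure_phase_eq, intro conjI allI impI)
    show "continuous_on {..fst T.critical_point} T.coexistence" by (rule T.coexistence_continuous)
    show "T.coexistence y < T.coexistence x" if "x < y" "y \<le> fst T.critical_point" for x y
      using that by (rule T.coexistence_decreasing)
    show "T.coexistence (fst T.critical_point) = T.critical_coupling" by (rule T.coexistence_critical)
    show "{Q. phase parameter_space ?\<psi> Q} = {T.pure_phase}"
      by (intro T.single_phase agree T.analytic_on_pure_phase)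
    show "phase_transition parameter_space ?\<psi> T.pure_phase 1 (x, T.coexistence x)"
      if "x < fst T.critical_point" for x
      by (rule T.first_order_transition[OF agree that])
    show "phase_transition parameter_space ?\<psi> T.pure_phase 2 (fst T.critical_point, T.critical_coupling)"
      using T.second_order_transition[OF agree] unfolding T.coexistence_critical .
  qed
qed

end
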